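(* Let $p$ be odd and let $D_n=(E(x_1,\dots,x_n)\otimes\mathbb{F}_p[y_1,\dots,y_n])^{GL_n(\mathbb{F}_p)}$ be the extended Dickson algebra. Let $g:D_n\to D_n$ be a degree-preserving $\mathcal{A}$-linear map with $g(x_1x_2\cdots x_nL_n^{p-2})\neq 0$ (note $x_1\cdots x_n L_n^{p-2}=M_{n;0,1,\dots,n-1}L_n^{p-2}$ spans the lowest positive degree of $D_n$). Then $g$ is bijective in every positive degree; i.e. $D_n$ is atomic as an $\mathcal{A}$-module.
   Context: $p$ odd prime, $\mathbb{F}_p=\mathbb{Z}/p$, $\mathcal{A}$ the mod $p$ Steenrod algebra (reduced powers $P^r$ and Bockstein $\beta$). $H^*(B(\mathbb{Z}/p)^n;\mathbb{F}_p)=E(x_1,\dots,x_n)\otimes\mathbb{F}_p[y_1,\dots,y_n]$, $|x_i|=1$, $|y_i|=2$, $\beta x_i=y_i$; $GL_n(\mathbb{F}_p)$ acts and the invariants $D_n$ form an $\mathcal{A}$-algebra. $L_n=\det(y_j^{p^{i-1}})_{1\le i,j\le n}$; for $0\le s_1<\dots<s_m\le n-1$ with complement $t_1<\dots<t_{n-m}$, $M_{n;s_1,\dots,s_m}=\sum_{\sigma\in S_n,\sigma(1)<\dots<\sigma(m)}\mathrm{sgn}(\sigma)x_{\sigma(1)}\cdots x_{\sigma(m)}y_{\sigma(m+1)}^{p^{t_1}}\cdots y_{\sigma(n)}^{p^{t_{n-m}}}$. By Mùi's theorem, $D_n$ is the tensor product of the Dickson algebra $\mathbb{F}_p[d_{n,1},\dots,d_{n,n}]$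 with the $\mathbb{F}_p$-span of $1$ and the elements $M_{n;s_1,\dots,s_m}L_n^{p-2}$ ($1\le m\le n$, $0\le s_1<\dots<s_m\le n-1$). A graded $\mathcal{A}$-module is called atomic if every degree-preserving $\mathcal{A}$-module endomorphism which is an isomorphism in the lowest positive degree is an isomorphism (in positive degrees). *)

theory Defs
  imports "HOL-Combinatorics.Permutations" "Berlekamp_Zassenhaus.Finite_Field"
begin

(* H^*(B(Z/p)^n; F_p) = E(x_0..x_{n-1}) (x) F_p[y_0..y_{n-1}], indices 0..n-1.
   A monomial (S,e) stands for x_{s_1} x_{s_2} ... x_{s_m} * prod_i y_i^(e i),
   where s_1 < ... < s_m lists S in increasing order.  An element is a
   finitely supported coefficient function on monomials. *)

type_synonym mono = "nat set \<times> (nat \<Rightarrow> nat)"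
type_synonym 'k elt = "mono \<Rightarrow> 'k"

definition supp :: "'k::zero elt \<Rightarrow> mono set" where
  "supp f = {m. f m \<noteq> 0}"

definition mono_ok :: "nat \<Rightarrow> mono \<Rightarrow> bool" where
  "mono_ok n m \<longleftrightarrow> fst m \<subseteq> {..<n} \<and> (\<forall>i\<ge>n. snd m i = 0)"

definition H :: "nat \<Rightarrow> 'k::zero elt set" where
  "H n = {f. finite (supp f) \<and> (\<forall>m\<in>supp f. mono_ok n m)}"

definition mdeg :: "nat \<Rightarrow> mono \<Rightarrow> nat" where
  "mdeg n m = card (fst m) + 2 * (\<Sum>i<n. snd m i)"

definition homog :: "nat \<Rightarrow> nat \<Rightarrow> 'k::zero elt \<Rightarrow> bool" where
  "homog n d f \<longleftrightarrow> (\<forall>m\<in>supp f. mdeg n m = d)"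

definition ezero :: "'k::zero elt" where
  "ezero = (\<lambda>_. 0)"

definition single :: "mono \<Rightarrow> 'k \<Rightarrow> 'k::zero elt" where
  "single m c = (\<lambda>m'. if m' = m then c else 0)"

definition eadd :: "'k::plus elt \<Rightarrow> 'k elt \<Rightarrow> 'k elt" where
  "eadd f g = (\<lambda>m. f m + g m)"

definition escale :: "'k::times \<Rightarrow> 'k elt \<Rightarrow> 'k elt" where
  "escale c f = (\<lambda>m. c * f m)"

definition lin_ext :: "(mono \<Rightarrow> 'k elt) \<Rightarrow> 'k::comm_ring_1 elt \<Rightarrow> 'k elt" where
  "lin_ext F f = (\<lambda>m. \<Sum>m'\<in>supp f. f m' * F m' m)"

(* sign for x_S * x_T = sign * x_{S \<union> T} (S, T disjoint) *)
definition xsign :: "nat set \<Rightarrow> nat set \<Rightarrow> 'k::comm_ring_1" where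
  "xsign S T = (-1) ^ card {(i,j). i \<in> S \<and> j \<in> T \<and> j < i}"

definition mono_mult :: "mono \<Rightarrow> mono \<Rightarrow> 'k::comm_ring_1 elt" where
  "mono_mult m1 m2 =
     (if fst m1 \<inter> fst m2 = {}
      then single (fst m1 \<union> fst m2, \<lambda>i. snd m1 i + snd m2 i) (xsign (fst m1) (fst m2))
      else ezero)"

definition emult :: "'k::comm_ring_1 elt \<Rightarrow> 'k elt \<Rightarrow> 'k elt" where
  "emult f g = (\<lambda>m. \<Sum>(m1,m2)\<in>supp f \<times> supp g. f m1 * g m2 * mono_mult m1 m2 m)"

definition eone :: "'k::comm_ring_1 elt" where
  "eone = single ({}, \<lambda>_. 0) 1"

definition epow :: "'k::comm_ring_1 elt \<Rightarrow> nat \<Rightarrow> 'k elt" where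
  "epow f k = (emult f ^^ k) eone"

definition GL :: "nat \<Rightarrow> (nat \<Rightarrow> nat \<Rightarrow> 'k::comm_ring_1) set" where
  "GL n = {A. \<exists>B. \<forall>i<n. \<forall>j<n. (\<Sum>k<n. A i k * B k j) = (if i = j then 1 else 0)}"

(* action of a matrix A: x_i \<mapsto> \<Sum>_j A j i x_j,  y_i \<mapsto> \<Sum>_j A j i y_j,
   extended to an algebra homomorphism *)
definition xlin :: "nat \<Rightarrow> (nat \<Rightarrow> nat \<Rightarrow> 'k::comm_ring_1) \<Rightarrow> nat \<Rightarrow> 'k elt" where
  "xlin n A i = (\<lambda>m. \<Sum>j<n. single ({j}, \<lambda>_. 0) (A j i) m)"

definition ylin :: "nat \<Rightarrow> (nat \<Rightarrow> nat \<Rightarrow> 'k::comm_ring_1) \<Rightarrow> nat \<Rightarrow> 'k elt" where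
  "ylin n A i = (\<lambda>m. \<Sum>j<n. single ({}, \<lambda>k. if k = j then 1 else 0) (A j i) m)"

definition act_mono :: "nat \<Rightarrow> (nat \<Rightarrow> nat \<Rightarrow> 'k::comm_ring_1) \<Rightarrow> mono \<Rightarrow> 'k elt" where
  "act_mono n A m =
     emult (foldr emult (map (xlin n A) (sorted_list_of_set (fst m))) eone)
           (foldr (\<lambda>i acc. emult (epow (ylin n A i) (snd m i)) acc) [0..<n] eone)"

definition act :: "nat \<Rightarrow> (nat \<Rightarrow> nat \<Rightarrow> 'k::comm_ring_1) \<Rightarrow> 'k elt \<Rightarrow> 'k elt" where
  "act n A f = lin_ext (act_mono n A) f"

definition D :: "nat \<Rightarrow> 'k::comm_ring_1 elt set" where
  "D n = {f \<in> H n. \<forall>A\<in>GL n. act n A f = f}"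

(* reduced power P^r:  P^r(x_S y^e) = x_S * \<Sum>_{|k|=r} \<Prod>_i C(e_i,k_i) y^(e + (p-1) k),
   i.e. the total power is multiplicative with P(x_i) = x_i, P(y_i) = y_i + y_i^p *)
definition Pmono :: "nat \<Rightarrow> nat \<Rightarrow> nat \<Rightarrow> mono \<Rightarrow> 'k::comm_ring_1 elt" where
  "Pmono n p r m =
     (\<lambda>m'. \<Sum>k\<in>{k. (\<forall>i. k i \<le> snd m i) \<and> (\<Sum>i<n. k i) = r}.
        single (fst m, \<lambda>i. snd m i + (p - 1) * k i)
               (\<Prod>i<n. of_nat (snd m i choose k i)) m')"

definition Pst :: "nat \<Rightarrow> nat \<Rightarrow> nat \<Rightarrow> 'k::comm_ring_1 elt \<Rightarrow> 'k elt" where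
  "Pst n p r f = lin_ext (Pmono n p r) f"

(* Bockstein: the derivation with beta x_i = y_i, beta y_i = 0 *)
definition bmono :: "mono \<Rightarrow> 'k::comm_ring_1 elt" where
  "bmono m = (\<lambda>m'. \<Sum>i\<in>fst m.
      single (fst m - {i}, (snd m)(i := snd m i + 1))
             ((-1) ^ card {j \<in> fst m. j < i}) m')"

definition Bock :: "'k::comm_ring_1 elt \<Rightarrow> 'k elt" where
  "Bock f = lin_ext bmono f"

(* L_n = det(y_j^{p^i})_{0 \<le> i,j < n} *)
definition Ln :: "nat \<Rightarrow> nat \<Rightarrow> 'k::comm_ring_1 elt" where
  "Ln n p = (\<lambda>m. \<Sum>\<sigma>\<in>{\<sigma>. \<sigma> permutes {..<n}}.
      single ({}, \<lambda>j. if j < n then p ^ (Hilbert_Choice.inv \<sigma> j) else 0) (of_int (sign \<sigma>)) m)"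

definition topgen :: "nat \<Rightarrow> nat \<Rightarrow> 'k::comm_ring_1 elt" where
  "topgen n p = emult (single ({..<n}, \<lambda>_. 0) 1) (epow (Ln n p) (p - 2))"

end

theory Submission
  imports Defs "Jordan_Normal_Form.Determinant" "HOL-Algebra.Algebraic_Closure_Type"
begin

hide_const (open) Polynomials.degree Divisibility.prime

text \<open>
  Let R be an algebraic closure of the prime field. An element f of the cohomology ring is turned into a
  function ev f on R^n with values in exterior forms, and g is replaced by the R-span GG of its graph
  (ev f, ev (g f)), f homogeneous of positive degree. Membership in GG is stable under taking coefficients
  of polynomials in a parameter. Total reduced powers substitute y + t y^p for y, every additive
  polynomial over R splits into such factors, and so GG is closed under all substitutions of additive
  polynomials (up to a twist by the exterior degree), under the Frobenius substitution, and under
  contraction with the vectors (y_j^{p^i}), i.e. the Milnor primitives.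

  Suppose f is nonzero, homogeneous of positive degree and g f = 0. Contracting f as long as possible
  gives a pair (phi, 0) in GG with phi a nonzero polynomial function without exterior part that is
  invariant under GL_n over the prime field and vanishes at 0. A suitable sum of substitutions
  phi(sum_i s_i z_i), with z the rows of a matrix Z over the prime field, equals r times the indicator of
  det Z nonzero, that is r det(Z)^{p-1}, with r nonzero. For the truncated traces
  z_{ij} = sum_m (b_i y_j c)^{p^m}, as polynomials in c, the coefficient of c^E for suitable E sees only the
  restriction of a polynomial to the prime field, so it can be read off from r det(Z)^{p-1}: it is a
  nonzero multiple of L_n^{(p-1)p^k}. Hence (L_n^{(p-1)p^k}, 0) lies in GG.

  On the other hand, contracting x_1...x_n L_n^{p-2} completely gives a multiple of L_n^{p-1}. Its image
  under g has to be of full exterior degree, for otherwise a shorter contraction would kill the source but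
  not the image; hence the complete contraction of the image is nonzero. Applying Frobenius gives
  (L_n^{(p-1)p^k}, v) in GG with v nonzero. So (0, v) lies in GG, which is impossible
  because GG is the graph of a function. Thus g is injective on the finite set of elements of each
  positive degree.
\<close>

section \<open>Exterior forms\<close>

text \<open>Passing to an algebraically closed R has three uses: additive polynomials split and the
  twists have square roots; coefficients in a parameter can be recovered from values because R is
  infinite; and an element is determined by its values, which fails over the prime field, where y
  and y^p agree. The price is that g is linear over the prime field only. It is paid by functionals:
  a relation over R is turned, coefficient by coefficient, into relations over the prime field by
  all linear maps from R to it. This is why the R-span of the graph is still a graph. The exponent
  p^k comes from the digit argument. The k lowest digits of E - 1 equal p - 1, and this protects the
  coefficient at E against reduction of exponents for polynomials of degree at most k. So k has to
  reach the degree of the orbit sum, and the argument delivers a Frobenius power of L_n^(p-1). This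
  is harmless, because the other pair can be subjected to Frobenius too, and Frobenius is surjective
  on points. The same substitution also discards exterior components, being the degenerate case of a
  twisted one.\<close>

text \<open>An exterior form is encoded by its coefficients \<omega> S at the monomials x_S, S a subset of {..<n};
  \<open>iota\<close> is contraction with a vector, \<open>eps\<close> is left multiplication by a linear form.\<close>

definition sg :: "nat set \<Rightarrow> nat \<Rightarrow> 'r::comm_ring_1" where
  "sg T j = (-1) ^ card {i\<in>T. i < j}"

definition iota :: "nat \<Rightarrow> (nat \<Rightarrow> 'r::comm_ring_1) \<Rightarrow> (nat set \<Rightarrow> 'r) \<Rightarrow> nat set \<Rightarrow> 'r" where
  "iota n w \<omega> T = (\<Sum>j<n. if j \<in> T then 0 else sg T j * w j * \<omega> (insert j T))"

definition eps :: "nat \<Rightarrow> (nat \<Rightarrow> 'r::comm_ring_1) \<Rightarrow> (nat set \<Rightarrow> 'r) \<Rightarrow> nat set \<Rightarrow> 'r" where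
  "eps n l \<omega> U = (\<Sum>j<n. if j \<in> U then l j * sg (U - {j}) j * \<omega> (U - {j}) else 0)"

lemma sg_insert:
  assumes "j \<notin> T"
  shows "sg (insert j T) k = (if j < k then - sg T k else sg T k)"
proof -
  have "{i \<in> insert j T. i < k} = (if j < k then insert j {i\<in>T. i < k} else {i\<in>T. i < k})" by auto
  then show ?thesis using assms by (simp add: sg_def)
qed

lemma sg_sq [simp]: "sg T j * sg T j = (1::'r::comm_ring_1)"
  by (simp add: sg_def flip: power_add mult_2)

lemma sg_sq_left [simp]: "sg T j * (sg T j * x) = (x::'r::comm_ring_1)"
  by (simp flip: mult.assoc)

lemma sg_swap:
  assumes "j \<notin> T" "k \<notin> T" "j \<noteq> k"
  shows "sg (insert k T) j * sg (insert j T) k = - (sg T k * sg T j :: 'r::comm_ring_1)"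
  using assms by (auto simp: sg_insert)

text \<open>Contraction and left multiplication satisfy the Clifford relation: their anticommutator
  is the scalar l(v). Off the diagonal the contributions of (j, k) to the two composites cancel by
  \<open>sg_swap\<close>; on the diagonal exactly one composite contributes, according to whether j
  lies in T.\<close>

lemma iota_eps:
  fixes b :: "nat set \<Rightarrow> 'r::comm_ring_1"
  shows "iota n v (eps n l b) T = (\<Sum>j<n. l j * v j) * b T - eps n l (iota n v b) T"
proof -
  define XX where "XX = (\<lambda>j k. if j \<in> T then 0 else
     (if k \<in> insert j T then sg T j * v j * (l k * sg (insert j T - {k}) k * b (insert j T - {k})) else 0))"
  define Y where "Y = (\<lambda>j k. if k \<in> T then
     (if j \<in> T - {k} then 0 else l k * sg (T-{k}) k * (sg (T-{k}) j * v j * b (insert j (T-{k})))) else 0)"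
  have 1: "iota n v (eps n l b) T = (\<Sum>j<n. \<Sum>k<n. XX j k)"
    unfolding iota_def eps_def XX_def by (intro sum.cong refl) (auto simp: sum_distrib_left intro!: sum.cong)
  have 2: "eps n l (iota n v b) T = (\<Sum>j<n. \<Sum>k<n. Y j k)"
    unfolding iota_def eps_def Y_def
    by (subst sum.swap, intro sum.cong refl) (auto simp: sum_distrib_left intro!: sum.cong)
  have 3: "XX j k + Y j k = (if j = k then l j * v j * b T else 0)" for j k
  proof (cases "j = k")
    case True
    then show ?thesis by (cases "k \<in> T") (auto simp: XX_def Y_def insert_absorb mult_ac)
  next
    case False
    show ?thesis
    proof (cases "j \<notin> T \<and> k \<in> T")
      case True
      define T' where "T' = T - {k}"
      have T': "k \<notin> T'" "j \<notin> T'" "T = insert k T'" using True False by (auto simp: T'_def)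
      have e: "insert j (insert k T') - {k} = insert j T'" using T' False by auto
      have "XX j k + Y j k = v j * l k * b (insert j T') * (sg (insert k T') j * sg (insert j T') k + sg T' k * sg T' j)"
        using T'(1,2) False by (simp add: XX_def Y_def e T'(3) algebra_simps)
      then show ?thesis using False by (simp add: sg_swap[OF T'(2) T'(1) False])
    next
      case c: False
      then show ?thesis using False by (auto simp: XX_def Y_def)
    qed
  qed
  have "iota n v (eps n l b) T + eps n l (iota n v b) T = (\<Sum>j<n. \<Sum>k<n. XX j k + Y j k)"
    by (simp add: 1 2 sum.distrib)
  also have "\<dots> = (\<Sum>j<n. l j * v j * b T)"
    unfolding 3 by (intro sum.cong refl) (simp add: sum.delta')
  finally show ?thesis by (simp add: sum_distrib_right eq_diff_eq)
qed

lemma iota_anticomm: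
  fixes b :: "nat set \<Rightarrow> 'r::comm_ring_1"
  shows "iota n v (iota n w b) T = - iota n w (iota n v b) T"
proof -
  define XX where "XX = (\<lambda>v w j k. if j \<in> T then 0 else
     (if k \<in> insert j T then 0 else sg T j * v j * (sg (insert j T) k * w k * b (insert k (insert j T)))))"
  have 1: "iota n v (iota n w b) T = (\<Sum>j<n. \<Sum>k<n. XX v w j k)" for v w
    unfolding iota_def XX_def by (intro sum.cong refl) (auto simp: sum_distrib_left intro!: sum.cong)
  have 3: "XX v w j k = - XX w v k j" for j k
  proof (cases "j \<in> T \<or> k \<in> T \<or> j = k")
    case False
    then show ?thesis by (auto simp: XX_def sg_insert insert_commute)
  qed (auto simp: XX_def)
  have "iota n v (iota n w b) T = (\<Sum>j<n. \<Sum>k<n. - XX w v k j)"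
    unfolding 1 by (intro sum.cong refl) (rule 3)
  also have "\<dots> = - iota n w (iota n v b) T"
    unfolding 1 by (subst sum.swap) (simp add: sum_negf)
  finally show ?thesis .
qed

text \<open>Anticommutativity alone shows that twice this expression is zero, which is empty in
  characteristic 2; hence a direct argument with vanishing diagonal terms.\<close>

lemma iota_self: "iota n v (iota n v b) T = (0::'r::comm_ring_1)"
proof -
  define XX where "XX = (\<lambda>j k. if j \<in> T then 0 else
     (if k \<in> insert j T then 0 else sg T j * v j * (sg (insert j T) k * v k * b (insert k (insert j T)))))"
  have 1: "iota n v (iota n v b) T = (\<Sum>j<n. \<Sum>k<n. XX j k)"
    unfolding iota_def XX_def by (intro sum.cong refl) (auto simp: sum_distrib_left intro!: sum.cong)
  have 3: "XX j k = - XX k j" for j k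
  proof (cases "j \<in> T \<or> k \<in> T \<or> j = k")
    case False
    then show ?thesis by (auto simp: XX_def sg_insert insert_commute)
  qed (auto simp: XX_def)
  have 4: "XX j j = 0" for j by (simp add: XX_def)
  have "(\<Sum>j<n. \<Sum>k<n. XX j k) = 0"
  \<comment> \<open>The new index contributes a row and a column that cancel each other, and a
    corner that is zero.\<close>
  proof (induction n)
    case (Suc n)
    have "(\<Sum>j<Suc n. \<Sum>k<Suc n. XX j k) = (\<Sum>j<n. \<Sum>k<n. XX j k) + (\<Sum>j<n. XX j n + XX n j) + XX n n"
      by (simp add: sum.distrib algebra_simps)
    also have "\<dots> = 0" using 3[of _ n] 4 Suc by simp
    finally show ?case .
  qed simp
  then show ?thesis using 1 by simp
qed

lemma iota_add: "iota n v (\<lambda>S. a S + b S) T = iota n v a T + iota n v b T"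
  unfolding iota_def sum.distrib[symmetric] by (intro sum.cong) (auto simp: algebra_simps)

lemma iota_scale: "iota n v (\<lambda>S. c * a S) T = c * iota n v a T"
  unfolding iota_def sum_distrib_left by (intro sum.cong) (auto simp: algebra_simps)

lemma iota_sum: "iota n v (\<lambda>S. \<Sum>i\<in>I. a i S) T = (\<Sum>i\<in>I. iota n v (a i) T)"
  unfolding iota_def
  by (subst sum.swap, intro sum.cong) (auto simp: sum_distrib_left intro!: sum.cong)

lemma iota_vadd: "iota n (\<lambda>j. v j + w j) a T = iota n v a T + iota n w a T"
  unfolding iota_def sum.distrib[symmetric] by (intro sum.cong) (auto simp: algebra_simps)

lemma iota_vscale: "iota n (\<lambda>j. c * v j) a T = c * iota n v a T"
  unfolding iota_def sum_distrib_left by (intro sum.cong) (auto simp: algebra_simps)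

lemma iota_vsum: "iota n (\<lambda>j. \<Sum>i\<in>I. v i j) a T = (\<Sum>i\<in>I. iota n (v i) a T)"
  unfolding iota_def
  by (subst sum.swap, intro sum.cong) (auto simp: sum_distrib_left sum_distrib_right intro!: sum.cong)

lemma iota_cong: "(\<And>j. j < n \<Longrightarrow> v j = w j) \<Longrightarrow> iota n v a T = iota n w a T"
  unfolding iota_def by (intro sum.cong) auto

lemma eps_scale: "eps n v (\<lambda>S. c * a S) T = c * eps n v a T"
  unfolding eps_def sum_distrib_left by (intro sum.cong) (auto simp: algebra_simps)

lemma eps_sum: "eps n v (\<lambda>S. \<Sum>i\<in>I. a i S) T = (\<Sum>i\<in>I. eps n v (a i) T)"
  unfolding eps_def
  by (subst sum.swap, intro sum.cong) (auto simp: sum_distrib_left intro!: sum.cong)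

section \<open>Linear substitutions of exterior forms\<close>

definition delta :: "nat set \<Rightarrow> nat set \<Rightarrow> 'r::comm_ring_1" where
  "delta S T = (if S = T then 1 else 0)"

text \<open>Product of the linear forms given by columns of A: the image of x_s1 ... x_sm under x_i
  \<mapsto> sum_j A j i x_j, the convention of \<open>xlin\<close>.\<close>

fun elist :: "nat \<Rightarrow> (nat \<Rightarrow> nat \<Rightarrow> 'r::comm_ring_1) \<Rightarrow> nat list \<Rightarrow> nat set \<Rightarrow> 'r" where
  "elist n A [] = delta {}"
| "elist n A (s # ss) = eps n (\<lambda>j. A j s) (elist n A ss)"

definition lam :: "nat \<Rightarrow> (nat \<Rightarrow> nat \<Rightarrow> 'r::comm_ring_1) \<Rightarrow> nat set \<Rightarrow> nat set \<Rightarrow> 'r" where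
  "lam n A S = elist n A (sorted_list_of_set S)"

text \<open>The same substitution on the polynomial generators: entry i is the value of the
  transformed y_i at the point y. On points it is therefore the transpose of A.\<close>

definition tr :: "nat \<Rightarrow> (nat \<Rightarrow> nat \<Rightarrow> 'r::comm_ring_1) \<Rightarrow> (nat \<Rightarrow> 'r) \<Rightarrow> nat \<Rightarrow> 'r" where
  "tr n A y i = (\<Sum>j<n. A j i * y j)"

lemma iota_delta_empty: "iota n w (delta {}) T = 0"
  unfolding iota_def delta_def by (intro sum.neutral) auto

text \<open>Contraction is an antiderivation: by \<open>iota_eps\<close> it passes the first factor
  at the cost of a sign, and this is the change of \<open>sg\<close> when the smallest index s joins
  the set.\<close>

lemma iota_elist:
  assumes "sorted ss" "distinct ss"
  shows "iota n w (elist n A ss) T = (\<Sum>i\<in>set ss. sg (set ss) i * tr n A w i * elist n A (remove1 i ss) T)"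
  using assms
proof (induction ss arbitrary: T)
  case Nil
  then show ?case by (simp add: iota_delta_empty)
next
  case (Cons s ss)
  have lt: "s < i" if "i \<in> set ss" for i using Cons.prems that by (auto simp: order.strict_iff_order)
  have s: "s \<notin> set ss" using Cons.prems by auto
  have sgs: "sg (set (s # ss)) s = (1::'a)"
  proof -
    have "{i \<in> set (s # ss). i < s} = {}" using lt by (auto dest: less_asym)
    then show ?thesis unfolding sg_def by (metis card.empty power_0)
  qed
  have sgi: "sg (set (s # ss)) i = (- sg (set ss) i :: 'a)" if "i \<in> set ss" for i
    using lt[OF that] s by (simp add: sg_insert)
  have IH: "iota n w (elist n A ss) = (\<lambda>T. (\<Sum>i\<in>set ss. sg (set ss) i * tr n A w i * elist n A (remove1 i ss) T))"
    using Cons by auto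
  have "iota n w (elist n A (s # ss)) T = tr n A w s * elist n A ss T -
     eps n (\<lambda>j. A j s) (iota n w (elist n A ss)) T"
    by (simp add: iota_eps tr_def)
  also have "eps n (\<lambda>j. A j s) (iota n w (elist n A ss)) T =
    (\<Sum>i\<in>set ss. sg (set ss) i * tr n A w i * elist n A (remove1 i (s # ss)) T)"
    unfolding IH eps_sum eps_scale using s by (intro sum.cong) auto
  moreover have "(\<Sum>i\<in>set (s # ss). sg (set (s # ss)) i * tr n A w i * elist n A (remove1 i (s # ss)) T)
    = tr n A w s * elist n A ss T + (\<Sum>i\<in>set ss. sg (set (s # ss)) i * tr n A w i * elist n A (remove1 i (s # ss)) T)"
    using s sgs by simp
  moreover have "(\<Sum>i\<in>set ss. sg (set (s # ss)) i * tr n A w i * elist n A (remove1 i (s # ss)) T)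
    = - (\<Sum>i\<in>set ss. sg (set ss) i * tr n A w i * elist n A (remove1 i (s # ss)) T)"
    unfolding sum_negf[symmetric] by (intro sum.cong refl) (simp only: sgi, simp)
  ultimately show ?case by simp
qed

lemma iota_lam:
  assumes "finite S"
  shows "iota n w (lam n A S) T = (\<Sum>i\<in>S. sg S i * tr n A w i * lam n A (S - {i}) T)"
  unfolding lam_def using assms
  by (subst iota_elist) (simp_all add: sorted_list_of_set_remove)

lemma elist_supp: "elist n A ss U \<noteq> 0 \<Longrightarrow> U \<subseteq> {..<n} \<and> card U = length ss"
proof (induction ss arbitrary: U)
  case Nil
  then show ?case by (auto simp: delta_def split: if_splits)
next
  case (Cons s ss)
  from Cons.prems obtain j where j0: "j < n" "(if j \<in> U then A j s * sg (U - {j}) j * elist n A ss (U - {j}) else 0) \<noteq> 0"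
    unfolding elist.simps eps_def by (rule sum.not_neutral_contains_not_neutral) auto
  then have j: "j < n" "j \<in> U" "elist n A ss (U - {j}) \<noteq> 0"
    by (auto split: if_splits)
  have a: "U - {j} \<subseteq> {..<n}" and b: "card (U - {j}) = length ss" using Cons.IH[OF j(3)] by simp_all
  have U: "U \<subseteq> {..<n}" using a j(1) by blast
  then have "finite U" by (rule finite_subset) simp
  from card.remove[OF this j(2)] b have "card U = length (s # ss)" by (simp only: list.size)
  with U show ?case by blast
qed

lemma lam_supp: "finite S \<Longrightarrow> lam n A S U \<noteq> 0 \<Longrightarrow> U \<subseteq> {..<n} \<and> card U = card S"
  unfolding lam_def by (drule elist_supp) simp

lemma lam_empty: "lam n A {} = delta {}" by (simp add: lam_def)

definition Lam :: "nat \<Rightarrow> (nat \<Rightarrow> nat \<Rightarrow> 'r::comm_ring_1) \<Rightarrow> (nat set \<Rightarrow> 'r) \<Rightarrow> nat set \<Rightarrow> 'r" where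
  "Lam n A \<omega> T = (\<Sum>S\<in>Pow {..<n}. \<omega> S * lam n A S T)"

lemma Lam_empty: "Lam n A \<omega> {} = \<omega> {}"
proof -
  have "Lam n A \<omega> {} = (\<Sum>S\<in>{{}}. \<omega> S * lam n A S {})"
    unfolding Lam_def
  proof (rule sum.mono_neutral_right)
    show "\<forall>i\<in>Pow {..<n} - {{}}. \<omega> i * lam n A i {} = 0"
    proof
      fix S assume S: "S \<in> Pow {..<n} - {{}}"
      then have "finite S" "S \<noteq> {}" by (auto intro: finite_subset)
      then have "lam n A S {} = 0" using lam_supp[of S n A "{}"] by auto
      then show "\<omega> S * lam n A S {} = 0" by simp
    qed
  qed auto
  then show ?thesis by (simp add: lam_empty delta_def)
qed

text \<open>Naturality of contraction: the vector w pairs with the transformed form number i to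
  \<open>tr n A w i\<close>. This makes the Bockstein and complete contractions compatible with the
  group action.\<close>

lemma iota_Lam: "iota n w (Lam n A \<omega>) T = Lam n A (iota n (tr n A w) \<omega>) T"
proof -
  let ?f = "\<lambda>i S'. \<omega> (insert i S') * (sg S' i * tr n A w i * lam n A S' T)"
  have "iota n w (Lam n A \<omega>) T = (\<Sum>S\<in>Pow {..<n}. \<omega> S * (\<Sum>i\<in>S. sg S i * tr n A w i * lam n A (S - {i}) T))"
  proof -
    have e: "Lam n A \<omega> = (\<lambda>T. \<Sum>S\<in>Pow {..<n}. \<omega> S * lam n A S T)" by (rule ext) (simp add: Lam_def)
    show ?thesis unfolding e iota_sum iota_scale
      by (intro sum.cong refl) (simp add: iota_lam finite_subset)
  qed
  also have "\<dots> = (\<Sum>S\<in>Pow {..<n}. \<Sum>i<n. if i \<in> S then ?f i (S - {i}) else 0)"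
  proof (intro sum.cong refl)
    fix S assume "S \<in> Pow {..<n}"
    then have S: "S \<subseteq> {..<n}" by auto
    have "sg (S - {i}) i = (sg S i :: 'a)" for i
    proof -
      have "{k \<in> S - {i}. k < i} = {k \<in> S. k < i}" by auto
      then show ?thesis unfolding sg_def by metis
    qed
    then have "\<omega> S * (\<Sum>i\<in>S. sg S i * tr n A w i * lam n A (S - {i}) T) = (\<Sum>i\<in>S. ?f i (S-{i}))"
      by (simp add: sum_distrib_left insert_absorb)
    also have "\<dots> = (\<Sum>i<n. if i \<in> S then ?f i (S - {i}) else 0)"
      using S by (simp add: sum.inter_restrict[symmetric] Int_absorb1)
    finally show "\<omega> S * (\<Sum>i\<in>S. sg S i * tr n A w i * lam n A (S - {i}) T) = (\<Sum>i<n. if i \<in> S then ?f i (S - {i}) else 0)" .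
  qed
  also have "\<dots> = (\<Sum>i<n. \<Sum>S\<in>Pow {..<n}. if i \<in> S then ?f i (S - {i}) else 0)" by (rule sum.swap)
  also have "\<dots> = (\<Sum>i<n. \<Sum>S\<in>Pow {..<n}. if i \<in> S then 0 else ?f i S)"
  proof (rule sum.cong[OF refl])
    fix i assume "i \<in> {..<n}"
    then have i: "i < n" by simp
    have "(\<Sum>S\<in>Pow {..<n}. if i \<in> S then ?f i (S - {i}) else 0) = (\<Sum>S | S \<in> Pow {..<n} \<and> i \<in> S. ?f i (S - {i}))"
      by (rule sum.inter_filter[symmetric]) simp
    also have "\<dots> = (\<Sum>S | S \<in> Pow {..<n} \<and> i \<notin> S. ?f i S)"
      by (rule sum.reindex_bij_witness[of _ "insert i" "\<lambda>S. S - {i}"]) (use i in \<open>auto simp: insert_absorb\<close>)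
    also have "\<dots> = (\<Sum>S\<in>Pow {..<n}. if i \<notin> S then ?f i S else 0)"
      by (rule sum.inter_filter) simp
    also have "\<dots> = (\<Sum>S\<in>Pow {..<n}. if i \<in> S then 0 else ?f i S)"
      by (intro sum.cong refl) simp
    finally show "(\<Sum>S\<in>Pow {..<n}. if i \<in> S then ?f i (S - {i}) else 0) = (\<Sum>S\<in>Pow {..<n}. if i \<in> S then 0 else ?f i S)" .
  qed
  also have "\<dots> = Lam n A (iota n (tr n A w) \<omega>) T"
    unfolding Lam_def iota_def
    by (subst sum.swap, intro sum.cong refl) (auto simp: sum_distrib_left sum_distrib_right intro!: sum.cong)
  finally show ?thesis .
qed

section \<open>Polynomial functions\<close>

text \<open>With the other variables fixed, a one-variable polynomial of degree below |A| vanishes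
  on A and is zero; induction treats one variable at a time. It serves both for the prime field with
  exponents below p and for large finite subsets of an infinite field.\<close>

lemma mpoly_zero:
  fixes A :: "'r::idom set" and p :: "('i \<Rightarrow> nat) \<Rightarrow> 'r"
  assumes "finite J" "finite E" "\<And>a i. a \<in> E \<Longrightarrow> i \<notin> J \<Longrightarrow> a i = 0"
    "\<And>a i. a \<in> E \<Longrightarrow> i \<in> J \<Longrightarrow> a i < card A"
    "\<And>x. (\<And>i. i \<in> J \<Longrightarrow> x i \<in> A) \<Longrightarrow> (\<Sum>a\<in>E. p a * (\<Prod>i\<in>J. x i ^ a i)) = 0"
    "a \<in> E"
  shows "p a = 0"
  using assms
proof (induction J arbitrary: E p a rule: finite_induct)
  case empty
  then have z: "\<And>a. a \<in> E \<Longrightarrow> a = (\<lambda>_. 0)" by (auto simp: fun_eq_iff)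
  then have "E = {a}" using empty.prems(5) by blast
  then show ?case using empty.prems(4)[of "\<lambda>_. 0"] by simp
next
  case (insert i0 J)
  define d where "d = a i0"
  have d: "d < card A" using insert.prems(3)[OF insert.prems(5), of i0] by (simp add: d_def)
  \<comment> \<open>The exponents with value d at i0, that entry erased so that only variables in J
    remain.\<close>
  define Ed where "Ed = (\<lambda>b. b(i0 := 0)) ` {b\<in>E. b i0 = d}"
  define p' where "p' = (\<lambda>b. p (b(i0 := d)))"
  have inj: "inj_on (\<lambda>b. b(i0 := 0)) {b\<in>E. b i0 = d}"
    by (rule inj_on_inverseI[of _ "\<lambda>b. b(i0 := d)"]) auto
  have "p' (a(i0 := 0)) = 0"
  proof (rule insert.IH)
    show "finite Ed" using insert.prems(1) by (simp add: Ed_def)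
    show "b i = 0" if "b \<in> Ed" "i \<notin> J" for b i using that insert.prems(2) by (auto simp: Ed_def)
    show "b i < card A" if "b \<in> Ed" "i \<in> J" for b i
      using that insert.prems(3) insert.hyps by (auto simp: Ed_def)
    show "a(i0 := 0) \<in> Ed" using insert.prems(5) by (auto simp: Ed_def d_def)
    fix x :: "'i \<Rightarrow> 'r" assume x: "\<And>i. i \<in> J \<Longrightarrow> x i \<in> A"
    define q where "q = (\<Sum>b\<in>E. Polynomial.monom (p b * (\<Prod>i\<in>J. x i ^ b i)) (b i0))"
    have q0: "poly q c = 0" if c: "c \<in> A" for c
    proof -
      have "(\<Sum>b\<in>E. p b * (\<Prod>i\<in>insert i0 J. (x(i0 := c)) i ^ b i)) = 0"
        by (rule insert.prems(4)) (use x c insert.hyps in auto)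
      also have "(\<Sum>b\<in>E. p b * (\<Prod>i\<in>insert i0 J. (x(i0 := c)) i ^ b i)) = poly q c"
        unfolding q_def poly_sum
      proof (intro sum.cong refl)
        fix b
        have "(\<Prod>i\<in>J. (x(i0 := c)) i ^ b i) = (\<Prod>i\<in>J. x i ^ b i)"
          using insert.hyps by (intro prod.cong) auto
        then show "p b * (\<Prod>i\<in>insert i0 J. (x(i0 := c)) i ^ b i) = poly (Polynomial.monom (p b * (\<Prod>i\<in>J. x i ^ b i)) (b i0)) c"
          using insert.hyps by (simp add: poly_monom mult_ac)
      qed
      finally show ?thesis .
    qed
    have "q = 0"
    proof (rule ccontr)
      assume q: "q \<noteq> 0"
      have "degree q \<le> card A - 1"
        unfolding q_def
      proof (rule degree_sum_le[OF insert.prems(1)])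
        fix b assume "b \<in> E"
        then have "b i0 < card A" using insert.prems(3) by blast
        moreover have "degree (Polynomial.monom (p b * (\<Prod>i\<in>J. x i ^ b i)) (b i0)) \<le> b i0" by (rule degree_monom_le)
        ultimately show "degree (Polynomial.monom (p b * (\<Prod>i\<in>J. x i ^ b i)) (b i0)) \<le> card A - 1" by linarith
      qed
      then have "degree q < card A" using d by simp
      moreover have "card A \<le> card {c. poly q c = 0}"
        using q q0 by (intro card_mono poly_roots_finite) auto
      ultimately show False using card_poly_roots_bound[OF q] by simp
    qed
    then have "0 = coeff q d" by simp
    also have "\<dots> = (\<Sum>b\<in>E. if b i0 = d then p b * (\<Prod>i\<in>J. x i ^ b i) else 0)"
      by (simp add: q_def coeff_sum)
    also have "\<dots> = (\<Sum>b\<in>{b\<in>E. b i0 = d}. p b * (\<Prod>i\<in>J. x i ^ b i))"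
      using insert.prems(1) by (rule sum.inter_filter[symmetric])
    also have "\<dots> = (\<Sum>b\<in>{b\<in>E. b i0 = d}. p' (b(i0 := 0)) * (\<Prod>i\<in>J. x i ^ (b(i0 := 0)) i))"
    proof (intro sum.cong refl)
      fix b assume b: "b \<in> {b\<in>E. b i0 = d}"
      then have "b(i0 := d) = b" by (auto simp: fun_upd_idem_iff)
      moreover have "(\<Prod>i\<in>J. x i ^ (b(i0 := 0)) i) = (\<Prod>i\<in>J. x i ^ b i)"
        using insert.hyps by (intro prod.cong) auto
      ultimately show "p b * (\<Prod>i\<in>J. x i ^ b i) = p' (b(i0 := 0)) * (\<Prod>i\<in>J. x i ^ (b(i0 := 0)) i)"
        by (simp add: p'_def)
    qed
    also have "\<dots> = (\<Sum>b\<in>Ed. p' b * (\<Prod>i\<in>J. x i ^ b i))"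
      unfolding Ed_def by (subst sum.reindex[OF inj]) simp
    finally show "(\<Sum>b\<in>Ed. p' b * (\<Prod>i\<in>J. x i ^ b i)) = 0" by simp
  qed
  then show ?case by (simp add: p'_def d_def)
qed

text \<open>N bounds the total degree. The transfer from the prime field consumes this bound: it has
  to be at most the number k of protected digits.\<close>

definition polyfun :: "'i set \<Rightarrow> nat \<Rightarrow> (('i \<Rightarrow> 'r::comm_ring_1) \<Rightarrow> 'r) \<Rightarrow> bool" where
  "polyfun J N F \<longleftrightarrow> (\<exists>E p. finite E \<and> (\<forall>a\<in>E. (\<forall>i. i \<notin> J \<longrightarrow> a i = 0) \<and> (\<Sum>i\<in>J. a i) \<le> N) \<and>
     (\<forall>x. F x = (\<Sum>a\<in>E. p a * (\<Prod>i\<in>J. x i ^ a i))))"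

lemma polyfun_const: "polyfun J N (\<lambda>_. c)"
  unfolding polyfun_def by (intro exI[of _ "{\<lambda>_. 0}"] exI[of _ "\<lambda>_. c"]) auto

lemma polyfun_var:
  assumes "finite J" "j \<in> J" "1 \<le> N"
  shows "polyfun J N (\<lambda>x. x j)"
proof -
  let ?a = "\<lambda>i. if i = j then 1 else (0::nat)"
  have "(\<Prod>i\<in>J. x i ^ ?a i) = x j" for x :: "'a \<Rightarrow> 'b"
    using prod.delta[OF assms(1), of j "x"] assms by (simp add: if_distrib[of "\<lambda>e. _ ^ e"] cong: if_cong)
  moreover have "(\<Sum>i\<in>J. ?a i) \<le> N" using assms by simp
  ultimately show ?thesis unfolding polyfun_def
    using assms by (intro exI[of _ "{?a}"] exI[of _ "\<lambda>_. 1"]) auto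
qed

lemma polyfun_mono: "polyfun J N F \<Longrightarrow> N \<le> M \<Longrightarrow> polyfun J M F"
  unfolding polyfun_def by (meson order.trans)

lemma polyfun_add:
  assumes "polyfun J N F" "polyfun J N G"
  shows "polyfun J N (\<lambda>x. F x + G x)"
proof -
  obtain E p where 1: "finite E" "\<And>a. a\<in>E \<Longrightarrow> (\<forall>i. i \<notin> J \<longrightarrow> a i = 0) \<and> (\<Sum>i\<in>J. a i) \<le> N"
     "\<And>x. F x = (\<Sum>a\<in>E. p a * (\<Prod>i\<in>J. x i ^ a i))" using assms(1) unfolding polyfun_def by metis
  obtain E' p' where 2: "finite E'" "\<And>a. a\<in>E' \<Longrightarrow> (\<forall>i. i \<notin> J \<longrightarrow> a i = 0) \<and> (\<Sum>i\<in>J. a i) \<le> N"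
     "\<And>x. G x = (\<Sum>a\<in>E'. p' a * (\<Prod>i\<in>J. x i ^ a i))" using assms(2) unfolding polyfun_def by metis
  define q where "q = (\<lambda>a. (if a \<in> E then p a else 0) + (if a \<in> E' then p' a else 0))"
  have "F x + G x = (\<Sum>a\<in>E \<union> E'. q a * (\<Prod>i\<in>J. x i ^ a i))" for x
  proof -
    have "F x = (\<Sum>a\<in>E \<union> E'. (if a \<in> E then p a else 0) * (\<Prod>i\<in>J. x i ^ a i))"
      unfolding 1 using 1(1) 2(1) by (intro sum.mono_neutral_cong_left) auto
    moreover have "G x = (\<Sum>a\<in>E \<union> E'. (if a \<in> E' then p' a else 0) * (\<Prod>i\<in>J. x i ^ a i))"
      unfolding 2 using 1(1) 2(1) by (intro sum.mono_neutral_cong_left) auto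
    ultimately show ?thesis by (simp add: q_def distrib_right sum.distrib)
  qed
  moreover have "\<forall>a\<in>E \<union> E'. (\<forall>i. i \<notin> J \<longrightarrow> a i = 0) \<and> (\<Sum>i\<in>J. a i) \<le> N" using 1(2) 2(2) by blast
  ultimately show ?thesis unfolding polyfun_def using 1(1) 2(1) by (intro exI[of _ "E \<union> E'"] exI[of _ q]) blast
qed

lemma polyfun_mult:
  assumes "polyfun J N F" "polyfun J M G"
  shows "polyfun J (N + M) (\<lambda>x. F x * G x)"
proof -
  obtain E p where 1: "finite E" "\<And>a. a\<in>E \<Longrightarrow> (\<forall>i. i \<notin> J \<longrightarrow> a i = 0) \<and> (\<Sum>i\<in>J. a i) \<le> N"
     "\<And>x. F x = (\<Sum>a\<in>E. p a * (\<Prod>i\<in>J. x i ^ a i))" using assms(1) unfolding polyfun_def by metis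
  obtain E' p' where 2: "finite E'" "\<And>a. a\<in>E' \<Longrightarrow> (\<forall>i. i \<notin> J \<longrightarrow> a i = 0) \<and> (\<Sum>i\<in>J. a i) \<le> M"
     "\<And>x. G x = (\<Sum>a\<in>E'. p' a * (\<Prod>i\<in>J. x i ^ a i))" using assms(2) unfolding polyfun_def by metis
  define h where "h = (\<lambda>(a::'a\<Rightarrow>nat, b::'a\<Rightarrow>nat) i. a i + b i)"
  define q where "q = (\<lambda>c. \<Sum>z\<in>{z\<in>E \<times> E'. h z = c}. p (fst z) * p' (snd z))"
  have fin: "finite (E \<times> E')" using 1(1) 2(1) by simp
  have "F x * G x = (\<Sum>c\<in>h ` (E \<times> E'). q c * (\<Prod>i\<in>J. x i ^ c i))" for x
  proof -
    have "F x * G x = (\<Sum>z\<in>E \<times> E'. p (fst z) * p' (snd z) * (\<Prod>i\<in>J. x i ^ h z i))"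
      unfolding 1 2 sum_product sum.cartesian_product
      by (intro sum.cong) (auto simp: h_def power_add prod.distrib mult_ac)
    also have "\<dots> = (\<Sum>c\<in>h ` (E \<times> E'). \<Sum>z\<in>{z\<in>E \<times> E'. h z = c}. p (fst z) * p' (snd z) * (\<Prod>i\<in>J. x i ^ h z i))"
      using fin by (intro sum.image_gen)
    also have "\<dots> = (\<Sum>c\<in>h ` (E \<times> E'). q c * (\<Prod>i\<in>J. x i ^ c i))"
      unfolding q_def sum_distrib_right by (intro sum.cong) auto
    finally show ?thesis .
  qed
  moreover have "\<forall>c\<in>h ` (E \<times> E'). (\<forall>i. i \<notin> J \<longrightarrow> c i = 0) \<and> (\<Sum>i\<in>J. c i) \<le> N + M"
    using 1(2) 2(2) by (auto simp: h_def sum.distrib add_mono)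
  ultimately show ?thesis unfolding polyfun_def using fin by (intro exI[of _ "h ` (E \<times> E')"] exI[of _ q]) blast
qed

lemma polyfun_sum:
  assumes "\<And>i. i \<in> I \<Longrightarrow> polyfun J N (F i)"
  shows "polyfun J N (\<lambda>x. \<Sum>i\<in>I. F i x)"
  using assms by (induction I rule: infinite_finite_induct) (auto intro: polyfun_const polyfun_add)

lemma polyfun_prod:
  assumes "\<And>i. i \<in> I \<Longrightarrow> polyfun J (M i) (F i)"
  shows "polyfun J (\<Sum>i\<in>I. M i) (\<lambda>x. \<Prod>i\<in>I. F i x)"
  using assms by (induction I rule: infinite_finite_induct) (auto intro: polyfun_const polyfun_mult)

lemma polyfun_power: "polyfun J N F \<Longrightarrow> polyfun J (k * N) (\<lambda>x. F x ^ k)"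
  by (induction k) (auto intro: polyfun_const polyfun_mult)

lemma polyfun_cmult: "polyfun J N F \<Longrightarrow> polyfun J N (\<lambda>x. c * F x)"
  using polyfun_mult[OF polyfun_const[of J 0 c], of N F] by simp

subsection \<open>Polynomials in a parameter\<close>

text \<open>The degree bound M is uniform in x. This lets a coefficient be recovered by one linear
  combination of values whose weights do not depend on x.\<close>

definition tpoly :: "('r::comm_ring_1 \<Rightarrow> 'x \<Rightarrow> 'r) \<Rightarrow> bool" where
  "tpoly f \<longleftrightarrow> (\<exists>M q. \<forall>x. degree (q x :: 'r poly) \<le> M \<and> (\<forall>t. f t x = poly (q x) t))"

lemma tpolyI: "(\<And>x. degree (q x :: 'r::comm_ring_1 poly) \<le> M) \<Longrightarrow> (\<And>t x. f t x = poly (q x) t) \<Longrightarrow> tpoly f"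
  unfolding tpoly_def by blast

lemma tpoly_const: "tpoly (\<lambda>t. g)"
  by (rule tpolyI[of "\<lambda>x. [:g x:]" 0]) auto

lemma tpoly_id: "tpoly (\<lambda>t x. t)"
  by (rule tpolyI[of "\<lambda>x. [:0, 1:]" 1]) auto

lemma tpoly_add: assumes "tpoly f" "tpoly g" shows "tpoly (\<lambda>t x. f t x + g t x)"
proof -
  obtain M q where 1: "\<And>x. degree (q x) \<le> M" "\<And>t x. f t x = poly (q x) t" using assms(1) unfolding tpoly_def by metis
  obtain M' q' where 2: "\<And>x. degree (q' x) \<le> M'" "\<And>t x. g t x = poly (q' x) t" using assms(2) unfolding tpoly_def by metis
  show ?thesis
    by (rule tpolyI[of "\<lambda>x. q x + q' x" "max M M'"]) (auto intro!: degree_add_le intro: order.trans[OF 1(1)] order.trans[OF 2(1)] simp: 1(2) 2(2))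
qed

lemma tpoly_mult: assumes "tpoly f" "tpoly g" shows "tpoly (\<lambda>t x. f t x * g t x)"
proof -
  obtain M q where 1: "\<And>x. degree (q x) \<le> M" "\<And>t x. f t x = poly (q x) t" using assms(1) unfolding tpoly_def by metis
  obtain M' q' where 2: "\<And>x. degree (q' x) \<le> M'" "\<And>t x. g t x = poly (q' x) t" using assms(2) unfolding tpoly_def by metis
  show ?thesis
  proof (rule tpolyI[of "\<lambda>x. q x * q' x" "M + M'"])
    show "degree (q x * q' x) \<le> M + M'" for x
      using degree_mult_le[of "q x" "q' x"] 1(1)[of x] 2(1)[of x] by linarith
  qed (simp add: 1(2) 2(2))
qed

lemma tpoly_power: "tpoly f \<Longrightarrow> tpoly (\<lambda>t x. f t x ^ k)"
proof (induction k)
  case 0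
  show ?case using tpoly_const[of "\<lambda>x. 1"] by simp
next
  case (Suc k)
  then show ?case using tpoly_mult[of f "\<lambda>t x. f t x ^ k"] by simp
qed

lemma tpoly_sum: "(\<And>i. i \<in> I \<Longrightarrow> tpoly (f i)) \<Longrightarrow> tpoly (\<lambda>t x. \<Sum>i\<in>I. f i t x)"
proof (induction I rule: infinite_finite_induct)
  case (insert i I)
  then show ?case using tpoly_add[of "f i" "\<lambda>t x. \<Sum>i\<in>I. f i t x"] by simp
qed (simp_all add: tpoly_const)

lemma tpoly_prod: "(\<And>i. i \<in> I \<Longrightarrow> tpoly (f i)) \<Longrightarrow> tpoly (\<lambda>t x. \<Prod>i\<in>I. f i t x)"
proof (induction I rule: infinite_finite_induct)
  case (insert i I)
  then show ?case using tpoly_mult[of "f i" "\<lambda>t x. \<Prod>i\<in>I. f i t x"] by simp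
qed (simp_all add: tpoly_const)

section \<open>Spaces of functions and extraction of coefficients\<close>

definition subspc :: "('x \<Rightarrow> 'r::field) set \<Rightarrow> bool" where
  "subspc W \<longleftrightarrow> (\<forall>u\<in>W. \<forall>v\<in>W. (\<lambda>x. u x + v x) \<in> W) \<and> (\<forall>c. \<forall>u\<in>W. (\<lambda>x. c * u x) \<in> W) \<and> (\<lambda>_. 0) \<in> W"

lemma subspc_add: "subspc W \<Longrightarrow> u \<in> W \<Longrightarrow> v \<in> W \<Longrightarrow> (\<lambda>x. u x + v x) \<in> W"
  by (simp add: subspc_def)

lemma subspc_scale: "subspc W \<Longrightarrow> u \<in> W \<Longrightarrow> (\<lambda>x. c * u x) \<in> W"
  by (simp add: subspc_def)

lemma subspc_zero: "subspc W \<Longrightarrow> (\<lambda>_. 0) \<in> W"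
  by (simp add: subspc_def)

lemma subspc_diff: assumes "subspc W" "u \<in> W" "v \<in> W" shows "(\<lambda>x. u x - v x) \<in> W"
proof -
  have "(\<lambda>x. u x + (-1) * v x) \<in> W" using assms by (intro subspc_add subspc_scale)
  then show ?thesis by simp
qed

lemma subspc_sum: assumes "subspc W" "\<And>i. i \<in> I \<Longrightarrow> u i \<in> W" shows "(\<lambda>x. \<Sum>i\<in>I. u i x) \<in> W"
  using assms(2)
proof (induction I rule: infinite_finite_induct)
  case (insert i I)
  then have "u i \<in> W" "(\<lambda>x. \<Sum>i\<in>I. u i x) \<in> W" by auto
  then have "(\<lambda>x. u i x + (\<Sum>i\<in>I. u i x)) \<in> W" by (rule subspc_add[OF assms(1)])
  then show ?case using insert.hyps by simp
qed (use assms(1) in \<open>auto simp: subspc_def\<close>)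

lemma poly_eqI_infinite:
  fixes P Q :: "'r::idom poly"
  assumes "infinite (UNIV :: 'r set)" "\<And>c. poly P c = poly Q c"
  shows "P = Q"
proof (rule ccontr)
  assume "P \<noteq> Q"
  then have "finite {c. poly (P - Q) c = 0}" by (intro poly_roots_finite) simp
  moreover have "{c. poly (P - Q) c = 0} = UNIV" using assms(2) by simp
  ultimately show False using assms(1) by simp
qed

text \<open>Lagrange interpolation. The weights depend on the nodes and on e but not on q, so a
  coefficient of a polynomial family stays in any linear space that contains the values at the
  nodes.\<close>

lemma coeff_by_values:
  fixes t :: "nat \<Rightarrow> 'r::field"
  assumes t: "inj_on t {..M}"
  obtains c where "\<And>q. degree q \<le> M \<Longrightarrow> coeff q e = (\<Sum>j\<le>M. c j * poly q (t j))"
proof -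
  define l where "l = (\<lambda>j. \<Prod>i\<in>{..M} - {j}. smult (inverse (t j - t i)) [:- t i, 1:])"
  have val: "poly (l j) (t k) = (if j = k then 1 else 0)" if "j \<le> M" "k \<le> M" for j k
  proof (cases "j = k")
    case True
    have "inverse (t j - t i) * (t j - t i) = 1" if "i \<in> {..M} - {j}" for i
      using that \<open>j \<le> M\<close> inj_onD[OF t, of j i] by (intro left_inverse) auto
    then show ?thesis using True by (simp add: l_def poly_prod algebra_simps)
  next
    case False
    then show ?thesis using that by (auto simp: l_def poly_prod intro!: prod_zero bexI[of _ k])
  qed
  have deg: "degree (l j) \<le> M" if "j \<le> M" for j
  proof -
    have "degree (l j) \<le> sum (degree \<circ> (\<lambda>i. smult (inverse (t j - t i)) [:- t i, 1:])) ({..M} - {j})"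
      unfolding l_def by (rule degree_prod_sum_le) simp
    also have "\<dots> \<le> (\<Sum>i\<in>{..M} - {j}. 1)" by (intro sum_mono) simp
    finally show ?thesis using that by simp
  qed
  show thesis
  proof
    fix q :: "'r poly" assume q: "degree q \<le> M"
    define d where "d = q - (\<Sum>j\<le>M. smult (poly q (t j)) (l j))"
    have "d = 0"
    proof (rule ccontr)
      assume d: "d \<noteq> 0"
      have "degree d \<le> M" unfolding d_def
        by (intro degree_diff_le q degree_sum_le order_trans[OF degree_smult_le deg]) auto
      moreover have "poly d (t k) = 0" if "k \<le> M" for k
        using that by (simp add: d_def poly_sum val if_distrib cong: if_cong)
      then have "card (t ` {..M}) \<le> card {x. poly d x = 0}"
        using d by (intro card_mono poly_roots_finite) auto
      then have "Suc M \<le> degree d" using card_poly_roots_bound[OF d] by (simp add: card_image[OF t])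
      ultimately show False by simp
    qed
    then have "q = (\<Sum>j\<le>M. smult (poly q (t j)) (l j))" by (simp add: d_def)
    then have "coeff q e = coeff (\<Sum>j\<le>M. smult (poly q (t j)) (l j)) e" by (rule arg_cong)
    then show "coeff q e = (\<Sum>j\<le>M. coeff (l j) e * poly q (t j))" by (simp add: coeff_sum mult.commute)
  qed
qed


lemma extract_coeff_poly:
  assumes W: "subspc (W :: ('x \<Rightarrow> 'r::field) set)" and T: "infinite T"
    and q: "\<And>t. t \<in> T \<Longrightarrow> (\<lambda>x. poly (q x) t) \<in> W" "\<And>x. degree (q x) \<le> M"
  shows "(\<lambda>x. coeff (q x) e) \<in> W"
proof -
  obtain t :: "nat \<Rightarrow> 'r" where t: "inj t" "range t \<subseteq> T" using infinite_countable_subset[OF T] by blast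
  obtain c where c: "\<And>q. degree q \<le> M \<Longrightarrow> coeff q e = (\<Sum>j\<le>M. c j * poly q (t j))"
    using coeff_by_values[OF inj_on_subset[OF t(1) subset_UNIV]] by blast
  show ?thesis unfolding c[OF q(2)]
    using t(2) by (intro subspc_sum[OF W] subspc_scale[OF W] q(1)) auto
qed

text \<open>T may omit 0 itself. An operation that divides by t, or needs a nonzero constant, is
  carried to its degenerate limit in this way.\<close>

lemma extract_at_0:
  assumes "subspc (W :: ('x \<Rightarrow> 'r::field) set)" "infinite T" "tpoly f" "\<And>t. t \<in> T \<Longrightarrow> f t \<in> W"
  shows "f 0 \<in> W"
proof -
  obtain M q where 1: "\<And>x. degree (q x) \<le> M" "\<And>t x. f t x = poly (q x) t" using assms(3) unfolding tpoly_def by metis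
  have "f t = (\<lambda>x. poly (q x) t)" for t using 1(2) by auto
  then have "(\<lambda>x. coeff (q x) 0) \<in> W" using assms 1(1) by (intro extract_coeff_poly[of W T q M]) auto
  moreover have "f 0 = (\<lambda>x. coeff (q x) 0)" using 1(2) by (auto simp: poly_0_coeff_0)
  ultimately show ?thesis by simp
qed

section \<open>Evaluation\<close>

definition mval :: "nat \<Rightarrow> (nat \<Rightarrow> 'r::comm_ring_1) \<Rightarrow> (nat \<Rightarrow> nat) \<Rightarrow> 'r" where
  "mval n y e = (\<Prod>j<n. y j ^ e j)"

definition evR :: "nat \<Rightarrow> 'r::comm_ring_1 elt \<Rightarrow> (nat \<Rightarrow> 'r) \<Rightarrow> nat set \<Rightarrow> 'r" where
  "evR n F y S = (\<Sum>m\<in>supp F. if fst m = S then F m * mval n y (snd m) else 0)"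

definition emb :: "'k::field elt \<Rightarrow> 'k alg_closure elt" where
  "emb f = (\<lambda>m. to_ac (f m))"

abbreviation ev :: "nat \<Rightarrow> 'k::field elt \<Rightarrow> (nat \<Rightarrow> 'k alg_closure) \<Rightarrow> nat set \<Rightarrow> 'k alg_closure" where
  "ev n f \<equiv> evR n (emb f)"

lemma emb_apply: "emb f m = to_ac (f m)" by (simp add: emb_def)

lemma supp_emb [simp]: "supp (emb f) = supp f"
  by (auto simp: supp_def emb_def)

lemma evR_superset:
  assumes "finite M" "supp F \<subseteq> M"
  shows "evR n F y S = (\<Sum>m\<in>M. if fst m = S then F m * mval n y (snd m) else 0)"
  unfolding evR_def using assms by (intro sum.mono_neutral_left) (auto simp: supp_def)

lemma supp_sum: "supp (\<lambda>m. \<Sum>i\<in>I. c i * F i m) \<subseteq> (\<Union>i\<in>I. supp (F i :: 'r::comm_ring_1 elt))"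
proof
  fix m assume "m \<in> supp (\<lambda>m. \<Sum>i\<in>I. c i * F i m)"
  then have "(\<Sum>i\<in>I. c i * F i m) \<noteq> 0" by (simp add: supp_def)
  then obtain i where "i \<in> I" "c i * F i m \<noteq> 0" by (rule sum.not_neutral_contains_not_neutral)
  then show "m \<in> (\<Union>i\<in>I. supp (F i))" unfolding supp_def by (metis (mono_tags, lifting) UN_iff mem_Collect_eq mult_zero_right)
qed

lemma evR_sum:
  assumes "finite I" "\<And>i. i \<in> I \<Longrightarrow> finite (supp (F i))"
  shows "evR n (\<lambda>m. \<Sum>i\<in>I. c i * F i m) y S = (\<Sum>i\<in>I. c i * evR n (F i) y S)"
proof -
  define M where "M = (\<Union>i\<in>I. supp (F i))"
  have M: "finite M" using assms by (simp add: M_def)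
  have "evR n (\<lambda>m. \<Sum>i\<in>I. c i * F i m) y S = (\<Sum>m\<in>M. if fst m = S then (\<Sum>i\<in>I. c i * F i m) * mval n y (snd m) else 0)"
    by (rule evR_superset[OF M]) (auto simp: M_def intro: supp_sum[THEN subsetD])
  also have "\<dots> = (\<Sum>m\<in>M. \<Sum>i\<in>I. c i * (if fst m = S then F i m * mval n y (snd m) else 0))"
  proof (intro sum.cong refl)
    fix m
    show "(if fst m = S then (\<Sum>i\<in>I. c i * F i m) * mval n y (snd m) else 0) = (\<Sum>i\<in>I. c i * (if fst m = S then F i m * mval n y (snd m) else 0))"
      by (cases "fst m = S") (simp_all add: sum_distrib_right mult.assoc)
  qed
  also have "\<dots> = (\<Sum>i\<in>I. c i * (\<Sum>m\<in>M. if fst m = S then F i m * mval n y (snd m) else 0))"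
    by (subst sum.swap) (simp only: sum_distrib_left)
  also have "\<dots> = (\<Sum>i\<in>I. c i * evR n (F i) y S)"
    by (intro sum.cong refl) (subst evR_superset[OF M], auto simp: M_def)
  finally show ?thesis .
qed

lemma evR_add:
  assumes "finite (supp F)" "finite (supp G)"
  shows "evR n (\<lambda>m. F m + G m) y S = evR n F y S + evR n G y S"
  using evR_sum[of "{True,False}" "\<lambda>b. if b then F else G" n "\<lambda>_. 1" y S] assms by simp

lemma evR_scale:
  assumes "finite (supp F)"
  shows "evR n (\<lambda>m. c * F m) y S = c * evR n F y S"
  using evR_sum[of "{True}" "\<lambda>b. F" n "\<lambda>_. c" y S] assms by simp

lemma supp_single: "supp (single m c) \<subseteq> {m}"
  by (auto simp: supp_def single_def)

lemma finite_supp_single [simp]: "finite (supp (single m c))"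
  using supp_single finite_subset by (metis finite.emptyI finite.insertI)

lemma evR_single: "evR n (single m c) y S = (if fst m = S then c * mval n y (snd m) else 0)"
  by (subst evR_superset[OF _ supp_single]) (auto simp: single_def)

lemma emb_single: "emb (single m c) = single m (to_ac c)"
  by (auto simp: emb_def single_def)

lemma H_finite: "f \<in> H n \<Longrightarrow> finite (supp f)" by (simp add: H_def)

lemma H_ok: "f \<in> H n \<Longrightarrow> m \<in> supp f \<Longrightarrow> mono_ok n m" by (simp add: H_def)

lemma H_I: "finite (supp f) \<Longrightarrow> (\<And>m. m \<in> supp f \<Longrightarrow> mono_ok n m) \<Longrightarrow> f \<in> H n" by (simp add: H_def)

lemma H_emb [simp]: "emb f \<in> H n \<longleftrightarrow> f \<in> H n" by (simp add: H_def)

lemma H_single: "mono_ok n m \<Longrightarrow> single m c \<in> H n"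
  using supp_single[of m c] by (intro H_I) auto

lemma H_sum:
  assumes "finite I" "\<And>i. i \<in> I \<Longrightarrow> (F i :: 'r::comm_ring_1 elt) \<in> H n"
  shows "(\<lambda>m. \<Sum>i\<in>I. c i * F i m) \<in> H n"
proof (rule H_I)
  show "finite (supp (\<lambda>m. \<Sum>i\<in>I. c i * F i m))"
    by (rule finite_subset[OF supp_sum]) (intro finite_UN_I assms(1) H_finite[OF assms(2)])
  fix m assume "m \<in> supp (\<lambda>m. \<Sum>i\<in>I. c i * F i m)"
  then have "m \<in> (\<Union>i\<in>I. supp (F i))" by (rule supp_sum[THEN subsetD])
  then show "mono_ok n m" using assms H_ok by blast
qed

lemma H_sum1:
  assumes "finite I" "\<And>i. i \<in> I \<Longrightarrow> (F i :: 'r::comm_ring_1 elt) \<in> H n"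
  shows "(\<lambda>m. \<Sum>i\<in>I. F i m) \<in> H n"
  using H_sum[OF assms, where c = "\<lambda>_. 1"] by simp

lemma H_lin_ext:
  assumes "finite (supp f)" "\<And>m. m \<in> supp f \<Longrightarrow> G m \<in> H n"
  shows "lin_ext G f \<in> H n"
  unfolding lin_ext_def using assms by (rule H_sum)

lemma emb_lin_ext: "emb (lin_ext G f) = (\<lambda>m. \<Sum>m'\<in>supp f. to_ac (f m') * emb (G m') m)"
  by (auto simp: emb_def lin_ext_def to_ac_sum)

lemma ev_lin_ext:
  assumes "finite (supp f)" "\<And>m. m \<in> supp f \<Longrightarrow> finite (supp (G m))"
  shows "ev n (lin_ext G f) y S = (\<Sum>m\<in>supp f. to_ac (f m) * ev n (G m) y S)"
  unfolding emb_lin_ext using assms by (intro evR_sum) auto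

lemma emb_sum1: "emb (\<lambda>m. \<Sum>i\<in>I. F i m) = (\<lambda>m. \<Sum>i\<in>I. 1 * emb (F i) m)"
  by (auto simp: emb_def to_ac_sum)

lemma ev_sum1:
  assumes "finite I" "\<And>i. i \<in> I \<Longrightarrow> finite (supp (F i))"
  shows "ev n (\<lambda>m. \<Sum>i\<in>I. F i m) y S = (\<Sum>i\<in>I. ev n (F i) y S)"
  unfolding emb_sum1 using assms by (subst evR_sum) auto

subsection \<open>Products\<close>

lemma mval_add: "mval n y (\<lambda>i. a i + b i) = mval n y a * mval n y b"
  by (simp add: mval_def power_add prod.distrib)

lemma to_ac_xsign: "to_ac (xsign S T) = xsign S T"
  by (simp add: xsign_def)

lemma ev_mono_mult: "ev n (mono_mult m1 m2) y U =
   (if fst m1 \<inter> fst m2 = {} \<and> fst m1 \<union> fst m2 = U then xsign (fst m1) (fst m2) * mval n y (snd m1) * mval n y (snd m2) else 0)"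
proof (cases "fst m1 \<inter> fst m2 = {}")
  case True
  then show ?thesis by (simp add: mono_mult_def emb_single evR_single mval_add to_ac_xsign)
next
  case False
  have "emb (ezero :: 'a elt) = single m1 0" by (auto simp: emb_def ezero_def single_def)
  with False show ?thesis by (simp add: mono_mult_def evR_single)
qed

lemma mono_mult_supp: "supp (mono_mult m1 m2) \<subseteq> {(fst m1 \<union> fst m2, \<lambda>i. snd m1 i + snd m2 i)}"
  using supp_single by (auto simp: mono_mult_def ezero_def supp_def)

lemma finite_supp_mono_mult [simp]: "finite (supp (mono_mult m1 m2))"
  using mono_mult_supp finite_subset by (metis finite.emptyI finite.insertI)

lemma mono_mult_H: "mono_ok n m1 \<Longrightarrow> mono_ok n m2 \<Longrightarrow> mono_mult m1 m2 \<in> H n"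
  by (rule H_I) (auto simp: mono_ok_def dest!: subsetD[OF mono_mult_supp])

lemma emult_alt: "emult f g = (\<lambda>m. \<Sum>z\<in>supp f \<times> supp g. (f (fst z) * g (snd z)) * mono_mult (fst z) (snd z) m)"
  unfolding emult_def by (simp add: case_prod_beta)

lemma H_emult: "f \<in> H n \<Longrightarrow> g \<in> H n \<Longrightarrow> emult f g \<in> H n"
  unfolding emult_alt by (intro H_sum) (auto simp: H_finite H_ok intro!: mono_mult_H)

lemma emb_emult: "emb (emult f g) = (\<lambda>m. \<Sum>z\<in>supp f \<times> supp g. (to_ac (f (fst z)) * to_ac (g (snd z))) * emb (mono_mult (fst z) (snd z)) m)"
  unfolding emult_alt by (simp add: emb_def to_ac_sum)

lemma ev_emult:
  assumes "finite M1" "supp f \<subseteq> M1" "finite M2" "supp g \<subseteq> M2"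
  shows "ev n (emult f g) y U = (\<Sum>m1\<in>M1. \<Sum>m2\<in>M2. to_ac (f m1) * to_ac (g m2) *
     (if fst m1 \<inter> fst m2 = {} \<and> fst m1 \<union> fst m2 = U then xsign (fst m1) (fst m2) * mval n y (snd m1) * mval n y (snd m2) else 0))"
proof -
  have fin: "finite (supp f)" "finite (supp g)" using assms finite_subset by auto
  have "ev n (emult f g) y U = (\<Sum>z\<in>supp f \<times> supp g. to_ac (f (fst z)) * to_ac (g (snd z)) * ev n (mono_mult (fst z) (snd z)) y U)"
    unfolding emb_emult using fin by (intro evR_sum) auto
  also have "\<dots> = (\<Sum>z\<in>M1 \<times> M2. to_ac (f (fst z)) * to_ac (g (snd z)) * ev n (mono_mult (fst z) (snd z)) y U)"
    using assms by (intro sum.mono_neutral_left) (auto simp: supp_def)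
  also have "\<dots> = (\<Sum>m1\<in>M1. \<Sum>m2\<in>M2. to_ac (f m1) * to_ac (g m2) * ev n (mono_mult m1 m2) y U)"
    by (simp add: sum.cartesian_product case_prod_beta)
  finally show ?thesis by (simp only: ev_mono_mult)
qed

definition Hp :: "nat \<Rightarrow> 'k::zero elt set" where
  "Hp n = {f \<in> H n. \<forall>m\<in>supp f. fst m = {}}"

lemma xsign_empty: "xsign S {} = 1" "xsign {} S = 1"
  by (simp_all add: xsign_def)

text \<open>A right factor without exterior generators produces no sign, so the product is
  pointwise. All powers that occur are factors of this kind.\<close>

lemma ev_emult_poly:
  assumes f: "f \<in> H n" and g: "g \<in> Hp n"
  shows "ev n (emult f g) y U = ev n f y U * ev n g y {}"
proof -
  have fin: "finite (supp f)" "finite (supp g)" using assms by (auto simp: Hp_def H_finite)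
  have g0: "fst m = {}" if "m \<in> supp g" for m using g that by (simp add: Hp_def)
  have "ev n (emult f g) y U = (\<Sum>m1\<in>supp f. \<Sum>m2\<in>supp g.
      (if fst m1 = U then emb f m1 * mval n y (snd m1) else 0) * (if fst m2 = {} then emb g m2 * mval n y (snd m2) else 0))"
    unfolding ev_emult[OF fin(1) subset_refl fin(2) subset_refl]
    by (intro sum.cong refl) (auto simp: g0 xsign_empty emb_apply)
  then show ?thesis by (simp add: evR_def sum_product)
qed

lemma Hp_emult:
  fixes f g :: "'k::comm_ring_1 elt"
  assumes fg: "f \<in> Hp n" "g \<in> Hp n"
  shows "emult f g \<in> Hp n"
proof -
  have "fst m = {}" if "m \<in> supp (emult f g)" for m
  proof -
    from that have "m \<in> (\<Union>z\<in>supp f \<times> supp g. supp (mono_mult (fst z) (snd z) :: 'k elt))"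
      unfolding emult_alt by (rule supp_sum[THEN subsetD])
    then obtain m1 m2 where m: "m1 \<in> supp f" "m2 \<in> supp g" "m \<in> supp (mono_mult m1 m2 :: 'k elt)" by auto
    from subsetD[OF mono_mult_supp m(3)] m fg show ?thesis by (auto simp: Hp_def)
  qed
  with fg show ?thesis by (simp add: Hp_def H_emult)
qed

lemma Hp_one: "eone \<in> Hp n"
  by (auto simp: Hp_def eone_def mono_ok_def intro!: H_single dest!: subsetD[OF supp_single])

lemma ev_one: "ev n eone y S = (delta {} S)"
  by (simp add: eone_def emb_single evR_single mval_def delta_def)

lemma Hp_H: "f \<in> Hp n \<Longrightarrow> f \<in> H n" by (simp add: Hp_def)

lemma epow_Suc: "epow f (Suc k) = emult f (epow f k)" by (simp add: epow_def)

lemma Hp_epow: "f \<in> Hp n \<Longrightarrow> epow f k \<in> Hp n"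
proof (induction k)
  case 0
  then show ?case by (simp add: epow_def Hp_one)
next
  case (Suc k)
  then show ?case by (simp add: epow_Suc Hp_emult)
qed

lemma ev_epow: "f \<in> Hp n \<Longrightarrow> ev n (epow f k) y {} = ev n f y {} ^ k"
proof (induction k)
  case 0
  then show ?case using ev_one[of n y "{}"] by (simp add: epow_def delta_def)
next
  case (Suc k)
  then show ?case by (simp add: epow_Suc ev_emult_poly Hp_H Hp_epow)
qed

lemma xlin_alt: "xlin n A s = (\<lambda>m. \<Sum>j<n. single ({j}, \<lambda>_. 0) (A j s) m)"
  by (simp add: xlin_def)

lemma H_xlin: "xlin n A s \<in> H n"
  unfolding xlin_alt by (intro H_sum1 H_single) (auto simp: mono_ok_def)

lemma Hp_ylin: "ylin n A s \<in> Hp n"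
proof -
  let ?F = "\<lambda>j. single ({}, \<lambda>k. if k = j then 1 else 0) (A j s) :: 'a elt"
  have "ylin n A s \<in> H n"
    unfolding ylin_def by (intro H_sum1 H_single) (auto simp: mono_ok_def)
  moreover have "fst m = {}" if "m \<in> supp (ylin n A s)" for m
  proof -
    have "m \<in> supp (\<lambda>m. \<Sum>j<n. 1 * ?F j m)" using that by (simp add: ylin_def)
    then have "m \<in> (\<Union>j<n. supp (?F j))" by (rule supp_sum[THEN subsetD])
    then show ?thesis using supp_single by fastforce
  qed
  ultimately show ?thesis by (simp add: Hp_def)
qed

abbreviation acm :: "(nat \<Rightarrow> nat \<Rightarrow> 'k::field) \<Rightarrow> nat \<Rightarrow> nat \<Rightarrow> 'k alg_closure" where
  "acm A \<equiv> \<lambda>i j. to_ac (A i j)"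

lemma prod_power_delta: "(i::nat) < n \<Longrightarrow> (\<Prod>j<n. y j ^ (if j = i then 1 else 0)) = (y i :: 'r::comm_ring_1)"
proof -
  assume i: "i < n"
  have "(\<Prod>j<n. y j ^ (if j = i then 1 else 0)) = (\<Prod>j<n. if j = i then y j else 1)"
    by (intro prod.cong) auto
  then show ?thesis using i prod.delta[of "{..<n}" i y] by simp
qed

lemma ev_ylin: "ev n (ylin n A s) y {} = tr n (acm A) y s"
proof -
  have "ev n (ylin n A s) y {} = (\<Sum>j<n. ev n (single ({}, \<lambda>k. if k = j then 1 else 0) (A j s)) y {})"
    unfolding ylin_def by (rule ev_sum1) auto
  also have "\<dots> = tr n (acm A) y s"
    unfolding tr_def
  proof (intro sum.cong refl)
    fix j assume j: "j \<in> {..<n}"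
    have "(\<Prod>i<n. y i ^ (if i = j then 1 else 0)) = y j" using j by (simp add: prod_power_delta)
    then show "ev n (single ({}, \<lambda>k. if k = j then 1 else 0) (A j s)) y {} = to_ac (A j s) * y j"
      by (simp add: emb_single evR_single mval_def)
  qed
  finally show ?thesis .
qed

lemma xsign_single: "xsign {j} S = sg S j"
proof -
  have "{(i, k). i \<in> {j} \<and> k \<in> S \<and> k < i} = Pair j ` {k \<in> S. k < j}" by auto
  moreover have "card (Pair j ` {k \<in> S. k < j}) = card {k \<in> S. k < j}" by (rule card_image) (auto simp: inj_on_def)
  ultimately show ?thesis by (simp only: xsign_def sg_def)
qed

lemma xlin_apply: "xlin n A s ({j}, \<lambda>_. 0) = (if j < n then A j s else 0)"
proof -
  have "xlin n A s ({j}, \<lambda>_. 0) = (\<Sum>i<n. if i = j then A i s else 0)"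
    unfolding xlin_def single_def by (intro sum.cong) auto
  then show ?thesis by simp
qed

text \<open>x_j times x_(U - {j}) is x_U up to the parity of the number of elements of U below j,
  which is the sign built into \<open>eps\<close>.\<close>

lemma ev_emult_xlin:
  assumes h: "h \<in> H n"
  shows "ev n (emult (xlin n A s) h) y U = eps n (\<lambda>j. to_ac (A j s)) (ev n h y) U"
proof -
  let ?v = "\<lambda>j. ({j}, \<lambda>_. 0) :: mono"
  have sub: "supp (xlin n A s) \<subseteq> ?v ` {..<n}"
  proof
    fix m assume "m \<in> supp (xlin n A s)"
    then have "m \<in> supp (\<lambda>m. \<Sum>j<n. 1 * single ({j}, \<lambda>_. 0) (A j s) m)" by (simp add: xlin_def)
    then have "m \<in> (\<Union>j<n. supp (single ({j}, \<lambda>_. 0) (A j s)))" by (rule supp_sum[THEN subsetD])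
    then show "m \<in> ?v ` {..<n}" using supp_single by fastforce
  qed
  have inj: "inj_on ?v {..<n}" by (auto simp: inj_on_def)
  have "ev n (emult (xlin n A s) h) y U = (\<Sum>j<n. \<Sum>m2\<in>supp h. to_ac (A j s) * to_ac (h m2) *
     (if {j} \<inter> fst m2 = {} \<and> {j} \<union> fst m2 = U then xsign {j} (fst m2) * mval n y (\<lambda>_. 0) * mval n y (snd m2) else 0))"
    by (subst ev_emult[OF _ sub H_finite[OF h] subset_refl]) (simp_all add: sum.reindex[OF inj] xlin_apply cong: if_cong)
  also have "\<dots> = eps n (\<lambda>j. to_ac (A j s)) (ev n h y) U"
    unfolding eps_def
  proof (intro sum.cong refl)
    fix j assume j: "j \<in> {..<n}"
    have eq: "({j} \<inter> fst m2 = {} \<and> {j} \<union> fst m2 = U) \<longleftrightarrow> j \<in> U \<and> fst m2 = U - {j}" for m2 :: mono by auto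
    show "(\<Sum>m2\<in>supp h. to_ac (A j s) * to_ac (h m2) *
     (if {j} \<inter> fst m2 = {} \<and> {j} \<union> fst m2 = U then xsign {j} (fst m2) * mval n y (\<lambda>_. 0) * mval n y (snd m2) else 0))
      = (if j \<in> U then to_ac (A j s) * sg (U - {j}) j * ev n h y (U - {j}) else 0)"
    proof (cases "j \<in> U")
      case True
      show ?thesis unfolding eq using True
        by (auto simp: evR_def sum_distrib_left xsign_single mval_def emb_apply mult_ac intro!: sum.cong)
    next
      case False
      then show ?thesis unfolding eq by simp
    qed
  qed
  finally show ?thesis .
qed

lemma ev_xpart:
  "foldr emult (map (xlin n A) ss) eone \<in> H n \<and> ev n (foldr emult (map (xlin n A) ss) eone) y = elist n (acm A) ss"
proof (induction ss)
  case Nil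
  then show ?case by (auto simp: Hp_H[OF Hp_one] ev_one)
next
  case (Cons s ss)
  then have "foldr emult (map (xlin n A) ss) eone \<in> H n" by simp
  from ev_emult_xlin[OF this, of A s y] Cons show ?case by (auto intro!: H_emult H_xlin)
qed

lemma ev_ypart:
  "foldr (\<lambda>i acc. emult (epow (ylin n A i) (e i)) acc) is eone \<in> Hp n \<and>
   ev n (foldr (\<lambda>i acc. emult (epow (ylin n A i) (e i)) acc) is eone) y {} = (\<Prod>i\<leftarrow>is. tr n (acm A) y i ^ e i)"
proof (induction "is")
  case Nil
  then show ?case by (auto simp: Hp_one ev_one delta_def)
next
  case (Cons i "is")
  then show ?case by (simp add: Hp_emult Hp_epow Hp_ylin ev_emult_poly Hp_H ev_epow ev_ylin)
qed

lemma H_act_mono: "act_mono n (A :: nat \<Rightarrow> nat \<Rightarrow> 'k::field) m \<in> H n"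
  unfolding act_mono_def by (rule H_emult[OF conjunct1[OF ev_xpart] Hp_H[OF conjunct1[OF ev_ypart]]])

lemma ev_act_mono: "ev n (act_mono n A m) y U = lam n (acm A) (fst m) U * mval n (tr n (acm A) y) (snd m)"
proof -
  have "ev n (act_mono n A m) y U = ev n (foldr emult (map (xlin n A) (sorted_list_of_set (fst m))) eone) y U *
     ev n (foldr (\<lambda>i acc. emult (epow (ylin n A i) (snd m i)) acc) [0..<n] eone) y {}"
    unfolding act_mono_def by (rule ev_emult_poly[OF conjunct1[OF ev_xpart] conjunct1[OF ev_ypart]])
  also have "\<dots> = lam n (acm A) (fst m) U * (\<Prod>i\<leftarrow>[0..<n]. tr n (acm A) y i ^ snd m i)"
    by (simp add: ev_xpart ev_ypart lam_def)
  also have "(\<Prod>i\<leftarrow>[0..<n]. tr n (acm A) y i ^ snd m i) = mval n (tr n (acm A) y) (snd m)"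
    unfolding mval_def by (subst prod.distinct_set_conv_list[symmetric]) (auto simp: atLeast0LessThan)
  finally show ?thesis .
qed

lemma H_act: "f \<in> H n \<Longrightarrow> act n (A :: nat \<Rightarrow> nat \<Rightarrow> 'k::field) f \<in> H n"
  unfolding act_def by (intro H_lin_ext H_act_mono H_finite)

lemma ev_act:
  assumes f: "f \<in> H n"
  shows "ev n (act n A f) y U = Lam n (acm A) (ev n f (tr n (acm A) y)) U"
proof -
  have "ev n (act n A f) y U = (\<Sum>m\<in>supp f. to_ac (f m) * ev n (act_mono n A m) y U)"
    unfolding act_def using f by (intro ev_lin_ext) (auto simp: H_finite intro: H_finite H_act_mono)
  also have "\<dots> = (\<Sum>m\<in>supp f. \<Sum>S\<in>Pow {..<n}. (if fst m = S then to_ac (f m) * mval n (tr n (acm A) y) (snd m) else 0) * lam n (acm A) S U)"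
  proof (intro sum.cong refl)
    fix m assume "m \<in> supp f"
    then have "fst m \<in> Pow {..<n}" using H_ok[OF f, of m] by (auto simp: mono_ok_def)
    moreover have "(\<Sum>S\<in>Pow {..<n}. (if fst m = S then to_ac (f m) * mval n (tr n (acm A) y) (snd m) else 0) * lam n (acm A) S U)
        = (\<Sum>S\<in>Pow {..<n}. if S = fst m then to_ac (f m) * mval n (tr n (acm A) y) (snd m) * lam n (acm A) S U else 0)"
      by (intro sum.cong refl) simp
    ultimately show "to_ac (f m) * ev n (act_mono n A m) y U = (\<Sum>S\<in>Pow {..<n}. (if fst m = S then to_ac (f m) * mval n (tr n (acm A) y) (snd m) else 0) * lam n (acm A) S U)"
      by (simp add: ev_act_mono mult_ac sum.delta)
  qed
  also have "\<dots> = Lam n (acm A) (ev n f (tr n (acm A) y)) U"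
    unfolding Lam_def evR_def by (subst sum.swap) (simp add: sum_distrib_right emb_apply cong: if_cong)
  finally show ?thesis .
qed

subsection \<open>Steenrod operations\<close>

lemma H_bmono: assumes "mono_ok n m" shows "bmono m \<in> H n"
  unfolding bmono_def using assms
  by (intro H_sum1 H_single) (auto simp: mono_ok_def intro: finite_subset)

lemma H_Bock: "f \<in> H n \<Longrightarrow> Bock f \<in> H n"
  unfolding Bock_def by (intro H_lin_ext H_bmono) (auto simp: H_finite H_ok)

lemma mval_upd: "i < n \<Longrightarrow> mval n y (e(i := e i + 1)) = y i * mval n y e"
proof -
  assume i: "i < n"
  have "mval n y (e(i := e i + 1)) = mval n y (\<lambda>j. e j + (if j = i then 1 else 0))"
    by (intro arg_cong[of _ _ "mval n y"]) auto
  also have "\<dots> = y i * mval n y e"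
    unfolding mval_add using prod_power_delta[OF i, of y] by (simp add: mval_def mult.commute)
  finally show ?thesis .
qed

lemma ev_bmono:
  assumes "mono_ok n m"
  shows "ev n (bmono m) y T = (\<Sum>j<n. if j \<in> T then 0 else sg T j * y j * (if fst m = insert j T then mval n y (snd m) else 0))"
proof -
  have S: "fst m \<subseteq> {..<n}" "finite (fst m)" using assms by (auto simp: mono_ok_def intro: finite_subset)
  have "ev n (bmono m) y T = (\<Sum>i\<in>fst m. ev n (single (fst m - {i}, (snd m)(i := snd m i + 1)) ((-1) ^ card {j \<in> fst m. j < i})) y T)"
    unfolding bmono_def using S by (intro ev_sum1) auto
  also have "\<dots> = (\<Sum>i\<in>fst m. if fst m - {i} = T then sg T i * y i * mval n y (snd m) else 0)"
  proof (intro sum.cong refl)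
    fix i assume i: "i \<in> fst m"
    then have "{j \<in> fst m. j < i} = {j \<in> fst m - {i}. j < i}" by auto
    then have "(-1) ^ card {j \<in> fst m. j < i} = (sg (fst m - {i}) i :: 'a alg_closure)" by (simp only: sg_def)
    moreover have "mval n y ((snd m)(i := snd m i + 1)) = y i * mval n y (snd m)" by (rule mval_upd) (use i S in auto)
    ultimately show "ev n (single (fst m - {i}, (snd m)(i := snd m i + 1)) ((-1) ^ card {j \<in> fst m. j < i})) y T =
        (if fst m - {i} = T then sg T i * y i * mval n y (snd m) else 0)"
      by (auto simp: emb_single evR_single simp del: fun_upd_apply)
  qed
  also have "\<dots> = (\<Sum>j<n. if j \<in> T then 0 else sg T j * y j * (if fst m = insert j T then mval n y (snd m) else 0))"
    using S by (intro sum.mono_neutral_cong_left) auto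
  finally show ?thesis .
qed

text \<open>The Bockstein is the derivation sum_i y_i d/dx_i, hence contraction with the point
  itself; the Milnor primitives contract with its Frobenius powers.\<close>

lemma ev_Bock:
  assumes f: "f \<in> H n"
  shows "ev n (Bock f) y T = iota n y (ev n f y) T"
proof -
  have "ev n (Bock f) y T = (\<Sum>m\<in>supp f. to_ac (f m) * ev n (bmono m) y T)"
    unfolding Bock_def using f by (intro ev_lin_ext) (auto simp: H_finite intro: H_finite[OF H_bmono] H_ok)
  also have "\<dots> = (\<Sum>m\<in>supp f. \<Sum>j<n. if j \<in> T then 0 else sg T j * y j * (if fst m = insert j T then to_ac (f m) * mval n y (snd m) else 0))"
  proof (intro sum.cong refl)
    fix m assume "m \<in> supp f"
    then have "mono_ok n m" using f by (rule H_ok[rotated])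
    then show "to_ac (f m) * ev n (bmono m) y T = (\<Sum>j<n. if j \<in> T then 0 else sg T j * y j * (if fst m = insert j T then to_ac (f m) * mval n y (snd m) else 0))"
      unfolding ev_bmono[OF \<open>mono_ok n m\<close>] sum_distrib_left by (intro sum.cong) (auto simp: mult_ac)
  qed
  also have "\<dots> = iota n y (ev n f y) T"
    unfolding iota_def evR_def supp_emb by (subst sum.swap) (auto simp: sum_distrib_left emb_apply intro!: sum.cong)
  finally show ?thesis .
qed

definition kset :: "nat \<Rightarrow> (nat \<Rightarrow> nat) \<Rightarrow> (nat \<Rightarrow> nat) set" where
  "kset n e = {k. (\<forall>i. k i \<le> e i)}"

text \<open>Exponent vectors are zero outside {..<n}, whereas distributing a product over sums
  produces extensional functions; this passes between the two encodings.\<close>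

lemma kset_bij:
  assumes "\<forall>i\<ge>n. e i = 0"
  shows "bij_betw (\<lambda>k. restrict k {..<n}) (kset n e) (PiE {..<n} (\<lambda>i. {..e i}))"
proof (rule bij_betwI[where g = "\<lambda>k i. if i < n then k i else 0"])
  show "(\<lambda>k. restrict k {..<n}) \<in> kset n e \<rightarrow> (PiE {..<n} (\<lambda>i. {..e i}))" by (auto simp: kset_def)
  show "(\<lambda>k i. if i < n then k i else 0) \<in> (PiE {..<n} (\<lambda>i. {..e i})) \<rightarrow> kset n e" by (auto simp: kset_def PiE_iff)
  show "(\<lambda>i. if i < n then (restrict k {..<n}) i else 0) = k" if "k \<in> kset n e" for k
  proof
    fix i show "(if i < n then (restrict k {..<n}) i else 0) = k i"
      using that assms by (cases "i < n") (auto simp: kset_def, metis le_0_eq not_le)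
  qed
  show "restrict (\<lambda>i. if i < n then k i else 0) {..<n} = k" if "k \<in> (PiE {..<n} (\<lambda>i. {..e i}))" for k
  proof
    fix i show "restrict (\<lambda>i. if i < n then k i else 0) {..<n} i = k i"
      using that by (cases "i < n") (auto simp: PiE_iff extensional_def)
  qed
qed

lemma kset_finite: "\<forall>i\<ge>n. e i = 0 \<Longrightarrow> finite (kset n e)"
  by (subst bij_betw_finite[OF kset_bij]) (auto intro: finite_PiE)

lemma H_Pmono: assumes "mono_ok n m" shows "Pmono n p r m \<in> H n"
proof -
  have e0: "\<forall>i\<ge>n. snd m i = 0" and S: "fst m \<subseteq> {..<n}" using assms by (simp_all add: mono_ok_def)
  have "{k. (\<forall>i. k i \<le> snd m i) \<and> (\<Sum>i<n. k i) = r} \<subseteq> kset n (snd m)"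
    unfolding kset_def by blast
  then have "finite {k. (\<forall>i. k i \<le> snd m i) \<and> (\<Sum>i<n. k i) = r}"
    using kset_finite[OF e0] by (rule finite_subset)
  moreover have "mono_ok n (fst m, \<lambda>i. snd m i + (p - 1) * k i)" if k: "\<forall>i. k i \<le> snd m i" for k
  proof -
    have "k i = 0" if "i \<ge> n" for i using k[rule_format, of i] e0[rule_format, OF that] by simp
    then show ?thesis using e0 S by (simp add: mono_ok_def)
  qed
  ultimately show ?thesis unfolding Pmono_def by (intro H_sum1 H_single) auto
qed

lemma H_Pst: "f \<in> H n \<Longrightarrow> Pst n p r f \<in> H n"
  unfolding Pst_def by (intro H_lin_ext H_Pmono) (auto simp: H_finite H_ok)

text \<open>With t marking r, the sum over all k factors over the variables, and the binomial
  theorem yields (y + t y^p)^e in each. P^r vanishes beyond the total exponent, so a finite R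
  suffices.\<close>

lemma ev_Pmono:
  assumes m: "mono_ok n m" and p: "p > 0" and R: "(\<Sum>i<n. snd m i) \<le> R"
  shows "(\<Sum>r\<le>R. t ^ r * ev n (Pmono n p r m) y S) = (if fst m = S then mval n (\<lambda>j. y j + t * y j ^ p) (snd m) else 0)"
proof -
  let ?e = "snd m"
  have e0: "\<forall>i\<ge>n. ?e i = 0" using m by (simp add: mono_ok_def)
  let ?K = "kset n ?e"
  have fin: "finite ?K" using e0 by (rule kset_finite)
  define c where "c = (\<lambda>k. (\<Prod>i<n. of_nat (?e i choose k i) * y i ^ (?e i + (p - 1) * k i)))"
  have 1: "ev n (Pmono n p r m) y S = (\<Sum>k\<in>{k\<in>?K. (\<Sum>i<n. k i) = r}. if fst m = S then c k else 0)" for r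
  proof -
    have K: "{k. (\<forall>i. k i \<le> ?e i) \<and> (\<Sum>i<n. k i) = r} = {k\<in>?K. (\<Sum>i<n. k i) = r}" by (auto simp: kset_def)
    have "ev n (Pmono n p r m) y S = (\<Sum>k\<in>{k\<in>?K. (\<Sum>i<n. k i) = r}. ev n (single (fst m, \<lambda>i. ?e i + (p - 1) * k i) (\<Prod>i<n. of_nat (?e i choose k i))) y S)"
      unfolding Pmono_def K using fin by (intro ev_sum1) auto
    also have "\<dots> = (\<Sum>k\<in>{k\<in>?K. (\<Sum>i<n. k i) = r}. if fst m = S then c k else 0)"
      by (intro sum.cong refl) (auto simp: emb_single evR_single c_def mval_def to_ac_prod prod.distrib)
    finally show ?thesis .
  qed
  show ?thesis
  proof (cases "fst m = S")
    case False
    then show ?thesis by (simp add: 1)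
  next
    case True
    have "(\<Sum>r\<le>R. t ^ r * ev n (Pmono n p r m) y S) = (\<Sum>r\<le>R. \<Sum>k\<in>{k\<in>?K. (\<Sum>i<n. k i) = r}. t ^ (\<Sum>i<n. k i) * c k)"
      unfolding 1 sum_distrib_left using True by (intro sum.cong refl) auto
    also have "\<dots> = (\<Sum>k\<in>?K. t ^ (\<Sum>i<n. k i) * c k)"
    proof (rule sum.group[OF fin])
      show "(\<lambda>k. \<Sum>i<n. k i) ` ?K \<subseteq> {..R}"
      proof
        fix s assume "s \<in> (\<lambda>k. \<Sum>i<n. k i) ` ?K"
        then obtain k where "k \<in> ?K" "s = (\<Sum>i<n. k i)" by auto
        then have "s \<le> (\<Sum>i<n. ?e i)" by (auto simp: kset_def intro: sum_mono)
        then show "s \<in> {..R}" using R by simp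
      qed
    qed simp
    also have "\<dots> = (\<Sum>k\<in>?K. \<Prod>i<n. of_nat (?e i choose k i) * (t * y i ^ p) ^ k i * y i ^ (?e i - k i))"
    proof (intro sum.cong refl)
      fix k assume k: "k \<in> ?K"
      have "t ^ (\<Sum>i<n. k i) * c k = (\<Prod>i<n. t ^ k i * (of_nat (?e i choose k i) * y i ^ (?e i + (p - 1) * k i)))"
        by (simp add: c_def power_sum prod.distrib)
      also have "\<dots> = (\<Prod>i<n. of_nat (?e i choose k i) * (t * y i ^ p) ^ k i * y i ^ (?e i - k i))"
      proof (intro prod.cong refl)
        fix i
        have ki: "k i \<le> ?e i" using k by (simp add: kset_def)
        have "p * k i = k i + (p - 1) * k i" using p by (cases p) auto
        then have "?e i + (p - 1) * k i = p * k i + (?e i - k i)" using ki by linarith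
        then show "t ^ k i * (of_nat (?e i choose k i) * y i ^ (?e i + (p - 1) * k i)) = of_nat (?e i choose k i) * (t * y i ^ p) ^ k i * y i ^ (?e i - k i)"
          by (simp add: power_mult_distrib power_add power_mult mult_ac)
      qed
      finally show "t ^ (\<Sum>i<n. k i) * c k = (\<Prod>i<n. of_nat (?e i choose k i) * (t * y i ^ p) ^ k i * y i ^ (?e i - k i))" .
    qed
    also have "\<dots> = (\<Sum>k\<in>PiE {..<n} (\<lambda>i. {..?e i}). \<Prod>i<n. of_nat (?e i choose k i) * (t * y i ^ p) ^ k i * y i ^ (?e i - k i))"
      by (subst sum.reindex_bij_betw[OF kset_bij[OF e0], symmetric]) (auto intro!: sum.cong prod.cong)
    also have "\<dots> = (\<Prod>i<n. \<Sum>k\<le>?e i. of_nat (?e i choose k) * (t * y i ^ p) ^ k * y i ^ (?e i - k))"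
      by (rule prod_sum_PiE[symmetric]) auto
    also have "\<dots> = mval n (\<lambda>j. y j + t * y j ^ p) ?e"
      unfolding mval_def by (intro prod.cong refl) (simp only: binomial_ring[symmetric] add.commute)
    finally show ?thesis using True by simp
  qed
qed

text \<open>Every R from some R0 on is allowed, so that one truncation can serve both an element and
  its image under g.\<close>

lemma ev_Pst:
  assumes f: "f \<in> H n" and p: "p > 0"
  shows "\<exists>R0. \<forall>R\<ge>R0. \<forall>t y S. (\<Sum>r\<le>R. t ^ r * ev n (Pst n p r f) y S) = ev n f (\<lambda>j. y j + t * y j ^ p) S"
proof -
  have fin: "finite (supp f)" using f by (rule H_finite)
  define R0 where "R0 = (\<Sum>m\<in>supp f. \<Sum>i<n. snd m i)"
  have R0: "(\<Sum>i<n. snd m i) \<le> R0" if "m \<in> supp f" for m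
    unfolding R0_def using fin that by (intro member_le_sum) auto
  have "(\<Sum>r\<le>R. t ^ r * ev n (Pst n p r f) y S) = ev n f (\<lambda>j. y j + t * y j ^ p) S" if "R0 \<le> R" for R t y S
  proof -
    have R: "(\<Sum>i<n. snd m i) \<le> R" if "m \<in> supp f" for m
      using R0[OF that] \<open>R0 \<le> R\<close> by (rule order.trans)
    have "ev n (Pst n p r f) y S = (\<Sum>m\<in>supp f. to_ac (f m) * ev n (Pmono n p r m) y S)" for r
      unfolding Pst_def using f by (intro ev_lin_ext) (auto simp: H_finite intro: H_finite[OF H_Pmono] H_ok)
    then have "(\<Sum>r\<le>R. t ^ r * ev n (Pst n p r f) y S) = (\<Sum>m\<in>supp f. to_ac (f m) * (\<Sum>r\<le>R. t ^ r * ev n (Pmono n p r m) y S))"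
      by (simp add: sum_distrib_left mult_ac) (rule sum.swap)
    also have "\<dots> = ev n f (\<lambda>j. y j + t * y j ^ p) S"
      unfolding evR_def[of n "emb f"] supp_emb
      by (intro sum.cong refl) (use R p H_ok[OF f] in \<open>simp add: ev_Pmono emb_apply cong: if_cong\<close>)
    finally show ?thesis .
  qed
  then show ?thesis by blast
qed

section \<open>Faithfulness of evaluation\<close>

lemma infinite_alg_closed: "infinite (UNIV :: 'r::alg_closed_field set)"
proof
  assume fin: "finite (UNIV :: 'r set)"
  define q where "q = (\<Prod>a\<in>(UNIV :: 'r set). [:-a, 1:]) + 1"
  have "degree (\<Prod>a\<in>(UNIV :: 'r set). [:-a, 1:]) = (\<Sum>a\<in>(UNIV :: 'r set). degree [:-a, 1:])"
    using fin by (intro degree_prod_eq_sum_degree) auto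
  also have "\<dots> = card (UNIV :: 'r set)" by simp
  finally have d: "degree (\<Prod>a\<in>(UNIV :: 'r set). [:-a, 1:]) = card (UNIV :: 'r set)" .
  have "card (UNIV :: 'r set) > 0" using fin by (simp add: card_gt_0_iff)
  with d have "degree q = card (UNIV :: 'r set)"
    unfolding q_def by (subst degree_add_eq_left) auto
  then obtain x where "poly q x = 0"
    using alg_closed_imp_poly_has_root[of q] \<open>card (UNIV :: 'r set) > 0\<close> by auto
  moreover have "poly q x = 1"
    unfolding q_def using fin by (simp add: poly_prod)
  ultimately show False by simp
qed

lemma evR_inj:
  fixes F :: "'r::idom elt"
  assumes inf: "infinite (UNIV :: 'r set)" and F: "F \<in> H n" and z: "\<And>y S. evR n F y S = 0"
  shows "F m = 0"
proof (rule ccontr)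
  assume m: "F m \<noteq> 0"
  define S where "S = fst m"
  define E where "E = snd ` {m\<in>supp F. fst m = S}"
  have fin: "finite (supp F)" using F by (rule H_finite)
  then have finE: "finite E" by (simp add: E_def)
  \<comment> \<open>Exceeds every exponent that occurs, so N values per coordinate detect all
    coefficients.\<close>
  define N where "N = Suc (\<Sum>e\<in>E. \<Sum>i<n. e i)"
  obtain A :: "'r set" where A: "finite A" "card A = N"
    using infinite_arbitrarily_large[OF inf, of N] by blast
  have inj: "inj_on snd {m\<in>supp F. fst m = S}" by (auto simp: inj_on_def)
  have "F (S, snd m) = 0"
  proof (rule mpoly_zero[of "{..<n}" E A "\<lambda>e. F (S, e)" "snd m"])
    show "e i = 0" if "e \<in> E" "i \<notin> {..<n}" for e i
      using that H_ok[OF F] by (auto simp: E_def mono_ok_def)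
    show "e i < card A" if "e \<in> E" "i \<in> {..<n}" for e i
    proof -
      have "e i \<le> (\<Sum>i<n. e i)" using that by (intro member_le_sum) auto
      also have "\<dots> \<le> (\<Sum>e\<in>E. \<Sum>i<n. e i)" using that finE by (intro member_le_sum[of e E "\<lambda>e. \<Sum>i<n. e i"]) auto
      finally show ?thesis by (simp add: A N_def)
    qed
    show "(\<Sum>e\<in>E. F (S, e) * (\<Prod>i<n. x i ^ e i)) = 0" for x
    proof -
      have "evR n F x S = (\<Sum>m\<in>{m\<in>supp F. fst m = S}. F m * mval n x (snd m))"
        unfolding evR_def using fin by (rule sum.inter_filter[symmetric])
      also have "\<dots> = (\<Sum>e\<in>E. F (S, e) * (\<Prod>i<n. x i ^ e i))"
        unfolding E_def by (subst sum.reindex[OF inj]) (auto simp: mval_def intro!: sum.cong)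
      finally show ?thesis using z by simp
    qed
    show "snd m \<in> E" using m by (auto simp: E_def S_def supp_def)
  qed (use finE in auto)
  with m show False by (simp add: S_def)
qed

lemma ev_inj:
  assumes "f \<in> H n" "h \<in> H n" "\<And>y S. ev n f y S = ev n h y S"
  shows "f = h"
proof
  fix m
  define F where "F = (\<lambda>m. emb f m + (-1) * emb h m)"
  have fin: "finite (supp (emb f))" "finite (supp (\<lambda>m. (-1) * emb h m))"
    using H_finite[OF assms(1)] H_finite[OF assms(2)] by (simp_all add: supp_def emb_def)
  have "supp F \<subseteq> supp f \<union> supp h" by (auto simp: F_def supp_def emb_def)
  then have FH: "F \<in> H n" using assms(1,2) unfolding H_def by (blast intro: finite_subset finite_UnI)
  have z: "evR n F y S = 0" for y S
  proof -
    have "evR n F y S = ev n f y S + (-1) * ev n h y S"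
      unfolding F_def evR_add[OF fin] by (subst evR_scale) (simp_all add: H_finite[OF assms(2)])
    then show ?thesis by (simp add: assms(3))
  qed
  have "F m = 0" by (rule evR_inj[OF infinite_alg_closed FH z])
  then show "f m = h m" by (simp add: F_def emb_apply)
qed

lemma power_sum_eq_imp:
  fixes a b :: "nat \<Rightarrow> 'r::field"
  assumes "infinite (UNIV :: 'r set)" "\<And>t. (\<Sum>r\<le>R. t ^ r * a r) = (\<Sum>r\<le>R. t ^ r * b r)" "r \<le> R"
  shows "a r = b r"
proof -
  have "(\<Sum>r\<le>R. Polynomial.monom (a r) r) = (\<Sum>r\<le>R. Polynomial.monom (b r) r)"
    using assms(2) by (intro poly_eqI_infinite[OF assms(1)]) (simp add: poly_sum poly_monom mult.commute)
  from arg_cong[OF this, of "\<lambda>P. coeff P r"] show ?thesis using assms(3) by (simp add: coeff_sum)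
qed

section \<open>Invariants described by their values\<close>

lemma Lam_add: "Lam n A (\<lambda>S. a S + b S) T = Lam n A a T + Lam n A b T"
  by (simp add: Lam_def sum.distrib distrib_right)

lemma Lam_scale: "Lam n A (\<lambda>S. c * a S) T = c * Lam n A a T"
  by (simp add: Lam_def sum_distrib_left mult_ac)

lemma Lam_sum: "Lam n A (\<lambda>S. \<Sum>i\<in>I. c i * a i S) T = (\<Sum>i\<in>I. c i * Lam n A (a i) T)"
  by (induction I rule: infinite_finite_induct) (auto simp: Lam_add Lam_scale, simp_all add: Lam_def)

text \<open>Since evaluation is faithful, invariance can be tested on values, where the action is
  explicit: \<open>tr\<close> on the point and \<open>Lam\<close> on the exterior
  coefficients.\<close>

lemma D_iff: "f \<in> D n \<longleftrightarrow> f \<in> H n \<and> (\<forall>A\<in>GL n. \<forall>y S. Lam n (acm A) (ev n f (tr n (acm A) y)) S = ev n f y S)"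
  for f :: "'k::field elt"
proof -
  have "act n A f = f \<longleftrightarrow> (\<forall>y S. Lam n (acm A) (ev n f (tr n (acm A) y)) S = ev n f y S)" if f: "f \<in> H n" for A
  proof
    assume "act n A f = f"
    then show "\<forall>y S. Lam n (acm A) (ev n f (tr n (acm A) y)) S = ev n f y S" using ev_act[OF f, of A] by metis
  next
    assume a: "\<forall>y S. Lam n (acm A) (ev n f (tr n (acm A) y)) S = ev n f y S"
    show "act n A f = f" by (rule ev_inj[OF H_act[OF f] f]) (simp add: ev_act[OF f] a)
  qed
  then show ?thesis unfolding D_def by auto
qed

lemma D_H: "f \<in> D n \<Longrightarrow> f \<in> H n" by (simp add: D_def)

lemma D_Lam: "f \<in> D n \<Longrightarrow> A \<in> GL n \<Longrightarrow> Lam n (acm A) (ev n f (tr n (acm A) y)) = ev n f y" for f :: "'k::field elt"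
  unfolding D_iff by blast

lemma H_eadd: "f \<in> H n \<Longrightarrow> h \<in> H n \<Longrightarrow> eadd f h \<in> H n" for f h :: "'k::comm_ring_1 elt"
proof -
  assume "f \<in> H n" "h \<in> H n"
  then have "(\<lambda>m. \<Sum>b\<in>{True,False}. (if b then f else h) m) \<in> H n" by (intro H_sum1) auto
  then show ?thesis by (simp add: eadd_def)
qed

lemma H_escale: "f \<in> H n \<Longrightarrow> escale c f \<in> H n" for f :: "'k::comm_ring_1 elt"
proof -
  assume "f \<in> H n"
  then have "(\<lambda>m. \<Sum>b\<in>{True}. c * f m) \<in> H n" by (intro H_sum) auto
  then show ?thesis by (simp add: escale_def)
qed

lemma ev_eadd: "f \<in> H n \<Longrightarrow> h \<in> H n \<Longrightarrow> ev n (eadd f h) y S = ev n f y S + ev n h y S"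
proof -
  assume "f \<in> H n" "h \<in> H n"
  moreover have "emb (eadd f h) = (\<lambda>m. emb f m + emb h m)" by (simp add: emb_def eadd_def)
  ultimately show ?thesis by (simp add: evR_add H_finite)
qed

lemma ev_escale: "f \<in> H n \<Longrightarrow> ev n (escale c f) y S = to_ac c * ev n f y S"
proof -
  assume "f \<in> H n"
  moreover have "emb (escale c f) = (\<lambda>m. to_ac c * emb f m)" by (simp add: emb_def escale_def)
  ultimately show ?thesis by (simp add: evR_scale H_finite)
qed

lemma D_eadd: fixes f h :: "'k::field elt" assumes "f \<in> D n" "h \<in> D n" shows "eadd f h \<in> D n"
proof -
  have e: "ev n (eadd f h) y = (\<lambda>S. ev n f y S + ev n h y S)" for y
    using assms by (auto simp: ev_eadd D_H)
  show ?thesis unfolding D_iff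
    using assms by (auto simp: H_eadd D_H e Lam_add D_Lam)
qed

lemma D_escale: fixes f :: "'k::field elt" assumes "f \<in> D n" shows "escale c f \<in> D n"
proof -
  have e: "ev n (escale c f) y = (\<lambda>S. to_ac c * ev n f y S)" for y
    using assms by (auto simp: ev_escale D_H)
  show ?thesis unfolding D_iff
    using assms by (auto simp: H_escale D_H e Lam_scale D_Lam)
qed

lemma D_ezero: "(ezero :: 'k::field elt) \<in> D n"
proof -
  have H: "(ezero :: 'k elt) \<in> H n" by (simp add: H_def supp_def ezero_def)
  have "(ev n (ezero :: 'k elt) y S) = 0" for y S by (simp add: evR_def supp_def ezero_def emb_def)
  then show ?thesis unfolding D_iff using H by (simp add: Lam_def)
qed

section \<open>Frobenius and stability of the invariants under the Steenrod operations\<close>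

lemma CHAR_ac: "CHAR('q::prime_card mod_ring alg_closure) = CARD('q)"
  by (simp add: CHAR_alg_closure)

lemma ac_add_power:
  fixes x y :: "'q::prime_card mod_ring alg_closure"
  shows "(x + y) ^ (CARD('q) ^ m) = x ^ (CARD('q) ^ m) + y ^ (CARD('q) ^ m)"
  by (rule freshmans_dream') (simp_all add: prime_card)

lemma ac_diff_power:
  fixes x y :: "'q::prime_card mod_ring alg_closure"
  shows "(x - y) ^ (CARD('q) ^ m) = x ^ (CARD('q) ^ m) - y ^ (CARD('q) ^ m)"
  using ac_add_power[of "x - y" y m] by simp

lemma ac_sum_power:
  fixes f :: "'i \<Rightarrow> 'q::prime_card mod_ring alg_closure"
  shows "(\<Sum>i\<in>I. f i) ^ (CARD('q) ^ m) = (\<Sum>i\<in>I. f i ^ (CARD('q) ^ m))"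
  by (rule freshmans_dream_sum') (simp_all add: prime_card)

lemma to_ac_power_card:
  fixes x :: "'q::prime_card mod_ring"
  shows "to_ac x ^ (CARD('q) ^ m) = to_ac x"
proof -
  have "x ^ CARD('q) = x" using finite_field_power_card_eq_same[of x] by simp
  then have "x ^ (CARD('q) ^ m) = x" by (induction m) (simp_all add: power_mult mult.commute)
  then show ?thesis by (simp flip: to_ac_power)
qed

text \<open>Frobenius is additive and fixes the entries of A. This is why reduced powers commute
  with the linear group.\<close>

lemma tr_frob:
  fixes A :: "nat \<Rightarrow> nat \<Rightarrow> 'q::prime_card mod_ring"
  shows "tr n (acm A) y i ^ (CARD('q) ^ m) = tr n (acm A) (\<lambda>j. y j ^ (CARD('q) ^ m)) i"
  unfolding tr_def ac_sum_power by (simp add: power_mult_distrib to_ac_power_card)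

lemma tr_linear: "tr n A (\<lambda>j. y j + t * z j) i = tr n A y i + t * tr n A z i"
  by (simp add: tr_def sum.distrib sum_distrib_left algebra_simps)

text \<open>All P^r are treated at once: their generating series in t is the substitution y + t y^p,
  which commutes with A. Comparing coefficients of t^r then separates them.\<close>

lemma D_Pst:
  fixes f :: "'q::prime_card mod_ring elt"
  assumes p: "p = CARD('q)" and f: "f \<in> D n"
  shows "Pst n p r f \<in> D n"
  unfolding D_iff
proof (intro conjI ballI allI)
  show "Pst n p r f \<in> H n" using f by (intro H_Pst D_H)
  fix A :: "nat \<Rightarrow> nat \<Rightarrow> 'q mod_ring" and y S assume A: "A \<in> GL n"
  have p0: "p > 0" using p by simp
  obtain R0 where R0: "\<And>R t y S. R0 \<le> R \<Longrightarrow> (\<Sum>r\<le>R. t ^ r * ev n (Pst n p r f) y S) = ev n f (\<lambda>j. y j + t * y j ^ p) S"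
    using ev_Pst[OF D_H[OF f] p0] by blast
  define R where "R = max R0 r"
  have R: "(\<Sum>r\<le>R. t ^ r * ev n (Pst n p r f) y S) = ev n f (\<lambda>j. y j + t * y j ^ p) S" for t y S
    by (rule R0) (simp add: R_def)
  show "Lam n (acm A) (ev n (Pst n p r f) (tr n (acm A) y)) S = ev n (Pst n p r f) y S"
  proof (rule power_sum_eq_imp[OF infinite_alg_closed, where R = R])
    show "r \<le> R" by (simp add: R_def)
    fix t
    have "(\<Sum>r\<le>R. t ^ r * Lam n (acm A) (ev n (Pst n p r f) (tr n (acm A) y)) S) =
      Lam n (acm A) (ev n f (\<lambda>j. tr n (acm A) y j + t * tr n (acm A) y j ^ p)) S"
      unfolding Lam_sum[symmetric] R ..
    also have "(\<lambda>j. tr n (acm A) y j + t * tr n (acm A) y j ^ p) = tr n (acm A) (\<lambda>j. y j + t * y j ^ p)"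
      using tr_frob[of n A y _ 1] by (simp add: tr_linear p fun_eq_iff)
    also have "Lam n (acm A) (ev n f \<dots>) S = ev n f (\<lambda>j. y j + t * y j ^ p) S"
      by (simp add: D_Lam[OF f A])
    finally show "(\<Sum>r\<le>R. t ^ r * Lam n (acm A) (ev n (Pst n p r f) (tr n (acm A) y)) S) = (\<Sum>r\<le>R. t ^ r * ev n (Pst n p r f) y S)"
      by (simp only: R)
  qed
qed

lemma D_Bock:
  fixes f :: "'k::field elt"
  assumes f: "f \<in> D n"
  shows "Bock f \<in> D n"
  unfolding D_iff
proof (intro conjI ballI allI)
  show "Bock f \<in> H n" using f by (intro H_Bock D_H)
  fix A :: "nat \<Rightarrow> nat \<Rightarrow> 'k" and y S assume A: "A \<in> GL n"
  have e: "ev n (Bock f) y = iota n y (ev n f y)" for y using ev_Bock[OF D_H[OF f]] by blast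
  show "Lam n (acm A) (ev n (Bock f) (tr n (acm A) y)) S = ev n (Bock f) y S"
    unfolding e iota_Lam[symmetric] D_Lam[OF f A] ..
qed

subsection \<open>Degrees\<close>

lemma homog_lin_ext:
  assumes "homog n d f" "\<And>m m'. m \<in> supp f \<Longrightarrow> m' \<in> supp (G m) \<Longrightarrow> mdeg n m' = mdeg n m + k"
  shows "homog n (d + k) (lin_ext G f)"
  unfolding homog_def
proof
  fix m' assume "m' \<in> supp (lin_ext G f)"
  then have "m' \<in> (\<Union>m\<in>supp f. supp (G m))" unfolding lin_ext_def by (rule supp_sum[THEN subsetD])
  then obtain m where "m \<in> supp f" "m' \<in> supp (G m)" by blast
  with assms show "mdeg n m' = d + k" by (simp add: homog_def)
qed

lemma supp_sum1: "supp (\<lambda>m. \<Sum>i\<in>I. F i m) \<subseteq> (\<Union>i\<in>I. supp (F i :: 'r::comm_ring_1 elt))"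
  using supp_sum[of "\<lambda>_. 1" F I] by simp

lemma homog_Bock:
  fixes f :: "'k::comm_ring_1 elt"
  assumes "f \<in> H n" "homog n d f"
  shows "homog n (d + 1) (Bock f)"
  unfolding Bock_def
proof (rule homog_lin_ext[OF assms(2)])
  fix m m' :: mono assume m: "m \<in> supp f" "m' \<in> supp (bmono m :: 'k elt)"
  have ok: "fst m \<subseteq> {..<n}" using H_ok[OF assms(1) m(1)] by (simp add: mono_ok_def)
  have "m' \<in> (\<Union>i\<in>fst m. supp (single (fst m - {i}, (snd m)(i := snd m i + 1)) ((-1) ^ card {j \<in> fst m. j < i}) :: 'k elt))"
    using m(2) unfolding bmono_def by (rule supp_sum1[THEN subsetD])
  then obtain i where i: "i \<in> fst m" "m' = (fst m - {i}, (snd m)(i := snd m i + 1))"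
    by (auto dest!: supp_single[THEN subsetD] simp del: fun_upd_apply)
  have "finite (fst m)" using ok finite_subset by blast
  then have c: "card (fst m) = Suc (card (fst m - {i}))" using i(1) by (rule card.remove)
  have "(\<Sum>j<n. ((snd m)(i := snd m i + 1)) j) = (\<Sum>j<n. snd m j + (if j = i then 1 else 0))"
    by (intro sum.cong) auto
  also have "\<dots> = (\<Sum>j<n. snd m j) + 1" using i(1) ok by (auto simp: sum.distrib)
  finally show "mdeg n m' = mdeg n m + 1" using c by (simp add: mdeg_def i(2))
qed

lemma homog_Pst:
  fixes f :: "'k::comm_ring_1 elt"
  assumes "homog n d f"
  shows "homog n (d + 2 * (p - 1) * r) (Pst n p r f)"
  unfolding Pst_def
proof (rule homog_lin_ext[OF assms])
  fix m m' :: mono assume m: "m' \<in> supp (Pmono n p r m :: 'k elt)"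
  have "m' \<in> (\<Union>k\<in>{k. (\<forall>i. k i \<le> snd m i) \<and> (\<Sum>i<n. k i) = r}.
      supp (single (fst m, \<lambda>i. snd m i + (p - 1) * k i) (\<Prod>i<n. of_nat (snd m i choose k i)) :: 'k elt))"
    using m unfolding Pmono_def by (rule supp_sum1[THEN subsetD])
  then obtain k where "(\<Sum>i<n. k i) = r" "m' = (fst m, \<lambda>i. snd m i + (p - 1) * k i)"
    by (auto dest!: supp_single[THEN subsetD])
  then show "mdeg n m' = mdeg n m + 2 * (p - 1) * r" by (simp add: mdeg_def sum.distrib sum_distrib_left[symmetric] distrib_left)
qed

lemma mval_scale: "mval n (\<lambda>j. c * y j) e = c ^ (\<Sum>j<n. e j) * mval n y e"
  by (simp add: mval_def power_mult_distrib prod.distrib power_sum)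

text \<open>The grading as a scaling action: x has weight 1 and y has weight 2 in s.\<close>

lemma ev_homog:
  assumes "f \<in> H n" "homog n d f"
  shows "s ^ card S * ev n f (\<lambda>j. s\<^sup>2 * y j) S = s ^ d * ev n f y S"
  unfolding evR_def sum_distrib_left supp_emb
proof (intro sum.cong refl)
  fix m assume m: "m \<in> supp f"
  then have "mdeg n m = d" using assms(2) by (simp add: homog_def)
  then have d: "d = card (fst m) + 2 * (\<Sum>j<n. snd m j)" by (simp add: mdeg_def)
  have "s ^ d = s ^ card (fst m) * (s\<^sup>2) ^ (\<Sum>j<n. snd m j)" unfolding d by (simp only: power_add power_mult)
  then show "s ^ card S * (if fst m = S then emb f m * mval n (\<lambda>j. s\<^sup>2 * y j) (snd m) else 0) = s ^ d * (if fst m = S then emb f m * mval n y (snd m) else 0)"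
    by (auto simp: mval_scale)
qed

text \<open>A nonzero r belongs to a basis of the closure over the ground field. Such functionals
  carry identities over the closure back to the ground field, where g is defined.\<close>

lemma exists_functional:
  fixes r :: "'k::field alg_closure"
  assumes "r \<noteq> 0"
  shows "\<exists>\<pi> :: 'k alg_closure \<Rightarrow> 'k. (\<forall>x y. \<pi> (x + y) = \<pi> x + \<pi> y) \<and> (\<forall>c x. \<pi> (to_ac c * x) = c * \<pi> x) \<and> \<pi> r \<noteq> 0"
proof -
  interpret vector_space_pair "\<lambda>(c::'k) (x::'k alg_closure). to_ac c * x" "\<lambda>(c::'k) (x::'k). c * x"
    by unfold_locales (auto simp: algebra_simps)
  have "vs1.independent {r}" using assms by (simp add: vs1.dependent_single)
  from linear_independent_extend[OF this, of "\<lambda>_. 1"] obtain \<pi> where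
    l: "Vector_Spaces.linear (\<lambda>(c::'k) (x::'k alg_closure). to_ac c * x) (\<lambda>(c::'k) (x::'k). c * x) \<pi>" and "\<pi> r = 1" by auto
  then show ?thesis using linear_add[OF l] linear_scale[OF l] by (intro exI[of _ \<pi>]) auto
qed

section \<open>The span of the graph of g\<close>

type_synonym 'k gfun = "bool \<times> (nat \<Rightarrow> 'k alg_closure) \<times> nat set \<Rightarrow> 'k alg_closure"

text \<open>Source and image form one function, so that a linear combination or an extraction of
  coefficients acts on both at once.\<close>

definition pairf :: "nat \<Rightarrow> ('k::field elt \<Rightarrow> 'k elt) \<Rightarrow> 'k elt \<Rightarrow> 'k gfun" where
  "pairf n g f = (\<lambda>(b, y, S). ev n (if b then g f else f) y S)"

text \<open>The two halves of a pair are selected by the boolean: False for the source, True for the image.\<close>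

inductive_set GG :: "nat \<Rightarrow> ('k::field elt \<Rightarrow> 'k elt) \<Rightarrow> 'k gfun set" for n g where
  GG_zero: "(\<lambda>_. 0) \<in> GG n g"
| GG_gen: "f \<in> D n \<Longrightarrow> homog n d f \<Longrightarrow> d > 0 \<Longrightarrow> pairf n g f \<in> GG n g"
| GG_add: "u \<in> GG n g \<Longrightarrow> v \<in> GG n g \<Longrightarrow> (\<lambda>x. u x + v x) \<in> GG n g"
| GG_scale: "u \<in> GG n g \<Longrightarrow> (\<lambda>x. c * u x) \<in> GG n g"

lemma subspc_GG: "subspc (GG n g)"
  by (auto simp: subspc_def intro: GG.intros)

section \<open>Closure properties of the span\<close>

locale steenrod_endo =
  fixes n p :: nat and g :: "'q::prime_card mod_ring elt \<Rightarrow> 'q mod_ring elt"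
  assumes p_def: "p = CARD('q)"
    and g_maps: "f \<in> D n \<Longrightarrow> g f \<in> D n"
    and g_add: "a \<in> D n \<Longrightarrow> b \<in> D n \<Longrightarrow> g (eadd a b) = eadd (g a) (g b)"
    and g_scale: "a \<in> D n \<Longrightarrow> g (escale c a) = escale c (g a)"
    and g_deg: "f \<in> D n \<Longrightarrow> homog n d f \<Longrightarrow> homog n d (g f)"
    and g_P: "f \<in> D n \<Longrightarrow> g (Pst n p r f) = Pst n p r (g f)"
    and g_beta: "f \<in> D n \<Longrightarrow> g (Bock f) = Bock (g f)"
begin

lemma p_pos: "p > 0" using p_def by simp

lemma p_gt1: "p > 1" using p_def prime_card[where 'a='q] prime_gt_1_nat by auto

lemma g_zero: "g ezero = ezero"
proof -
  have "escale 0 (f :: 'q mod_ring elt) = ezero" for f by (auto simp: escale_def ezero_def)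
  then show ?thesis using g_scale[of ezero 0] D_ezero by metis
qed

lemma pairf_if: "(if b then g f else f) \<in> D n" if "f \<in> D n" for b
  using that g_maps by auto

text \<open>As t lies in R, the substituted pair need not come from an element and its image. It is
  an R-combination of the pairs of P^r f, and here g commuting with the reduced powers
  enters.\<close>

lemma GG_total_power:
  assumes "w \<in> GG n g"
  shows "(\<lambda>(b, y, S). w (b, \<lambda>j. y j + t * y j ^ p, S)) \<in> GG n g"
  using assms
proof induction
  case GG_zero
  show ?case using GG.GG_zero[of n g] by simp
next
  case (GG_gen f d)
  obtain R1 where R1: "\<And>R t y S. R1 \<le> R \<Longrightarrow> (\<Sum>r\<le>R. t ^ r * ev n (Pst n p r f) y S) = ev n f (\<lambda>j. y j + t * y j ^ p) S"
    using ev_Pst[OF D_H[OF GG_gen(1)] p_pos] by blast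
  obtain R2 where R2: "\<And>R t y S. R2 \<le> R \<Longrightarrow> (\<Sum>r\<le>R. t ^ r * ev n (Pst n p r (g f)) y S) = ev n (g f) (\<lambda>j. y j + t * y j ^ p) S"
    using ev_Pst[OF D_H[OF g_maps[OF GG_gen(1)]] p_pos] by blast
  define R where "R = max R1 R2"
  have "pairf n g (Pst n p r f) \<in> GG n g" for r
    by (rule GG.GG_gen[OF D_Pst[OF p_def GG_gen(1)] homog_Pst[OF GG_gen(2)]]) (use GG_gen(3) in simp)
  then have "(\<lambda>x. \<Sum>r\<le>R. t ^ r * pairf n g (Pst n p r f) x) \<in> GG n g"
    by (intro subspc_sum[OF subspc_GG] subspc_scale[OF subspc_GG])
  moreover have "(\<lambda>x. \<Sum>r\<le>R. t ^ r * pairf n g (Pst n p r f) x) = (\<lambda>(b, y, S). pairf n g f (b, \<lambda>j. y j + t * y j ^ p, S))"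
  proof
    fix x :: "bool \<times> (nat \<Rightarrow> 'q mod_ring alg_closure) \<times> nat set"
    obtain b y S where x: "x = (b, y, S)" by (cases x)
    show "(\<Sum>r\<le>R. t ^ r * pairf n g (Pst n p r f) x) = (case x of (b, y, S) \<Rightarrow> pairf n g f (b, \<lambda>j. y j + t * y j ^ p, S))"
      using R1[of R t y S] R2[of R t y S] GG_gen(1) by (cases b) (simp_all add: x pairf_def g_P R_def)
  qed
  ultimately show ?case by simp
next
  case (GG_add u v)
  then show ?case using GG.GG_add[OF GG_add.IH] by (simp add: case_prod_beta)
next
  case (GG_scale u c)
  then show ?case using GG.GG_scale[OF GG_scale.IH, of c] by (simp add: case_prod_beta)
qed

text \<open>Both degrees count here: x has degree 1 and y has degree 2, so scaling y by a number requires a square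
  root of it. This is the source of the factors s ^ card S.\<close>

lemma GG_sigma:
  assumes "w \<in> GG n g"
  shows "(\<lambda>(b, y, S). s ^ card S * w (b, \<lambda>j. s\<^sup>2 * y j, S)) \<in> GG n g"
  using assms
proof induction
  case GG_zero
  show ?case using GG.GG_zero[of n g] by simp
next
  case (GG_gen f d)
  have "(\<lambda>x. s ^ d * pairf n g f x) \<in> GG n g" using GG_gen by (intro GG.GG_scale GG.GG_gen)
  moreover have "(\<lambda>x. s ^ d * pairf n g f x) = (\<lambda>(b, y, S). s ^ card S * pairf n g f (b, \<lambda>j. s\<^sup>2 * y j, S))"
  proof
    fix x :: "bool \<times> (nat \<Rightarrow> 'q mod_ring alg_closure) \<times> nat set"
    obtain b y S where x: "x = (b, y, S)" by (cases x)
    have "homog n d (if b then g f else f)" using GG_gen g_deg by auto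
    from ev_homog[OF D_H[OF pairf_if[OF GG_gen(1)]] this, where s = s and S = S and y = y]
    show "s ^ d * pairf n g f x = (case x of (b, y, S) \<Rightarrow> s ^ card S * pairf n g f (b, \<lambda>j. s\<^sup>2 * y j, S))"
      by (simp add: x pairf_def)
  qed
  ultimately show ?case by simp
next
  case (GG_add u v)
  then show ?case using GG.GG_add[OF GG_add.IH] by (simp add: case_prod_beta distrib_left)
next
  case (GG_scale u c)
  then show ?case using GG.GG_scale[OF GG_scale.IH, of c] by (simp add: case_prod_beta mult_ac)
qed

lemma GG_Bock:
  assumes "w \<in> GG n g"
  shows "(\<lambda>(b, y, S). iota n y (\<lambda>S. w (b, y, S)) S) \<in> GG n g"
  using assms
proof induction
  case GG_zero
  have "iota n y (\<lambda>S. 0 :: 'q mod_ring alg_closure) S = 0" for y S by (simp add: iota_def cong: if_cong)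
  then show ?case using GG.GG_zero[of n g] by simp
next
  case (GG_gen f d)
  have "pairf n g (Bock f) \<in> GG n g"
    by (rule GG.GG_gen[OF D_Bock[OF GG_gen(1)] homog_Bock[OF D_H[OF GG_gen(1)] GG_gen(2)]]) simp
  moreover have "pairf n g (Bock f) = (\<lambda>(b, y, S). iota n y (\<lambda>S. pairf n g f (b, y, S)) S)"
    using GG_gen(1) by (auto simp: pairf_def fun_eq_iff g_beta ev_Bock D_H g_maps)
  ultimately show ?case by simp
next
  case (GG_add u v)
  then show ?case using GG.GG_add[OF GG_add.IH] by (simp add: case_prod_beta iota_add)
next
  case (GG_scale u c)
  then show ?case using GG.GG_scale[OF GG_scale.IH, of c] by (simp add: case_prod_beta iota_scale)
qed

text \<open>Members of the span are represented by two elements with coefficients in R, and applying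
  a linear functional to all these coefficients gives a genuine pair f, g f. Quantifying over all
  functionals is what carries the induction through scaling.\<close>

lemma GG_repr:
  assumes "w \<in> GG n g"
  shows "\<exists>F. (\<forall>b. F b \<in> H n) \<and> (\<forall>b y S. w (b, y, S) = evR n (F b) y S) \<and>
     (\<forall>\<pi> :: 'q mod_ring alg_closure \<Rightarrow> 'q mod_ring. (\<forall>x y. \<pi> (x + y) = \<pi> x + \<pi> y) \<longrightarrow> (\<forall>c x. \<pi> (to_ac c * x) = c * \<pi> x) \<longrightarrow>
        (\<lambda>m. \<pi> (F False m)) \<in> D n \<and> g (\<lambda>m. \<pi> (F False m)) = (\<lambda>m. \<pi> (F True m)))"
  using assms
proof induction
  case GG_zero
  have "(\<lambda>m. \<pi> 0) = ezero" if "\<forall>c x. \<pi> (to_ac c * x) = c * \<pi> x" for \<pi> :: "'q mod_ring alg_closure \<Rightarrow> 'q mod_ring"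
    using that[rule_format, of 0 0] by (simp add: ezero_def)
  then show ?case
    by (intro exI[of _ "\<lambda>_ _. 0"]) (simp add: evR_def supp_def H_def D_ezero g_zero)
next
  case (GG_gen f d)
  define F where "F = (\<lambda>b. emb (if b then g f else f))"
  have e: "(\<lambda>m. \<pi> (F b m)) = escale (\<pi> 1) (if b then g f else f)" if "\<forall>c x. \<pi> (to_ac c * x) = c * \<pi> x"
    for \<pi> :: "'q mod_ring alg_closure \<Rightarrow> 'q mod_ring" and b
    using that[rule_format, of _ 1] by (auto simp: F_def emb_apply escale_def fun_eq_iff mult.commute)
  have 3: "(\<lambda>m. \<pi> (F False m)) \<in> D n \<and> g (\<lambda>m. \<pi> (F False m)) = (\<lambda>m. \<pi> (F True m))"
    if "\<forall>c x. \<pi> (to_ac c * x) = c * \<pi> x" for \<pi> :: "'q mod_ring alg_closure \<Rightarrow> 'q mod_ring"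
    using e[OF that, of False] e[OF that, of True] GG_gen(1) by (simp add: D_escale g_scale)
  have 1: "F b \<in> H n" for b using D_H[OF pairf_if[OF GG_gen(1)], of b] by (simp add: F_def)
  have 2: "pairf n g f (b, y, S) = evR n (F b) y S" for b y S by (simp add: F_def pairf_def)
  show ?case using 1 2 3 by (intro exI[of _ F]) blast
next
  case (GG_add u v)
  from GG_add.IH(1) obtain F where F: "\<And>b. F b \<in> H n" "\<And>b y S. u (b, y, S) = evR n (F b) y S"
    "\<And>\<pi> :: 'q mod_ring alg_closure \<Rightarrow> 'q mod_ring. (\<forall>x y. \<pi> (x + y) = \<pi> x + \<pi> y) \<Longrightarrow> (\<forall>c x. \<pi> (to_ac c * x) = c * \<pi> x) \<Longrightarrow>
        (\<lambda>m. \<pi> (F False m)) \<in> D n \<and> g (\<lambda>m. \<pi> (F False m)) = (\<lambda>m. \<pi> (F True m))" by blast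
  from GG_add.IH(2) obtain F' where F': "\<And>b. F' b \<in> H n" "\<And>b y S. v (b, y, S) = evR n (F' b) y S"
    "\<And>\<pi> :: 'q mod_ring alg_closure \<Rightarrow> 'q mod_ring. (\<forall>x y. \<pi> (x + y) = \<pi> x + \<pi> y) \<Longrightarrow> (\<forall>c x. \<pi> (to_ac c * x) = c * \<pi> x) \<Longrightarrow>
        (\<lambda>m. \<pi> (F' False m)) \<in> D n \<and> g (\<lambda>m. \<pi> (F' False m)) = (\<lambda>m. \<pi> (F' True m))" by blast
  have "(\<lambda>m. F b m + F' b m) \<in> H n" for b using H_eadd[OF F(1)[of b] F'(1)[of b]] by (simp add: eadd_def)
  moreover have "evR n (\<lambda>m. F b m + F' b m) y S = u (b, y, S) + v (b, y, S)" for b y S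
    using F(1)[of b] F'(1)[of b] by (simp add: F(2) F'(2) evR_add H_finite)
  moreover have "(\<lambda>m. \<pi> (F False m + F' False m)) \<in> D n \<and> g (\<lambda>m. \<pi> (F False m + F' False m)) = (\<lambda>m. \<pi> (F True m + F' True m))"
    if pi: "\<forall>x y. \<pi> (x + y) = \<pi> x + \<pi> y" "\<forall>c x. \<pi> (to_ac c * x) = c * \<pi> x" for \<pi> :: "'q mod_ring alg_closure \<Rightarrow> 'q mod_ring"
  proof -
    have e: "(\<lambda>m. \<pi> (F b m + F' b m)) = eadd (\<lambda>m. \<pi> (F b m)) (\<lambda>m. \<pi> (F' b m))" for b using pi(1) by (simp add: eadd_def)
    show ?thesis unfolding e using F(3)[OF pi] F'(3)[OF pi] by (simp add: D_eadd g_add)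
  qed
  ultimately show ?case by (intro exI[of _ "\<lambda>b m. F b m + F' b m"]) auto
next
  case (GG_scale u c)
  from GG_scale.IH obtain F where F: "\<And>b. F b \<in> H n" "\<And>b y S. u (b, y, S) = evR n (F b) y S"
    "\<And>\<pi> :: 'q mod_ring alg_closure \<Rightarrow> 'q mod_ring. (\<forall>x y. \<pi> (x + y) = \<pi> x + \<pi> y) \<Longrightarrow> (\<forall>c x. \<pi> (to_ac c * x) = c * \<pi> x) \<Longrightarrow>
        (\<lambda>m. \<pi> (F False m)) \<in> D n \<and> g (\<lambda>m. \<pi> (F False m)) = (\<lambda>m. \<pi> (F True m))" by blast
  have "(\<lambda>m. c * F b m) \<in> H n" for b using H_escale[OF F(1)[of b], of c] by (simp add: escale_def)
  moreover have "evR n (\<lambda>m. c * F b m) y S = c * u (b, y, S)" for b y S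
    using F(1)[of b] by (simp add: F(2) evR_scale H_finite)
  moreover have "(\<lambda>m. \<pi> (c * F False m)) \<in> D n \<and> g (\<lambda>m. \<pi> (c * F False m)) = (\<lambda>m. \<pi> (c * F True m))"
    if pi: "\<forall>x y. \<pi> (x + y) = \<pi> x + \<pi> y" "\<forall>c x. \<pi> (to_ac c * x) = c * \<pi> x" for \<pi> :: "'q mod_ring alg_closure \<Rightarrow> 'q mod_ring"
  \<comment> \<open>Multiplication by c is absorbed into the functional.\<close>
  proof (rule F(3))
    show "\<forall>x y. \<pi> (c * (x + y)) = \<pi> (c * x) + \<pi> (c * y)" using pi(1) by (simp add: distrib_left)
    show "\<forall>d x. \<pi> (c * (to_ac d * x)) = d * \<pi> (c * x)"
    proof (intro allI)
      fix d x
      have "c * (to_ac d * x) = to_ac d * (c * x)" by (rule mult.left_commute)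
      then show "\<pi> (c * (to_ac d * x)) = d * \<pi> (c * x)" by (simp only: pi(2))
    qed
  qed
  ultimately show ?case by (intro exI[of _ "\<lambda>b m. c * F b m"]) auto
qed

text \<open>A vanishing source forces \<open>F False\<close> to be zero, so every functional maps
  \<open>F True\<close> to g 0 = 0, while a nonzero coefficient would be detected by some
  functional.\<close>

lemma GG_graph:
  assumes w: "w \<in> GG n g" and z: "\<And>y S. w (False, y, S) = 0"
  shows "w (True, y, S) = 0"
proof -
  from GG_repr[OF w] obtain F where F: "\<And>b. F b \<in> H n" "\<And>b y S. w (b, y, S) = evR n (F b) y S"
    "\<And>\<pi> :: 'q mod_ring alg_closure \<Rightarrow> 'q mod_ring. (\<forall>x y. \<pi> (x + y) = \<pi> x + \<pi> y) \<Longrightarrow> (\<forall>c x. \<pi> (to_ac c * x) = c * \<pi> x) \<Longrightarrow>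
        (\<lambda>m. \<pi> (F False m)) \<in> D n \<and> g (\<lambda>m. \<pi> (F False m)) = (\<lambda>m. \<pi> (F True m))" by blast
  have F0: "F False m = 0" for m by (rule evR_inj[OF infinite_alg_closed F(1)]) (use z F(2) in simp)
  have "F True m = 0" for m
  proof (rule ccontr)
    assume "F True m \<noteq> 0"
    from exists_functional[OF this] obtain \<pi> :: "'q mod_ring alg_closure \<Rightarrow> 'q mod_ring"
      where pi: "\<forall>x y. \<pi> (x + y) = \<pi> x + \<pi> y" "\<forall>c x. \<pi> (to_ac c * x) = c * \<pi> x" and nz: "\<pi> (F True m) \<noteq> 0" by blast
    have "\<pi> 0 = 0" using pi(2)[rule_format, of 0 0] by simp
    then have "(\<lambda>m. \<pi> (F False m)) = ezero" by (simp add: F0 ezero_def)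
    then have "ezero = (\<lambda>m. \<pi> (F True m))" using F(3)[OF pi] g_zero by simp
    from fun_cong[OF this, of m] nz show False by (simp add: ezero_def)
  qed
  then have "supp (F True) = {}" by (simp add: supp_def)
  then show ?thesis by (simp add: F(2) evR_def)
qed

lemma GG_support:
  assumes "w \<in> GG n g" "\<not> S \<subseteq> {..<n}"
  shows "w (b, y, S) = 0"
proof -
  from GG_repr[OF assms(1)] obtain F where F: "\<And>b. F b \<in> H n" "\<And>b y S. w (b, y, S) = evR n (F b) y S" by blast
  have "fst m \<noteq> S" if "m \<in> supp (F b)" for m using H_ok[OF F(1) that] assms(2) by (auto simp: mono_ok_def)
  then show ?thesis by (auto simp: F(2) evR_def intro!: sum.neutral)
qed

text \<open>The representing elements have finite support, which bounds the degree in t uniformly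
  over both halves and all exterior indices.\<close>

lemma tpoly_GG:
  assumes w: "w \<in> GG n g" and h: "\<And>j. tpoly (\<lambda>t (x :: 'x). h t x j)"
  shows "tpoly (\<lambda>t x. w (B x, h t x, T x))"
proof -
  from GG_repr[OF w] obtain F where F: "\<And>b y S. w (b, y, S) = evR n (F b) y S" by blast
  have "(\<lambda>t x. w (B x, h t x, T x)) = (\<lambda>t x. \<Sum>b\<in>UNIV. \<Sum>m\<in>supp (F b). (if B x = b \<and> fst m = T x then F b m else 0) * (\<Prod>j<n. h t x j ^ snd m j))"
  proof (intro ext)
    fix t x
    have "(\<Sum>b\<in>UNIV. \<Sum>m\<in>supp (F b). (if B x = b \<and> fst m = T x then F b m else 0) * (\<Prod>j<n. h t x j ^ snd m j))
      = (\<Sum>m\<in>supp (F (B x)). (if fst m = T x then F (B x) m else 0) * (\<Prod>j<n. h t x j ^ snd m j))"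
      by (cases "B x") (simp_all add: UNIV_bool cong: if_cong)
    also have "\<dots> = w (B x, h t x, T x)"
      unfolding F evR_def mval_def by (intro sum.cong) auto
    finally show "w (B x, h t x, T x) = (\<Sum>b\<in>UNIV. \<Sum>m\<in>supp (F b). (if B x = b \<and> fst m = T x then F b m else 0) * (\<Prod>j<n. h t x j ^ snd m j))" by simp
  qed
  then show ?thesis by (simp only:) (intro tpoly_sum tpoly_mult tpoly_const tpoly_prod tpoly_power h)
qed

text \<open>A nonzero root z yields the right factor x^p - z^(p-1) x, which vanishes on the prime
  field multiples of z. The quotient is computed from the lowest coefficient upwards, so the
  remainder is a multiple of x^(p^(T+1)); it vanishes at z and is therefore zero.\<close>

lemma factor_additive:
  fixes a :: "nat \<Rightarrow> 'q mod_ring alg_closure"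
  assumes a0: "a 0 \<noteq> 0" and aT: "a (Suc T) \<noteq> 0"
  obtains z b where "z \<noteq> 0" "- (b 0 * z ^ (p - 1)) = a 0"
    "\<And>x. (\<Sum>m\<le>Suc T. a m * x ^ (p ^ m)) = (\<Sum>m\<le>T. b m * (x ^ p - z ^ (p - 1) * x) ^ (p ^ m))"
proof -
  \<comment> \<open>The additive polynomial divided by x. Its top coefficient provides a root, and
    its constant term a 0 keeps this root away from 0.\<close>
  define q where "q = (\<Sum>m\<le>Suc T. Polynomial.monom (a m) (p ^ m - 1))"
  have pm: "p ^ m > 0" for m using p_pos by simp
  have lt: "p ^ m - 1 < p ^ Suc T - 1" if "m \<le> T" for m
  proof -
    have "p ^ m < p ^ Suc T" using p_gt1 that by (intro power_strict_increasing) auto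
    then show ?thesis using pm[of m] by linarith
  qed
  have "coeff q (p ^ Suc T - 1) = (\<Sum>m\<le>Suc T. if p ^ m - 1 = p ^ Suc T - 1 then a m else 0)"
    by (simp add: q_def coeff_sum)
  also have "\<dots> = a (Suc T)"
  proof -
    have "(\<Sum>m\<le>T. if p ^ m - 1 = p ^ Suc T - 1 then a m else 0) = 0"
      using lt by (intro sum.neutral) fastforce
    then show ?thesis by simp
  qed
  finally have "p ^ Suc T - 1 \<le> degree q" using aT by (intro le_degree) simp
  moreover have "p ^ Suc T - 1 > 0" using lt[of 0] by simp
  ultimately have "degree q > 0" by linarith
  then obtain z where z: "poly q z = 0" using alg_closed_imp_poly_has_root by blast
  have zq: "z * poly q z = (\<Sum>m\<le>Suc T. a m * z ^ (p ^ m))"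
    unfolding q_def poly_sum sum_distrib_left poly_monom
  proof (intro sum.cong refl)
    fix m
    have "p ^ m = Suc (p ^ m - 1)" using pm[of m] by linarith
    then have "z ^ (p ^ m) = z * z ^ (p ^ m - 1)" by (metis power_Suc)
    then show "z * (a m * z ^ (p ^ m - 1)) = a m * z ^ (p ^ m)" by simp
  qed
  have "z \<noteq> 0"
  proof
    assume "z = 0"
    then have "poly q z = (\<Sum>m\<le>Suc T. if m = 0 then a m else 0)"
      unfolding q_def poly_sum poly_monom
    proof (intro sum.cong refl)
      fix m assume "z = 0"
      show "a m * z ^ (p ^ m - 1) = (if m = 0 then a m else 0)"
      proof (cases m)
        case (Suc k)
        have "p ^ m > 1" by (rule one_less_power[OF p_gt1]) (simp add: Suc)
        then show ?thesis using \<open>z = 0\<close> Suc by (simp add: zero_power)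
      qed simp
    qed
    then show False using z a0 by simp
  qed
  define c where "c = (\<lambda>m. z ^ ((p - 1) * p ^ m))"
  have c0: "c m \<noteq> 0" for m using \<open>z \<noteq> 0\<close> by (simp add: c_def)
  \<comment> \<open>Solves \<open>a 0 = - b 0 * c 0\<close> and
    \<open>a (Suc m) = b m - b (Suc m) * c (Suc m)\<close> for b.\<close>
  define b where "b = rec_nat (- a 0 / c 0) (\<lambda>m r. (r - a (Suc m)) / c (Suc m))"
  have b0: "b 0 = - a 0 / c 0" and bS: "b (Suc m) = (b m - a (Suc m)) / c (Suc m)" for m by (simp_all add: b_def)
  have a0b: "a 0 = - b 0 * c 0" using c0[of 0] by (simp add: b0)
  have aS: "a (Suc m) = b m - b (Suc m) * c (Suc m)" for m using c0[of "Suc m"] by (simp add: bS)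
  have key: "(\<Sum>m\<le>k. a m * x ^ (p ^ m)) = (\<Sum>m<k. b m * (x ^ p - z ^ (p - 1) * x) ^ (p ^ m)) - b k * c k * x ^ (p ^ k)" for k x
  proof (induction k)
    case 0
    then show ?case by (simp add: a0b)
  next
    case (Suc k)
    have "(x ^ p - z ^ (p - 1) * x) ^ (p ^ k) = (x ^ p) ^ (p ^ k) - (z ^ (p - 1) * x) ^ (p ^ k)"
      unfolding p_def by (rule ac_diff_power)
    also have "\<dots> = x ^ (p ^ Suc k) - c k * x ^ (p ^ k)"
      by (simp add: c_def power_mult_distrib power_mult)
    finally have E: "(x ^ p - z ^ (p - 1) * x) ^ (p ^ k) = x ^ (p ^ Suc k) - c k * x ^ (p ^ k)" .
    have "b k * (x ^ p - z ^ (p - 1) * x) ^ (p ^ k) = b k * x ^ (p ^ Suc k) - b k * c k * x ^ (p ^ k)"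
      unfolding E by (simp add: right_diff_distrib mult.assoc)
    then show ?case using Suc by (simp add: aS left_diff_distrib)
  qed
  have zz: "z ^ p - z ^ (p - 1) * z = 0"
    using p_pos by (metis Suc_diff_1 cancel_comm_monoid_add_class.diff_cancel power_Suc2)
  have "(\<Sum>m<Suc T. b m * (z ^ p - z ^ (p - 1) * z) ^ (p ^ m)) = 0"
    using pm unfolding zz by (intro sum.neutral) (simp add: zero_power)
  then have "b (Suc T) * c (Suc T) * z ^ (p ^ Suc T) = 0"
    using key[where k = "Suc T" and x = z] zq z by simp
  then have bT: "b (Suc T) = 0" using c0 \<open>z \<noteq> 0\<close> by simp
  show thesis
  proof (rule that)
    show "z \<noteq> 0" by fact
    show "- (b 0 * z ^ (p - 1)) = a 0" by (simp add: a0b c_def)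
    show "(\<Sum>m\<le>Suc T. a m * x ^ (p ^ m)) = (\<Sum>m\<le>T. b m * (x ^ p - z ^ (p - 1) * x) ^ (p ^ m))" for x
      unfolding key bT lessThan_Suc_atMost by simp
  qed
qed

text \<open>Induction by splitting off one right factor. With e = - z^(p-1) it is e (y + y^p / e), a
  total power followed by scaling with e, and the latter requires a square root of e.\<close>

lemma GG_additive:
  assumes "w \<in> GG n g" "s\<^sup>2 = a 0" "a 0 \<noteq> 0"
  shows "(\<lambda>(b, y, S). s ^ card S * w (b, \<lambda>j. \<Sum>m\<le>T. a m * y j ^ (p ^ m), S)) \<in> GG n g"
  using assms
proof (induction T arbitrary: w s a)
  case 0
  then show ?case using GG_sigma[of w s] by simp
next
  case (Suc T)
  show ?case
  proof (cases "a (Suc T) = 0")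
    case True
    then show ?thesis using Suc.IH[where w = w and s = s and a = a, OF Suc.prems] by simp
  next
    case False
    obtain z c where z: "z \<noteq> 0" "- (c 0 * z ^ (p - 1)) = a 0"
      "\<And>x. (\<Sum>m\<le>Suc T. a m * x ^ (p ^ m)) = (\<Sum>m\<le>T. c m * (x ^ p - z ^ (p - 1) * x) ^ (p ^ m))"
      using factor_additive[OF Suc.prems(3) False] by blast
    define e where "e = - (z ^ (p - 1))"
    have e0: "e \<noteq> 0" using z(1) by (simp add: e_def)
    obtain s2 where s2: "s2 ^ 2 = e" using nth_root_exists[of 2 e] by auto
    have s20: "s2 \<noteq> 0" using s2 e0 by auto
    \<comment> \<open>The root \<open>s2\<close> of e is arbitrary; \<open>s1\<close> is adjusted so
      that the two twists multiply to the prescribed one.\<close>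
    define s1 where "s1 = s / s2"
    have ec: "a 0 = c 0 * e" using z(2) by (simp add: e_def)
    have c0: "s1\<^sup>2 = c 0" using e0 by (simp add: s1_def power_divide s2 Suc.prems(2) ec)
    have c00: "c 0 \<noteq> 0" using z(2) Suc.prems(3) by auto
    have 1: "(\<lambda>(b, y, S). s1 ^ card S * w (b, \<lambda>j. \<Sum>m\<le>T. c m * y j ^ (p ^ m), S)) \<in> GG n g"
      using Suc.IH[where w = w and s = s1 and a = c, OF Suc.prems(1) c0 c00] .
    from GG_total_power[OF GG_sigma[OF this, of s2], of "1 / e"]
    have "(\<lambda>(b, y, S). s2 ^ card S * (s1 ^ card S * w (b, \<lambda>j. \<Sum>m\<le>T. c m * (s2\<^sup>2 * (y j + 1 / e * y j ^ p)) ^ (p ^ m), S))) \<in> GG n g"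
      by (simp add: case_prod_beta)
    moreover have "s2\<^sup>2 * (x + 1 / e * x ^ p) = x ^ p - z ^ (p - 1) * x" for x
    proof -
      have "s2\<^sup>2 * (x + 1 / e * x ^ p) = e * x + x ^ p" using e0 by (simp add: s2 distrib_left)
      then show ?thesis by (simp add: e_def)
    qed
    moreover have "s2 ^ card S * (s1 ^ card S * v) = s ^ card S * v" for v and S :: "nat set"
      using s20 by (simp add: s1_def power_divide)
    ultimately show ?thesis by (simp only: z(3))
  qed
qed

lemma infinite_nz: "infinite (UNIV - {0 :: 'q mod_ring alg_closure})"
  using infinite_alg_closed by simp

lemma tpoly_iota:
  assumes "\<And>h. tpoly (\<lambda>t (x :: 'x). w t x (h x))" "\<And>j. tpoly (\<lambda>t x. v t x j)"
  shows "tpoly (\<lambda>t x. iota n (v t x) (w t x) (T x :: nat set))"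
proof -
  have "(\<lambda>t x. iota n (v t x) (w t x) (T x)) = (\<lambda>t x. \<Sum>j<n. (if j \<in> T x then 0 else sg (T x) j) * v t x j * w t x (insert j (T x)))"
    unfolding iota_def by (intro ext sum.cong) auto
  then show ?thesis by (simp only:) (intro tpoly_sum tpoly_mult tpoly_const assms)
qed

text \<open>The commutator of the Bockstein and the substitution y + t y^{p^i} is t times this contraction, up to that
  substitution; divide by t and put t = 0.\<close>

lemma GG_Milnor:
  assumes w: "w \<in> GG n g"
  shows "(\<lambda>(b, y, S). iota n (\<lambda>j. y j ^ (p ^ i)) (\<lambda>S. w (b, y, S)) S) \<in> GG n g"
proof (cases "i = 0")
  case True
  then show ?thesis using GG_Bock[OF w] by simp
next
  case False
  define al where "al = (\<lambda>t (y :: nat \<Rightarrow> 'q mod_ring alg_closure) j. y j + t * y j ^ (p ^ i))"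
  define f where "f = (\<lambda>t (b, y, S). iota n (\<lambda>j. y j ^ (p ^ i)) (\<lambda>S. w (b, al t y, S)) S)"
  have sub: "(\<lambda>(b, y, S). u (b, al t y, S)) \<in> GG n g" if u: "u \<in> GG n g" for u t
  proof -
    define a where "a = (\<lambda>m. if m = 0 then 1 else if m = i then t else 0)"
    have "(\<Sum>m\<le>i. a m * x ^ (p ^ m)) = x + t * x ^ (p ^ i)" for x
    proof -
      have "(\<Sum>m\<le>i. a m * x ^ (p ^ m)) = (\<Sum>m\<in>{0, i}. a m * x ^ (p ^ m))"
        by (intro sum.mono_neutral_right) (auto simp: a_def)
      then show ?thesis using False by (simp add: a_def)
    qed
    then show ?thesis using GG_additive[OF u, of 1 a i] by (simp add: a_def al_def case_prod_beta)
  qed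
  have "f t \<in> GG n g" if t: "t \<in> UNIV - {0}" for t
  proof -
    have 1: "(\<lambda>(b, y, S). iota n y (\<lambda>S. w (b, al t y, S)) S) \<in> GG n g"
      using GG_Bock[OF sub[OF w, of t]] by simp
    have 2: "(\<lambda>(b, y, S). iota n (al t y) (\<lambda>S. w (b, al t y, S)) S) \<in> GG n g"
      using sub[OF GG_Bock[OF w], of t] by simp
    have "(\<lambda>x. inverse t * ((case x of (b, y, S) \<Rightarrow> iota n (al t y) (\<lambda>S. w (b, al t y, S)) S) -
        (case x of (b, y, S) \<Rightarrow> iota n y (\<lambda>S. w (b, al t y, S)) S))) \<in> GG n g"
      using 1 2 by (intro subspc_scale[OF subspc_GG] subspc_diff[OF subspc_GG])
    moreover have "iota n (al t y) \<omega> S = iota n y \<omega> S + t * iota n (\<lambda>j. y j ^ (p ^ i)) \<omega> S" for y \<omega> S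
      unfolding al_def iota_vadd iota_vscale ..
    ultimately show ?thesis using t by (simp add: f_def case_prod_unfold flip: mult.assoc)
  qed
  moreover have "tpoly f"
    unfolding f_def case_prod_beta
    by (intro tpoly_iota tpoly_const tpoly_GG[OF w]) (simp only: al_def, intro tpoly_add tpoly_mult tpoly_const tpoly_id)
  ultimately have "f 0 \<in> GG n g" using extract_at_0[OF subspc_GG infinite_nz] by blast
  then show ?thesis by (simp add: f_def al_def)
qed

text \<open>Put s = 0 in the substitution s^2 y + y^p: the twist s ^ card S then kills all forms of positive degree.\<close>

lemma GG_Frobenius:
  assumes w: "w \<in> GG n g"
  shows "(\<lambda>(b, y, S). if S = {} then w (b, \<lambda>j. y j ^ p, S) else 0) \<in> GG n g"
proof -
  \<comment> \<open>Agrees with s ^ card S on the relevant sets, those inside {..<n}. Its degree in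
    s is at most n for every S, while s ^ card S has no bound uniform in S.\<close>
  define c where "c = (\<lambda>s (S :: nat set). \<Sum>k\<le>n. (if card S = k then 1 else 0) * (s :: 'q mod_ring alg_closure) ^ k)"
  have c: "c s S * w (b, y, S) = s ^ card S * w (b, y, S)" for s b y S
  proof (cases "S \<subseteq> {..<n}")
    case True
    then have "card S \<le> n" using card_mono[of "{..<n}" S] by simp
    then have "c s S = s ^ card S" by (simp add: c_def if_distrib[of "\<lambda>u. u * _"] cong: if_cong)
    then show ?thesis by simp
  next
    case False
    then show ?thesis using GG_support[OF w] by simp
  qed
  define f where "f = (\<lambda>s (b, y, S). c s S * w (b, \<lambda>j. s\<^sup>2 * y j + y j ^ p, S))"
  have "f s \<in> GG n g" if "s \<in> UNIV - {0}" for s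
    using GG_additive[OF w, of s "\<lambda>m. if m = 0 then s\<^sup>2 else 1" 1] that by (simp add: f_def c)
  moreover have "tpoly f"
    unfolding f_def case_prod_beta power2_eq_square c_def
    by (intro tpoly_mult tpoly_sum tpoly_GG[OF w] tpoly_power tpoly_add tpoly_const tpoly_id)
  ultimately have "f 0 \<in> GG n g" using extract_at_0[OF subspc_GG infinite_nz] by blast
  moreover have "f 0 = (\<lambda>(b, y, S). if S = {} then w (b, \<lambda>j. y j ^ p, S) else 0)"
  proof (intro ext, clarify)
    fix b y S
    show "f 0 (b, y, S) = (if S = {} then w (b, \<lambda>j. y j ^ p, S) else 0)"
    proof (cases "S \<subseteq> {..<n}")
      case True
      then have "finite S" using finite_subset by blast
      then show ?thesis by (auto simp: f_def c card_eq_0_iff)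
    next
      case False
      then have "S \<noteq> {}" by auto
      then show ?thesis using GG_support[OF w False] by (simp add: f_def)
    qed
  qed
  ultimately show ?thesis by simp
qed

text \<open>Without exterior part the twist is trivial, so no square root survives and a 0 may be 0:
  it is perturbed by t, and the value at t = 0 is extracted.\<close>

lemma GG_additive_poly:
  assumes w: "w \<in> GG n g" and e: "\<And>b y S. S \<noteq> {} \<Longrightarrow> w (b, y, S) = 0"
  shows "(\<lambda>(b, y, S). w (b, \<lambda>j. \<Sum>m\<le>T. a m * y j ^ (p ^ m), S)) \<in> GG n g"
proof -
  have 1: "(\<lambda>(b, y, S). w (b, \<lambda>j. \<Sum>m\<le>T. a m * y j ^ (p ^ m), S)) \<in> GG n g" if a0: "a 0 \<noteq> 0" for a
  proof -
    obtain s where s: "s ^ 2 = a 0" using nth_root_exists[of 2 "a 0"] by auto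
    have "s ^ card S * w (b, y, S) = w (b, y, S)" for b y S using e[of S b y] by (cases "S = {}") auto
    then show ?thesis using GG_additive[where w = w and s = s and a = a and T = T, OF w s a0] by (simp only:)
  qed
  define f where "f = (\<lambda>t (b, y, S). w (b, \<lambda>j. \<Sum>m\<le>T. (a m + (if m = 0 then t else 0)) * y j ^ (p ^ m), S))"
  have "f t \<in> GG n g" if "t \<in> UNIV - {- a 0}" for t
  proof -
    have "a 0 + t \<noteq> 0" using that by (auto simp: eq_neg_iff_add_eq_0 add.commute)
    then show ?thesis using 1[of "\<lambda>m. a m + (if m = 0 then t else 0)"] by (simp add: f_def)
  qed
  moreover have tp: "tpoly (\<lambda>t (x :: bool \<times> (nat \<Rightarrow> 'q mod_ring alg_closure) \<times> nat set). if m = (0::nat) then t else 0)" for m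
    using tpoly_id tpoly_const[of "\<lambda>_. 0"] by (cases "m = 0") simp_all
  moreover have "infinite (UNIV - {- a 0})" using infinite_alg_closed by simp
  moreover have "tpoly f"
    unfolding f_def case_prod_beta
    by (intro tpoly_GG[OF w] tpoly_sum tpoly_mult tpoly_add tpoly_const tp)
  ultimately have "f 0 \<in> GG n g" using extract_at_0[OF subspc_GG] by blast
  then show ?thesis by (simp add: f_def cong: if_cong)
qed

end

section \<open>Linear algebra over the prime field\<close>

definition inspan :: "nat \<Rightarrow> nat \<Rightarrow> (nat \<Rightarrow> nat \<Rightarrow> 'k::field) \<Rightarrow> (nat \<Rightarrow> 'k) \<Rightarrow> bool" where
  "inspan n l z x \<longleftrightarrow> (\<exists>c. \<forall>j<n. x j = (\<Sum>i<l. c i * z i j))"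

definition indep :: "nat \<Rightarrow> nat \<Rightarrow> (nat \<Rightarrow> nat \<Rightarrow> 'k::field) \<Rightarrow> bool" where
  "indep n l z \<longleftrightarrow> (\<forall>c. (\<forall>j<n. (\<Sum>i<l. c i * z i j) = 0) \<longrightarrow> (\<forall>i<l. c i = 0))"

lemma inspan_add: "inspan n l z x \<Longrightarrow> inspan n l z y \<Longrightarrow> inspan n l z (\<lambda>j. x j + y j)"
  unfolding inspan_def
proof (elim exE)
  fix c d assume "\<forall>j<n. x j = (\<Sum>i<l. c i * z i j)" "\<forall>j<n. y j = (\<Sum>i<l. d i * z i j)"
  then show "\<exists>c. \<forall>j<n. x j + y j = (\<Sum>i<l. c i * z i j)"
    by (intro exI[of _ "\<lambda>i. c i + d i"]) (simp add: distrib_right sum.distrib)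
qed

lemma inspan_scale: "inspan n l z x \<Longrightarrow> inspan n l z (\<lambda>j. a * x j)"
  unfolding inspan_def
proof (elim exE)
  fix c assume "\<forall>j<n. x j = (\<Sum>i<l. c i * z i j)"
  then show "\<exists>c. \<forall>j<n. a * x j = (\<Sum>i<l. c i * z i j)"
    by (intro exI[of _ "\<lambda>i. a * c i"]) (simp add: sum_distrib_left mult.assoc)
qed

lemma inspan_cong: "(\<And>i. i < l \<Longrightarrow> z i = z' i) \<Longrightarrow> inspan n l z x \<longleftrightarrow> inspan n l z' x"
  by (simp add: inspan_def)

lemma indep_cong: "(\<And>i. i < l \<Longrightarrow> z i = z' i) \<Longrightarrow> indep n l z \<longleftrightarrow> indep n l z'"
  by (simp add: indep_def)

lemma inspan_Suc: "inspan n (Suc l) z x \<longleftrightarrow> (\<exists>a. inspan n l z (\<lambda>j. x j + a * z l j))"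
proof
  assume "inspan n (Suc l) z x"
  then obtain c where c: "\<forall>j<n. x j = (\<Sum>i<Suc l. c i * z i j)" by (auto simp: inspan_def)
  show "\<exists>a. inspan n l z (\<lambda>j. x j + a * z l j)"
    unfolding inspan_def by (rule exI[of _ "- c l"], rule exI[of _ c]) (simp add: c)
next
  assume "\<exists>a. inspan n l z (\<lambda>j. x j + a * z l j)"
  then obtain a c where c: "\<forall>j<n. x j + a * z l j = (\<Sum>i<l. c i * z i j)" by (auto simp: inspan_def)
  have "(\<Sum>i<l. (c(l := - a)) i * z i j) = (\<Sum>i<l. c i * z i j)" for j by (intro sum.cong) auto
  then show "inspan n (Suc l) z x"
    unfolding inspan_def by (intro exI[of _ "c(l := - a)"]) (simp add: c[rule_format, symmetric])
qed

lemma indep_Suc: "indep n (Suc l) z \<longleftrightarrow> indep n l z \<and> \<not> inspan n l z (z l)"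
proof
  assume i: "indep n (Suc l) z"
  have "indep n l z" unfolding indep_def
  proof (intro allI impI)
    fix c i assume c: "\<forall>j<n. (\<Sum>i<l. c i * z i j) = 0" and il: "i < l"
    have "(\<Sum>i<l. (c(l := 0)) i * z i j) = (\<Sum>i<l. c i * z i j)" for j by (intro sum.cong) auto
    then have "\<forall>j<n. (\<Sum>i<Suc l. (c(l := 0)) i * z i j) = 0" using c by simp
    then have "(c(l := 0)) i = 0" using i il unfolding indep_def by (meson less_SucI)
    then show "c i = 0" using il by simp
  qed
  moreover have "\<not> inspan n l z (z l)"
  proof
    assume "inspan n l z (z l)"
    then obtain c where c: "\<forall>j<n. z l j = (\<Sum>i<l. c i * z i j)" by (auto simp: inspan_def)
    have "(\<Sum>i<l. (c(l := -1)) i * z i j) = (\<Sum>i<l. c i * z i j)" for j by (intro sum.cong) auto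
    then have "\<forall>j<n. (\<Sum>i<Suc l. (c(l := -1)) i * z i j) = 0" using c by simp
    then have "(c(l := -1)) l = 0" using i unfolding indep_def by (meson lessI)
    then show False by simp
  qed
  ultimately show "indep n l z \<and> \<not> inspan n l z (z l)" by simp
next
  assume a: "indep n l z \<and> \<not> inspan n l z (z l)"
  show "indep n (Suc l) z" unfolding indep_def
  proof (intro allI impI)
    fix c i assume c: "\<forall>j<n. (\<Sum>i<Suc l. c i * z i j) = 0" and i: "i < Suc l"
    have cl: "c l = 0"
    proof (rule ccontr)
      assume "c l \<noteq> 0"
      have "z l j = (\<Sum>i<l. (- c i / c l) * z i j)" if "j < n" for j
      proof -
        have "(\<Sum>i<l. c i * z i j) + c l * z l j = 0" using c that by simp
        then have "z l j = - (\<Sum>i<l. c i * z i j) / c l" using \<open>c l \<noteq> 0\<close>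
          by (metis add.inverse_inverse add_eq_0_iff nonzero_mult_div_cancel_left)
        then show ?thesis by (simp add: sum_divide_distrib sum_negf)
      qed
      then have "inspan n l z (z l)" unfolding inspan_def by (intro exI[of _ "\<lambda>i. - c i / c l"]) blast
      with a show False by simp
    qed
    then have "\<forall>j<n. (\<Sum>i<l. c i * z i j) = 0" using c by simp
    then have "\<forall>i<l. c i = 0" using a unfolding indep_def by blast
    then show "c i = 0" using cl i less_Suc_eq by auto
  qed
qed

lemma inspan_line:
  assumes "inspan n l z (\<lambda>j. x j + a * y j)" "inspan n l z (\<lambda>j. x j + b * y j)" "a \<noteq> b"
  shows "inspan n l z y"
proof -
  have "inspan n l z (\<lambda>j. (x j + a * y j) + (-1) * (x j + b * y j))"
    by (rule inspan_add[OF assms(1) inspan_scale[OF assms(2)]])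
  then have "inspan n l z (\<lambda>j. (1 / (a - b)) * ((x j + a * y j) + (-1) * (x j + b * y j)))" by (rule inspan_scale)
  moreover have "(1 / (a - b)) * ((x j + a * y j) + (-1) * (x j + b * y j)) = y j" for j
  proof -
    have "(x j + a * y j) + (-1) * (x j + b * y j) = (a - b) * y j" by (simp add: algebra_simps)
    then show ?thesis using assms(3) by simp
  qed
  ultimately show ?thesis by simp
qed

text \<open>Let V be the span of the first m vectors, x = \<open>z m\<close> and y =
  \<open>z (Suc m)\<close>. Of the p + 1 vectors y and x + a y, the number outside V is p + 1 if x
  and y are independent modulo V, and p or 0 otherwise. Modulo p only the first case leaves
  r.\<close>

lemma indep_count:
  fixes z :: "nat \<Rightarrow> nat \<Rightarrow> 'q::prime_card mod_ring" and r :: "'q mod_ring alg_closure"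
  shows "(if indep n m z \<and> \<not> inspan n m z (z (Suc m)) then r else 0) +
     (\<Sum>a\<in>UNIV. if indep n m z \<and> \<not> inspan n m z (\<lambda>j. z m j + a * z (Suc m) j) then r else 0) =
     (if indep n (Suc (Suc m)) z then r else 0)"
proof -
  define I where "I = (\<lambda>x. if indep n m z \<and> \<not> inspan n m z x then r else 0)"
  let ?V = "inspan n m z" and ?x = "z m" and ?y = "z (Suc m)"
  have char: "of_nat (card (UNIV :: 'q mod_ring set)) * r = 0"
    using of_nat_CHAR[where 'a="'q mod_ring alg_closure"] by (simp add: CHAR_ac)
  have ind: "indep n (Suc (Suc m)) z \<longleftrightarrow> indep n m z \<and> \<not> ?V ?x \<and> \<not> (\<exists>a. ?V (\<lambda>j. ?y j + a * ?x j))"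
    unfolding indep_Suc inspan_Suc by simp
  have "I ?y + (\<Sum>a\<in>UNIV. I (\<lambda>j. ?x j + a * ?y j)) = (if indep n (Suc (Suc m)) z then r else 0)"
  proof (cases "indep n m z")
    case False
    then show ?thesis by (simp add: I_def ind)
  next
    case i: True
    show ?thesis
    proof (cases "?V ?y")
      case True
      have "?V (\<lambda>j. ?x j + a * ?y j) \<longleftrightarrow> ?V ?x" for a
      proof
        assume "?V (\<lambda>j. ?x j + a * ?y j)"
        from inspan_add[OF this inspan_scale[OF True, of "- a"]] show "?V ?x" by simp
      next
        assume "?V ?x"
        from inspan_add[OF this inspan_scale[OF True, of a]] show "?V (\<lambda>j. ?x j + a * ?y j)" .
      qed
      moreover have "\<exists>a. ?V (\<lambda>j. ?y j + a * ?x j)" using True by (intro exI[of _ 0]) simp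
      ultimately show ?thesis using True char by (simp add: I_def ind)
    next
      case y: False
      show ?thesis
      proof (cases "\<exists>a. ?V (\<lambda>j. ?x j + a * ?y j)")
        case True
        then obtain a0 where a0: "?V (\<lambda>j. ?x j + a0 * ?y j)" by blast
        have iff: "?V (\<lambda>j. ?x j + a * ?y j) \<longleftrightarrow> a = a0" for a
          using inspan_line[OF _ a0] a0 y by blast
        have "(\<Sum>a\<in>UNIV. I (\<lambda>j. ?x j + a * ?y j)) = (\<Sum>a\<in>UNIV. r - (if a = a0 then r else 0))"
          by (intro sum.cong refl) (auto simp: I_def i iff)
        also have "\<dots> = - r" using char by (simp add: sum_subtractf)
        finally have s: "(\<Sum>a\<in>UNIV. I (\<lambda>j. ?x j + a * ?y j)) = - r" .
        have "\<not> indep n (Suc (Suc m)) z"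
        proof (cases "a0 = 0")
          case True
          then show ?thesis using a0 by (simp add: ind)
        next
          case False
          from inspan_scale[OF a0, of "1 / a0"] have "?V (\<lambda>j. ?y j + (1 / a0) * ?x j)"
            using False by (simp add: distrib_left add.commute)
          then show ?thesis unfolding ind by blast
        qed
        then show ?thesis using s y i by (simp add: I_def)
      next
        case False
        have "\<not> ?V ?x" using False by (auto dest!: spec[of _ 0])
        moreover have "\<not> (\<exists>a. ?V (\<lambda>j. ?y j + a * ?x j))"
        proof
          assume "\<exists>a. ?V (\<lambda>j. ?y j + a * ?x j)"
          then obtain a where a: "?V (\<lambda>j. ?y j + a * ?x j)" by blast
          with y have "a \<noteq> 0" by auto
          with inspan_scale[OF a, of "1 / a"] have "?V (\<lambda>j. ?x j + (1 / a) * ?y j)"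
            by (simp add: distrib_left add.commute)
          with False show False by blast
        qed
        ultimately have "indep n (Suc (Suc m)) z" using i by (simp add: ind)
        moreover have "(\<Sum>a\<in>UNIV. I (\<lambda>j. ?x j + a * ?y j)) = (\<Sum>a\<in>(UNIV :: 'q mod_ring set). r)"
          using False i by (intro sum.cong) (auto simp: I_def)
        ultimately show ?thesis using i y char by (simp add: I_def)
      qed
    qed
  qed
  then show ?thesis by (simp only: I_def)
qed

section \<open>Independence and determinants\<close>

definition dmat :: "nat \<Rightarrow> (nat \<Rightarrow> nat \<Rightarrow> 'k) \<Rightarrow> 'k mat" where
  "dmat n z = mat n n (\<lambda>(i, j). z i j)"

lemma dmat_carrier [simp]: "dmat n z \<in> carrier_mat n n" by (simp add: dmat_def)

text \<open>Independence concerns combinations of rows, the kernel of a matrix those of columns;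
  hence the transpose.\<close>

lemma indep_iff_det:
  fixes z :: "nat \<Rightarrow> nat \<Rightarrow> 'k::field"
  shows "indep n n z \<longleftrightarrow> det (dmat n z) \<noteq> 0"
proof -
  have T: "transpose_mat (dmat n z) \<in> carrier_mat n n" by simp
  have mv: "(transpose_mat (dmat n z) *\<^sub>v v = 0\<^sub>v n) \<longleftrightarrow> (\<forall>j<n. (\<Sum>i<n. vec_index v i * z i j) = 0)" if v: "v \<in> carrier_vec n" for v :: "'k vec"
  proof -
    have "vec_index (transpose_mat (dmat n z) *\<^sub>v v) j = (\<Sum>i<n. vec_index v i * z i j)" if "j < n" for j
      using that v by (simp add: dmat_def scalar_prod_def atLeast0LessThan mult.commute)
    moreover have "dim_vec (transpose_mat (dmat n z) *\<^sub>v v) = n" by (simp add: dmat_def)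
    ultimately show ?thesis by (simp add: vec_eq_iff)
  qed
  have "det (dmat n z) = 0 \<longleftrightarrow> (\<exists>v\<in>carrier_vec n. v \<noteq> 0\<^sub>v n \<and> transpose_mat (dmat n z) *\<^sub>v v = 0\<^sub>v n)"
    unfolding det_transpose[OF dmat_carrier, symmetric] by (subst det_0_iff_vec_prod_zero_field[OF T]) auto
  also have "\<dots> \<longleftrightarrow> \<not> indep n n z"
  proof
    assume "\<exists>v\<in>carrier_vec n. v \<noteq> 0\<^sub>v n \<and> transpose_mat (dmat n z) *\<^sub>v v = 0\<^sub>v n"
    then obtain v where v: "v \<in> carrier_vec n" "v \<noteq> 0\<^sub>v n" "\<forall>j<n. (\<Sum>i<n. vec_index v i * z i j) = 0" using mv by blast
    then obtain i where "i < n" "vec_index v i \<noteq> 0" by (metis carrier_vecD eq_vecI index_zero_vec)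
    with v(3) show "\<not> indep n n z" unfolding indep_def by blast
  next
    assume "\<not> indep n n z"
    then obtain c i where c: "\<forall>j<n. (\<Sum>i<n. c i * z i j) = 0" "i < n" "c i \<noteq> 0" unfolding indep_def by blast
    have v: "vec n c \<in> carrier_vec n" by simp
    have "(\<Sum>i<n. vec_index (vec n c) i * z i j) = (\<Sum>i<n. c i * z i j)" for j by (intro sum.cong) auto
    then have "transpose_mat (dmat n z) *\<^sub>v vec n c = 0\<^sub>v n" using c(1) mv[OF v] by simp
    moreover have "vec n c \<noteq> 0\<^sub>v n" using c(2,3) by (metis index_vec index_zero_vec(1))
    ultimately show "\<exists>v\<in>carrier_vec n. v \<noteq> 0\<^sub>v n \<and> transpose_mat (dmat n z) *\<^sub>v v = 0\<^sub>v n" using v by blast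
  qed
  finally show ?thesis by blast
qed

lemma det_inverse:
  fixes z :: "nat \<Rightarrow> nat \<Rightarrow> 'k::field"
  assumes "det (dmat n z) \<noteq> 0"
  shows "\<exists>B. \<forall>i<n. \<forall>j<n. (\<Sum>k<n. z i k * B k j) = (if i = j then 1 else 0)"
proof -
  let ?A = "dmat n z"
  let ?d = "inverse (det ?A)"
  have ad: "adj_mat ?A \<in> carrier_mat n n" "?A * adj_mat ?A = det ?A \<cdot>\<^sub>m 1\<^sub>m n"
    using adj_mat[OF dmat_carrier] by auto
  have "(\<Sum>k<n. z i k * (?d * adj_mat ?A $$ (k, j))) = (if i = j then 1 else 0)" if ij: "i < n" "j < n" for i j
  proof -
    have "(?A * adj_mat ?A) $$ (i, j) = (\<Sum>k<n. z i k * adj_mat ?A $$ (k, j))"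
      using ij ad(1) by (simp add: scalar_prod_def dmat_def atLeast0LessThan)
    then have "(\<Sum>k<n. z i k * adj_mat ?A $$ (k, j)) = det ?A * (if i = j then 1 else 0)"
      unfolding ad(2) using ij by simp
    moreover have "(\<Sum>k<n. z i k * (?d * adj_mat ?A $$ (k, j))) = ?d * (\<Sum>k<n. z i k * adj_mat ?A $$ (k, j))"
      by (simp add: sum_distrib_left mult_ac)
    ultimately show ?thesis using assms by simp
  qed
  then show ?thesis by (intro exI[of _ "\<lambda>k j. ?d * adj_mat ?A $$ (k, j)"]) blast
qed

lemma det_dmat_mult:
  fixes A B :: "nat \<Rightarrow> nat \<Rightarrow> 'k::comm_ring_1"
  shows "det (dmat n (\<lambda>i j. \<Sum>k<n. A i k * B k j)) = det (dmat n A) * det (dmat n B)"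
proof -
  have "dmat n (\<lambda>i j. \<Sum>k<n. A i k * B k j) = dmat n A * dmat n B"
    by (rule eq_matI) (simp_all add: dmat_def scalar_prod_def atLeast0LessThan)
  then show ?thesis by (simp add: det_mult[of _ n])
qed

lemma dmat_cong: "(\<And>i j. i < n \<Longrightarrow> j < n \<Longrightarrow> A i j = B i j) \<Longrightarrow> dmat n A = dmat n B"
  by (rule eq_matI) (simp_all add: dmat_def)

lemma dmat_one: "dmat n (\<lambda>i j. if i = j then 1 else 0) = 1\<^sub>m n"
  by (rule eq_matI) (simp_all add: dmat_def)

lemma GL_iff_det: "(A :: nat \<Rightarrow> nat \<Rightarrow> 'k::field) \<in> GL n \<longleftrightarrow> det (dmat n A) \<noteq> 0"
proof
  assume "A \<in> GL n"
  then obtain B where B: "\<forall>i<n. \<forall>j<n. (\<Sum>k<n. A i k * B k j) = (if i = j then 1 else 0)" by (auto simp: GL_def)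
  have "dmat n (\<lambda>i j. \<Sum>k<n. A i k * B k j) = 1\<^sub>m n"
    unfolding dmat_one[symmetric] using B by (intro dmat_cong) auto
  then have "det (dmat n A) * det (dmat n B) = 1" unfolding det_dmat_mult[symmetric] by simp
  then show "det (dmat n A) \<noteq> 0" by auto
next
  assume "det (dmat n A) \<noteq> 0"
  then show "A \<in> GL n" unfolding GL_def using det_inverse by blast
qed

lemma det_dmat_zero_row:
  fixes z :: "nat \<Rightarrow> nat \<Rightarrow> 'k::field"
  assumes "l < n" "\<And>j. j < n \<Longrightarrow> z l j = 0"
  shows "det (dmat n z) = 0"
proof -
  have "\<not> indep n n z"
  proof
    assume i: "indep n n z"
    have "(\<Sum>i<n. (if i = l then 1 else 0) * z i j) = (\<Sum>i<n. if i = l then z l j else 0)" for j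
      by (intro sum.cong) auto
    then have "\<forall>j<n. (\<Sum>i<n. (if i = l then 1 else 0) * z i j) = 0" using assms by simp
    then have "\<forall>i<n. (if i = l then 1 else 0) = (0 :: 'k)"
      by (rule i[unfolded indep_def, THEN spec, THEN mp])
    then show False using assms(1) by auto
  qed
  then show ?thesis by (simp add: indep_iff_det)
qed

text \<open>If l < n vectors spanned everything, expressing the unit vectors through them would
  factor the identity through a matrix with a zero row.\<close>

lemma exists_not_inspan:
  fixes z :: "nat \<Rightarrow> nat \<Rightarrow> 'k::field"
  assumes l: "l < n"
  shows "\<exists>x. \<not> inspan n l z x"
proof (rule ccontr)
  assume "\<nexists>x. \<not> inspan n l z x"
  then have "\<forall>k. inspan n l z (\<lambda>j. if k = j then 1 else 0)" by blast
  then obtain c where c: "\<forall>k. \<forall>j<n. (if k = j then 1 else 0) = (\<Sum>i<l. c k i * z i j)"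
    unfolding inspan_def by metis
  define C where "C = (\<lambda>k i. if i < l then c k i else 0)"
  define Z where "Z = (\<lambda>i j. if i < l then z i j else 0)"
  have "(\<Sum>i<n. C k i * Z i j) = (if k = j then 1 else 0)" if "k < n" "j < n" for k j
  proof -
    have "(\<Sum>i<n. C k i * Z i j) = (\<Sum>i<l. c k i * z i j)"
      using l by (intro sum.mono_neutral_cong_right) (auto simp: C_def Z_def)
    then show ?thesis using c that by simp
  qed
  then have "dmat n (\<lambda>k j. \<Sum>i<n. C k i * Z i j) = 1\<^sub>m n"
    unfolding dmat_one[symmetric] by (intro dmat_cong)
  then have "det (dmat n C) * det (dmat n Z) = 1" unfolding det_dmat_mult[symmetric] by simp
  moreover have "det (dmat n Z) = 0" by (rule det_dmat_zero_row[OF l]) (simp add: Z_def)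
  ultimately show False by simp
qed

lemma indep_extend:
  fixes z :: "nat \<Rightarrow> nat \<Rightarrow> 'k::field"
  assumes "indep n l z" "l \<le> n"
  shows "\<exists>z'. (\<forall>i<l. z' i = z i) \<and> indep n n z'"
  using assms(2,1)
proof (induction l arbitrary: z rule: inc_induct)
  case base
  then show ?case by blast
next
  case (step l)
  obtain x where x: "\<not> inspan n l z x" using exists_not_inspan step by blast
  have c: "indep n l (z(l := x)) \<longleftrightarrow> indep n l z" by (rule indep_cong) auto
  have "inspan n l (z(l := x)) x \<longleftrightarrow> inspan n l z x" by (rule inspan_cong) auto
  then have "indep n (Suc l) (z(l := x))" using c step.prems x by (simp add: indep_Suc)
  from step.IH[OF this] obtain z' where z': "\<forall>i<Suc l. z' i = (z(l := x)) i" "indep n n z'" by blast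
  then have "\<forall>i<l. z' i = z i" by auto
  with z'(2) show ?case by blast
qed

lemma sum_list_concat_map: "(\<Sum>s\<leftarrow>concat (map h xs). f s) = (\<Sum>x\<leftarrow>xs. \<Sum>s\<leftarrow>h x. (f s :: 'r::comm_monoid_add))"
  by (induction xs) auto

text \<open>Take the least k such that \<phi> is nonzero at a combination of k vectors over the prime field with
  coefficients in R. By minimality its value is 0 on dependent vectors, by invariance it is constant on
  independent ones. To pass from k vectors to k + 1, replace the last two by one, and sum over the p + 1 lines of
  the plane they span.\<close>

lemma orbit_sum:
  fixes \<phi> :: "(nat \<Rightarrow> 'q::prime_card mod_ring alg_closure) \<Rightarrow> 'q mod_ring alg_closure"
  assumes inv: "\<And>A y. A \<in> GL n \<Longrightarrow> \<phi> (tr n (acm A) y) = \<phi> y"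
    and zero: "\<phi> (\<lambda>_. 0) = 0"
    and cong: "\<And>y y'. (\<And>j. j < n \<Longrightarrow> y j = y' j) \<Longrightarrow> \<phi> y = \<phi> y'"
    and nz: "\<phi> y0 \<noteq> 0"
  shows "\<exists>ss r. r \<noteq> 0 \<and> (\<forall>z :: nat \<Rightarrow> nat \<Rightarrow> 'q mod_ring.
     (\<Sum>s\<leftarrow>ss. \<phi> (\<lambda>j. \<Sum>i<n. s i * to_ac (z i j))) = (if det (dmat n z) \<noteq> 0 then r else 0))"
proof -
  \<comment> \<open>The index set I is arbitrary, so that deleting a dependent vector needs no
    renumbering.\<close>
  define P where "P = (\<lambda>k. \<exists>I (z :: nat \<Rightarrow> nat \<Rightarrow> 'q mod_ring) u. finite (I :: nat set) \<and> card I = k \<and> \<phi> (\<lambda>j. \<Sum>i\<in>I. u i * to_ac (z i j)) \<noteq> 0)"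
  have "P n"
  proof -
    have "\<phi> (\<lambda>j. \<Sum>i<n. y0 i * to_ac (if i = j then 1 else 0)) = \<phi> y0"
    proof (rule cong)
      fix j assume "j < n"
      have "(\<Sum>i<n. y0 i * to_ac (if i = j then 1 else 0)) = (\<Sum>i<n. if i = j then y0 i else 0)"
        by (intro sum.cong) auto
      then show "(\<Sum>i<n. y0 i * to_ac (if i = j then 1 else 0)) = y0 j" using \<open>j < n\<close> by simp
    qed
    then show ?thesis unfolding P_def using nz by (intro exI[of _ "{..<n}"] exI[of _ "\<lambda>i j. if i = j then 1 else 0"] exI[of _ y0]) simp
  qed
  define k where "k = (LEAST k. P k)"
  have Pk: "P k" unfolding k_def using \<open>P n\<close> by (rule LeastI)
  have kn: "k \<le> n" unfolding k_def using \<open>P n\<close> by (rule Least_le)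
  have min: "\<not> P j" if "j < k" for j using that unfolding k_def by (rule not_less_Least)
  from Pk obtain I :: "nat set" and z0 :: "nat \<Rightarrow> nat \<Rightarrow> 'q mod_ring" and u0 where I: "finite I" "card I = k" and nzI: "\<phi> (\<lambda>j. \<Sum>i\<in>I. u0 i * to_ac (z0 i j)) \<noteq> 0"
    unfolding P_def by blast
  have "k \<noteq> 0"
  proof
    assume "k = 0"
    then have "I = {}" using I by simp
    with nzI zero show False by simp
  qed
  then obtain k' where k': "k = Suc k'" using not0_implies_Suc by blast
  obtain h where h: "bij_betw h {..<k} I" using ex_bij_betw_nat_finite[OF I(1)] I(2) by (auto simp: atLeast0LessThan)
  define u where "u = (\<lambda>i. u0 (h i))"
  define z1 where "z1 = (\<lambda>i. z0 (h i))"
  have "(\<lambda>j. \<Sum>i\<in>I. u0 i * to_ac (z0 i j)) = (\<lambda>j. \<Sum>i<k. u i * to_ac (z1 i j))"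
    unfolding u_def z1_def by (rule ext, rule sum.reindex_bij_betw[OF h, symmetric])
  with nzI have nz1: "\<phi> (\<lambda>j. \<Sum>i<k. u i * to_ac (z1 i j)) \<noteq> 0" by simp
  have dep: "\<phi> (\<lambda>j. \<Sum>i<k. u i * to_ac (z i j)) = 0" if nd: "\<not> indep n k z" for z
  proof -
    obtain c i0 where c: "\<And>j. j < n \<Longrightarrow> (\<Sum>i<k. c i * z i j) = 0" "i0 < k" "c i0 \<noteq> 0" using nd unfolding indep_def by blast
    let ?J = "{..<k} - {i0}"
    define v where "v = (\<lambda>i. u i + u i0 * to_ac (- c i / c i0))"
    have eq: "\<phi> (\<lambda>j. \<Sum>i<k. u i * to_ac (z i j)) = \<phi> (\<lambda>j. \<Sum>i\<in>?J. v i * to_ac (z i j))"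
    proof (rule cong)
      fix j assume j: "j < n"
      have "c i0 * z i0 j + (\<Sum>i\<in>?J. c i * z i j) = 0" using c(1)[OF j] c(2) by (subst (asm) sum.remove[of _ i0]) auto
      then have "c i0 * z i0 j = - (\<Sum>i\<in>?J. c i * z i j)" by (simp add: eq_neg_iff_add_eq_0)
      then have "z i0 j = - (\<Sum>i\<in>?J. c i * z i j) / c i0" using c(3) by (simp add: field_simps)
      also have "\<dots> = (\<Sum>i\<in>?J. (- c i / c i0) * z i j)" by (simp add: sum_divide_distrib sum_negf)
      finally have z: "z i0 j = (\<Sum>i\<in>?J. (- c i / c i0) * z i j)" .
      have "(\<Sum>i<k. u i * to_ac (z i j)) = u i0 * to_ac (z i0 j) + (\<Sum>i\<in>?J. u i * to_ac (z i j))"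
        using c(2) by (subst sum.remove[of _ i0]) auto
      also have "u i0 * to_ac (z i0 j) = (\<Sum>i\<in>?J. u i0 * to_ac (- c i / c i0) * to_ac (z i j))"
        by (subst z) (simp only: to_ac_sum to_ac_mult sum_distrib_left mult.assoc)
      finally show "(\<Sum>i<k. u i * to_ac (z i j)) = (\<Sum>i\<in>?J. v i * to_ac (z i j))"
        by (simp only: v_def distrib_right sum.distrib add.commute)
    qed
    have np: "\<not> P k'" by (rule min) (simp add: k')
    have J: "finite ?J" "card ?J = k'" using c(2) by (simp_all add: k')
    show ?thesis
    proof (rule ccontr)
      assume "\<phi> (\<lambda>j. \<Sum>i<k. u i * to_ac (z i j)) \<noteq> 0"
      with eq J have "P k'" unfolding P_def by (intro exI[of _ ?J] exI[of _ z] exI[of _ v]) simp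
      with np show False by blast
    qed
  qed
  define r where "r = \<phi> (\<lambda>i. if i < k then u i else 0)"
  \<comment> \<open>Independent vectors are completed to the rows of an invertible matrix over the
    prime field, and invariance removes this matrix.\<close>
  have ind: "\<phi> (\<lambda>j. \<Sum>i<k. u i * to_ac (z i j)) = r" if i: "indep n k z" for z
  proof -
    obtain z' where z': "\<forall>i<k. z' i = z i" "indep n n z'" using indep_extend[OF i kn] by blast
    have "z' \<in> GL n" using z'(2) by (simp add: indep_iff_det GL_iff_det)
    have "(\<lambda>j. \<Sum>i<k. u i * to_ac (z i j)) = tr n (acm z') (\<lambda>i. if i < k then u i else 0)"
    proof
      fix j
      show "(\<Sum>i<k. u i * to_ac (z i j)) = tr n (acm z') (\<lambda>i. if i < k then u i else 0) j"
        unfolding tr_def using kn z'(1) by (intro sum.mono_neutral_cong_left) auto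
    qed
    then show ?thesis using inv[OF \<open>z' \<in> GL n\<close>] by (simp add: r_def)
  qed
  have r0: "r \<noteq> 0"
  proof (cases "indep n k z1")
    case True
    with ind nz1 show ?thesis by simp
  next
    case False
    with dep nz1 show ?thesis by simp
  qed
  define Q where "Q = (\<lambda>l. \<exists>ss. \<forall>z :: nat \<Rightarrow> nat \<Rightarrow> 'q mod_ring. (\<Sum>s\<leftarrow>ss. \<phi> (\<lambda>j. \<Sum>i<l. s i * to_ac (z i j))) = (if indep n l z then r else 0))"
  have Qstep: "Q (Suc (Suc m))" if Qm: "Q (Suc m)" for m
  proof -
    obtain ss where ss: "\<And>z :: nat \<Rightarrow> nat \<Rightarrow> 'q mod_ring. (\<Sum>s\<leftarrow>ss. \<phi> (\<lambda>j. \<Sum>i<Suc m. s i * to_ac (z i j))) = (if indep n (Suc m) z then r else 0)"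
      using Qm unfolding Q_def by blast
    obtain as :: "'q mod_ring list" where as: "set as = UNIV" "distinct as" using finite_distinct_list[of "UNIV :: 'q mod_ring set"] by auto
    \<comment> \<open>The first block attaches the last coefficient of s to \<open>z (Suc m)\<close>
      alone, the second attaches it, for each a, to \<open>z m\<close> plus a times
      \<open>z (Suc m)\<close>.\<close>
    define ss' where "ss' = map (\<lambda>s. s(m := 0, Suc m := s m)) ss @ concat (map (\<lambda>a. map (\<lambda>s. s(Suc m := to_ac a * s m)) ss) as)"
    have "(\<Sum>s\<leftarrow>ss'. \<phi> (\<lambda>j. \<Sum>i<Suc (Suc m). s i * to_ac (z i j))) = (if indep n (Suc (Suc m)) z then r else 0)" for z :: "nat \<Rightarrow> nat \<Rightarrow> 'q mod_ring"
    proof -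
      have low: "(\<Sum>i<m. (f i :: 'q mod_ring alg_closure) * to_ac (w i j)) = (\<Sum>i<m. s i * to_ac (z i j))"
        if "\<And>i. i < m \<Longrightarrow> f i = s i" "\<And>i. i < m \<Longrightarrow> w i = z i" for f s w j
        using that by (intro sum.cong) auto
      have 1: "(\<lambda>j. \<Sum>i<Suc (Suc m). (s(m := 0, Suc m := s m)) i * to_ac (z i j)) = (\<lambda>j. \<Sum>i<Suc m. s i * to_ac ((z(m := z (Suc m))) i j))" for s
        using low[of "s(m := 0, Suc m := s m)" s z] low[of s s "z(m := z (Suc m))"] by (auto simp: fun_eq_iff)
      have 2: "(\<lambda>j. \<Sum>i<Suc (Suc m). (s(Suc m := to_ac a * s m)) i * to_ac (z i j)) = (\<lambda>j. \<Sum>i<Suc m. s i * to_ac ((z(m := (\<lambda>j. z m j + a * z (Suc m) j))) i j))" for s a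
        using low[of "s(Suc m := to_ac a * s m)" s z] low[of s s "z(m := (\<lambda>j. z m j + a * z (Suc m) j))"] by (auto simp: fun_eq_iff algebra_simps)
      have 3: "indep n (Suc m) (z(m := x)) \<longleftrightarrow> indep n m z \<and> \<not> inspan n m z x" for x
        using indep_cong[of m "z(m := x)" z n] inspan_cong[of m "z(m := x)" z n x] by (simp add: indep_Suc)
      have "(\<Sum>s\<leftarrow>ss'. \<phi> (\<lambda>j. \<Sum>i<Suc (Suc m). s i * to_ac (z i j))) =
        (\<Sum>s\<leftarrow>ss. \<phi> (\<lambda>j. \<Sum>i<Suc m. s i * to_ac ((z(m := z (Suc m))) i j))) +
        (\<Sum>a\<leftarrow>as. \<Sum>s\<leftarrow>ss. \<phi> (\<lambda>j. \<Sum>i<Suc m. s i * to_ac ((z(m := (\<lambda>j. z m j + a * z (Suc m) j))) i j)))"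
        unfolding ss'_def by (simp only: map_append sum_list_append map_map o_def 1 sum_list_concat_map 2)
      also have "\<dots> = (if indep n m z \<and> \<not> inspan n m z (z (Suc m)) then r else 0) +
         (\<Sum>a\<in>UNIV. if indep n m z \<and> \<not> inspan n m z (\<lambda>j. z m j + a * z (Suc m) j) then r else 0)"
        unfolding ss 3 as(1)[symmetric] by (simp only: sum.distinct_set_conv_list[OF as(2)])
      also have "\<dots> = (if indep n (Suc (Suc m)) z then r else 0)" by (rule indep_count)
      finally show ?thesis .
    qed
    then show ?thesis unfolding Q_def by blast
  qed
  have "Q k" unfolding Q_def using ind dep by (intro exI[of _ "[u]"]) auto
  have "Q n"
    using kn
  proof (induction n rule: dec_induct)
    case base
    show ?case by fact
  next
    case (step m)
    then obtain m' where "m = Suc m'" using k' by (cases m) auto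
    with step Qstep show ?case by simp
  qed
  then show ?thesis using r0 unfolding Q_def indep_iff_det by blast
qed

section \<open>Digit sums and truncated traces\<close>

text \<open>Digit sum of e in base p; the guard \<open>p < 2\<close> secures termination.\<close>

function ds :: "nat \<Rightarrow> nat \<Rightarrow> nat" where
  "ds p e = (if e = 0 \<or> p < 2 then 0 else e mod p + ds p (e div p))"
  by auto
termination by (relation "measure snd") auto

declare ds.simps [simp del]

lemma ds_0: "ds p 0 = 0" by (simp add: ds.simps)

lemma ds_step: "p \<ge> 2 \<Longrightarrow> ds p e = e mod p + ds p (e div p)"
  using ds.simps[of p e] by (cases "e = 0") (auto simp: ds_0)

lemma ds_digit: "p \<ge> 2 \<Longrightarrow> a < p \<Longrightarrow> ds p (a + p * e) = a + ds p e"
  by (subst ds_step) auto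

lemma ds_Suc:
  assumes p: "p \<ge> 2"
  shows "ds p (Suc e) \<le> Suc (ds p e)"
proof (induction e rule: less_induct)
  case (less e)
  define a b where "a = e mod p" and "b = e div p"
  have e: "e = a + p * b" and a: "a < p" using p by (auto simp: a_def b_def)
  show ?case
  proof (cases "Suc a < p")
    case True
    have "ds p (Suc a + p * b) = Suc a + ds p b" by (rule ds_digit[OF p True])
    then show ?thesis using ds_digit[OF p a, of b] by (simp add: e)
  next
    case False
    then have ap: "Suc a = p" using a by simp
    then have "Suc e = 0 + p * Suc b" by (simp add: e)
    then have "ds p (Suc e) = ds p (Suc b)" using ds_digit[OF p, of 0 "Suc b"] p by simp
    moreover have "ds p (Suc b) \<le> Suc (ds p b)"
    proof (cases "e = 0")
      case True
      with e ap p show ?thesis by auto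
    next
      case False
      then have "b < e" using p by (simp add: b_def)
      then show ?thesis by (rule less)
    qed
    ultimately show ?thesis using ds_digit[OF p a, of b] by (simp add: e)
  qed
qed

text \<open>Each carry replaces p units of one digit by a single unit of the next.\<close>

lemma ds_add:
  assumes p: "p \<ge> 2"
  shows "ds p (x + y) \<le> ds p x + ds p y"
proof (induction x arbitrary: y rule: less_induct)
  case (less x)
  show ?case
  proof (cases "x = 0")
    case True
    then show ?thesis by simp
  next
    case False
    define a b c d where "a = x mod p" and "b = x div p" and "c = y mod p" and "d = y div p"
    have x: "x = a + p * b" and a: "a < p" and y: "y = c + p * d" and c: "c < p" using p by (auto simp: a_def b_def c_def d_def)
    have "b < x" using p False by (simp add: b_def)
    then have IH: "ds p (b + d) \<le> ds p b + ds p d" by (rule less)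
    have dx: "ds p x = a + ds p b" "ds p y = c + ds p d" using ds_digit[OF p] a c by (simp_all add: x y)
    show ?thesis
    proof (cases "a + c < p")
      case True
      have "ds p (x + y) = ds p ((a + c) + p * (b + d))" by (simp add: x y algebra_simps)
      also have "\<dots> = (a + c) + ds p (b + d)" by (rule ds_digit[OF p True])
      finally show ?thesis using IH dx by simp
    next
      case False
      have "x + y = (a + c - p) + p * Suc (b + d)" using False by (simp add: x y algebra_simps)
      then have "ds p (x + y) = (a + c - p) + ds p (Suc (b + d))" using ds_digit[OF p, of "a + c - p" "Suc (b + d)"] a c by simp
      also have "\<dots> \<le> (a + c - p) + Suc (ds p (b + d))" using ds_Suc[OF p] by simp
      also have "\<dots> \<le> a + c + ds p (b + d)" using False p by simp
      finally show ?thesis using IH dx by simp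
    qed
  qed
qed

lemma ds_power: "p \<ge> 2 \<Longrightarrow> ds p (p ^ m) = 1"
proof (induction m)
  case 0
  then show ?case using ds_digit[of p 1 0] by (simp add: ds_0)
next
  case (Suc m)
  then show ?case using ds_digit[of p 0 "p ^ m"] by simp
qed

text \<open>If p^k divides e + 1, the k lowest digits of e all equal p - 1, and each contributes at
  least 1.\<close>

lemma ds_lower: "p \<ge> 2 \<Longrightarrow> p ^ k dvd Suc e \<Longrightarrow> k \<le> ds p e"
proof (induction k arbitrary: e)
  case (Suc k)
  define a b where "a = e mod p" and "b = e div p"
  have e: "e = a + p * b" and a: "a < p" using Suc.prems by (auto simp: a_def b_def)
  have "p dvd Suc e" using Suc.prems(2) by (metis dvd_mult_left power_Suc)
  then have "p dvd Suc a" using e by (metis add_Suc dvd_add_left_iff dvd_triv_left)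
  then have ap: "Suc a = p" using a by (meson Suc_leI dvd_imp_le le_antisym zero_less_Suc)
  then have Se: "Suc e = p * Suc b" by (simp add: e)
  have "p * p ^ k dvd p * Suc b" using Suc.prems(2) unfolding Se power_Suc .
  moreover have "p \<noteq> 0" using Suc.prems(1) by simp
  ultimately have "p ^ k dvd Suc b" using nat_mult_dvd_cancel1[of p "p ^ k" "Suc b"] by blast
  then have "k \<le> ds p b" using Suc by blast
  then show ?case using ds_digit[OF Suc.prems(1) a, of b] ap Suc.prems(1) by (simp add: e)
qed simp

text \<open>A multiplicative filtration by digit sums of exponents, in which a product of s
  truncated traces has weight at most s.\<close>

definition dsupp :: "nat \<Rightarrow> nat \<Rightarrow> 'r::comm_ring_1 poly \<Rightarrow> bool" where
  "dsupp p s Q \<longleftrightarrow> (\<forall>e. coeff Q e \<noteq> 0 \<longrightarrow> ds p e \<le> s)"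

lemma dsupp_mult:
  assumes "p \<ge> 2" "dsupp p s A" "dsupp p t B"
  shows "dsupp p (s + t) (A * B)"
  unfolding dsupp_def
proof (intro allI impI)
  fix e assume "coeff (A * B) e \<noteq> 0"
  then have "(\<Sum>i\<le>e. coeff A i * coeff B (e - i)) \<noteq> 0" by (simp add: coeff_mult)
  then obtain i where i: "i \<in> {..e}" "coeff A i * coeff B (e - i) \<noteq> 0" by (rule sum.not_neutral_contains_not_neutral)
  then have "coeff A i \<noteq> 0" "coeff B (e - i) \<noteq> 0" by auto
  then have "ds p i \<le> s" "ds p (e - i) \<le> t" using assms by (auto simp: dsupp_def)
  then show "ds p e \<le> s + t" using ds_add[OF assms(1), of i "e - i"] i(1) by simp
qed

lemma dsupp_one: "dsupp p s 1"
  by (auto simp: dsupp_def coeff_1 ds_0 split: if_splits)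

lemma dsupp_power: "p \<ge> 2 \<Longrightarrow> dsupp p s A \<Longrightarrow> dsupp p (k * s) (A ^ k)"
  by (induction k) (auto simp: dsupp_one intro: dsupp_mult)

lemma dsupp_prod: "p \<ge> 2 \<Longrightarrow> (\<And>i. i \<in> I \<Longrightarrow> dsupp p (s i) (A i)) \<Longrightarrow> dsupp p (\<Sum>i\<in>I. s i) (\<Prod>i\<in>I. A i)"
  by (induction I rule: infinite_finite_induct) (auto simp: dsupp_one intro: dsupp_mult)

text \<open>For c with (z c)^(p^T) = z c the value is the trace of z c from the field with p^T
  elements to the prime field. As a polynomial in c it satisfies the equation \<lambda>^p =
  \<lambda> up to two end terms.\<close>

definition lamp :: "nat \<Rightarrow> nat \<Rightarrow> 'r::comm_ring_1 \<Rightarrow> 'r poly" where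
  "lamp p T z = (\<Sum>m<T. Polynomial.monom (z ^ (p ^ m)) (p ^ m))"

lemma dsupp_lamp: "p \<ge> 2 \<Longrightarrow> dsupp p 1 (lamp p T z)"
  unfolding dsupp_def lamp_def
proof (intro allI impI)
  fix e assume p: "p \<ge> 2" and "coeff (\<Sum>m<T. Polynomial.monom (z ^ (p ^ m)) (p ^ m)) e \<noteq> 0"
  then have "(\<Sum>m<T. coeff (Polynomial.monom (z ^ (p ^ m)) (p ^ m)) e) \<noteq> 0" by (simp only: coeff_sum not_False_eq_True)
  then obtain m where "coeff (Polynomial.monom (z ^ (p ^ m)) (p ^ m)) e \<noteq> 0" by (rule sum.not_neutral_contains_not_neutral)
  then have "e = p ^ m" by (auto split: if_splits)
  then show "ds p e \<le> 1" using ds_power[OF p, of m] by simp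
qed

lemma poly_lamp: "poly (lamp p T z) c = (\<Sum>m<T. (c * z) ^ (p ^ m))"
  by (simp add: lamp_def poly_sum poly_monom power_mult_distrib mult.commute)

lemma lamp_power:
  fixes z :: "'r::comm_ring_1"
  assumes "prime p" "CHAR('r) = p"
  shows "lamp p T z ^ p - lamp p T z = Polynomial.monom (z ^ (p ^ T)) (p ^ T) - Polynomial.monom z 1"
proof -
  have "lamp p T z ^ p = (\<Sum>m<T. Polynomial.monom (z ^ (p ^ m)) (p ^ m) ^ p)"
    unfolding lamp_def by (rule freshmans_dream_sum) (use assms in simp_all)
  also have "\<dots> = (\<Sum>m<T. Polynomial.monom (z ^ (p ^ Suc m)) (p ^ Suc m))"
    by (intro sum.cong refl) (simp add: monom_power power_mult[symmetric] mult.commute)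
  finally have "lamp p T z ^ p - lamp p T z = (\<Sum>m<T. Polynomial.monom (z ^ (p ^ Suc m)) (p ^ Suc m) - Polynomial.monom (z ^ (p ^ m)) (p ^ m))"
    by (simp add: lamp_def sum_subtractf)
  also have "\<dots> = Polynomial.monom (z ^ (p ^ T)) (p ^ T) - Polynomial.monom z 1"
    by (subst sum_lessThan_telescope) simp
  finally show ?thesis .
qed

text \<open>With \<lambda> the truncated trace \<open>lamp p T z\<close>, the difference \<lambda>^p - \<lambda> is z^{p^T} c^{p^T} - z c. When it is
  multiplied by fewer than k traces, neither term contributes to the coefficient of c^E: the first because
  E < p^T, the second because E - 1 has digit sum at least k. So in that coefficient exponents of \<lambda> may be reduced
  as for elements of the prime field.\<close>

locale trace_setup =
  fixes p k T E :: nat and ty :: "'r::field itself"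
  assumes p: "prime p" and char: "CHAR('r) = p" and dvdE: "p ^ k dvd E" and E: "E < p ^ T"
begin

lemma p2: "p \<ge> 2" using p by (rule prime_ge_2_nat)

lemma coeff_edge:
  fixes z :: 'r
  assumes "dsupp p s Q" "s < k"
  shows "coeff (Q * (lamp p T z ^ p - lamp p T z)) E = 0"
proof -
  have "coeff (Q * Polynomial.monom (z ^ (p ^ T)) (p ^ T)) E = 0"
    using E by (simp add: mult.commute[of Q] coeff_monom_mult)
  moreover have "coeff (Q * Polynomial.monom z 1) E = 0"
  proof (cases E)
    case (Suc e)
    have "k \<le> ds p e" using ds_lower[OF p2] dvdE Suc by simp
    then have "coeff Q e = 0" using assms unfolding dsupp_def by (metis le_less_trans less_irrefl)
    then show ?thesis using Suc by (simp add: mult.commute[of Q] coeff_monom_mult)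
  qed (simp add: mult.commute[of Q] coeff_monom_mult)
  ultimately show ?thesis unfolding lamp_power[OF p char] by (simp add: right_diff_distrib)
qed

text \<open>Exponents reduced by the relation x^p = x. Zero is kept apart because x^0 and x^(p-1)
  differ at x = 0; positive exponents are represented by 1, ..., p - 1.\<close>

definition red :: "nat \<Rightarrow> nat" where
  "red a = (if a = 0 then 0 else (a - 1) mod (p - 1) + 1)"

lemma red_le: "red a \<le> a"
proof (cases "a = 0")
  case False
  have "(a - 1) mod (p - 1) \<le> a - 1" by (rule mod_less_eq_dividend)
  then have "(a - 1) mod (p - 1) + 1 \<le> a" using False by linarith
  then show ?thesis by (simp only: red_def False if_False)
qed (simp add: red_def)

lemma red_less: "red a < p"
proof (cases "a = 0")
  case False
  have "(a - 1) mod (p - 1) < p - 1" using p2 by (intro mod_less_divisor) simp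
  then have "(a - 1) mod (p - 1) + 1 < p" using p2 by linarith
  then show ?thesis by (simp only: red_def False if_False)
qed (use p2 in \<open>simp add: red_def\<close>)

lemma red_small: "a < p \<Longrightarrow> red a = a"
  by (auto simp: red_def)

lemma red_step: "a \<ge> p \<Longrightarrow> red a = red (a - p + 1)"
proof -
  assume a: "a \<ge> p"
  have "(a - 1) mod (p - 1) = (a - 1 - (p - 1)) mod (p - 1)" using a by (intro le_mod_geq) simp
  then show ?thesis using a p2 by (simp add: red_def)
qed

text \<open>Replacing \<lambda>^a by \<lambda>^(a-p+1) changes the product by Q \<lambda>^(a-p)
  times \<lambda>^p - \<lambda>. The weight s + a - p of the first part is below k, so
  \<open>coeff_edge\<close> applies.\<close>

lemma coeff_red:
  fixes z :: 'r
  assumes "dsupp p s Q" "s + a \<le> k"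
  shows "coeff (Q * lamp p T z ^ a) E = coeff (Q * lamp p T z ^ red a) E"
  using assms
proof (induction a rule: less_induct)
  case (less a)
  show ?case
  proof (cases "a < p")
    case True
    then show ?thesis by (simp add: red_small)
  next
    case False
    let ?L = "lamp p T z"
    have a: "a = (a - p) + p" using False by simp
    have "dsupp p (s + (a - p) * 1) (Q * ?L ^ (a - p))" by (intro dsupp_mult[OF p2] less.prems dsupp_power[OF p2] dsupp_lamp[OF p2])
    moreover have "s + (a - p) * 1 < k" using less.prems False p2 by simp
    ultimately have "coeff (Q * ?L ^ (a - p) * (?L ^ p - ?L)) E = 0" by (rule coeff_edge)
    moreover have "Q * ?L ^ (a - p) * (?L ^ p - ?L) = Q * ?L ^ a - Q * ?L ^ (a - p + 1)"
      by (subst a) (simp add: power_add algebra_simps)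
    ultimately have "coeff (Q * ?L ^ a) E = coeff (Q * ?L ^ (a - p + 1)) E" by simp
    also have "\<dots> = coeff (Q * ?L ^ red (a - p + 1)) E"
      by (rule less.IH) (use less.prems False p2 in auto)
    also have "red (a - p + 1) = red a" using red_step False by simp
    finally show ?thesis .
  qed
qed

text \<open>One variable is reduced at a time, the other factors being absorbed into Q. Reduction
  does not increase exponents, so the total weight stays within k.\<close>

lemma coeff_red_prod:
  fixes z :: "'i \<Rightarrow> 'r"
  assumes "finite J" "dsupp p s Q" "s + (\<Sum>j\<in>J. a j) \<le> k"
  shows "coeff (Q * (\<Prod>j\<in>J. lamp p T (z j) ^ a j)) E = coeff (Q * (\<Prod>j\<in>J. lamp p T (z j) ^ red (a j))) E"
  using assms
proof (induction J arbitrary: Q s rule: finite_induct)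
  case (insert j J)
  let ?L = "\<lambda>j. lamp p T (z j)"
  have d: "dsupp p (t * 1) (?L j ^ t)" for t j by (intro dsupp_power[OF p2] dsupp_lamp[OF p2])
  have 1: "coeff (Q * ?L j ^ a j * (\<Prod>j\<in>J. ?L j ^ a j)) E = coeff (Q * ?L j ^ a j * (\<Prod>j\<in>J. ?L j ^ red (a j))) E"
    by (rule insert.IH[OF dsupp_mult[OF p2 insert.prems(1) d]]) (use insert in simp)
  have le: "(\<Sum>j\<in>J. red (a j)) \<le> (\<Sum>j\<in>J. a j)" by (intro sum_mono red_le)
  have 2: "coeff (Q * (\<Prod>j\<in>J. ?L j ^ red (a j)) * ?L j ^ a j) E = coeff (Q * (\<Prod>j\<in>J. ?L j ^ red (a j)) * ?L j ^ red (a j)) E"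
  proof (rule coeff_red)
    have "dsupp p (\<Sum>j\<in>J. red (a j)) (\<Prod>j\<in>J. ?L j ^ red (a j))"
      using dsupp_prod[OF p2, of J "\<lambda>j. red (a j)" "\<lambda>j. ?L j ^ red (a j)"] d by simp
    then show "dsupp p (s + (\<Sum>j\<in>J. red (a j))) (Q * (\<Prod>j\<in>J. ?L j ^ red (a j)))"
      by (rule dsupp_mult[OF p2 insert.prems(1)])
    show "s + (\<Sum>j\<in>J. red (a j)) + a j \<le> k" using insert le by simp
  qed
  show ?case using 1 2 insert.hyps by (simp add: mult_ac)
qed simp

end

text \<open>Reducing all exponents changes neither the values of F on the prime field nor the
  coefficient at E. The reduced polynomial has exponents below p and vanishes on the prime field, so
  all its coefficients are zero.\<close>

lemma transfer_zero:
  fixes F :: "('i \<Rightarrow> 'q::prime_card mod_ring alg_closure) \<Rightarrow> 'q mod_ring alg_closure"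
  assumes pc: "p = CARD('q)" and J: "finite J" and F: "polyfun J N F" and N: "N \<le> k"
    and dvdE: "p ^ k dvd E" and E: "E < p ^ T"
    and zero: "\<And>x. F (\<lambda>j. to_ac (x j)) = 0"
    and Q: "\<And>c. poly Q c = F (\<lambda>j. poly (lamp p T (z j)) c)"
  shows "coeff Q E = 0"
proof -
  interpret trace_setup p k T E "TYPE('q mod_ring alg_closure)"
  proof unfold_locales
    show "prime p" unfolding pc by (rule prime_card)
    show "CHAR('q mod_ring alg_closure) = p" unfolding pc by (rule CHAR_ac)
  qed fact+
  obtain A q where Aq: "finite A \<and> (\<forall>a\<in>A. (\<forall>i. i \<notin> J \<longrightarrow> a i = 0) \<and> (\<Sum>i\<in>J. a i) \<le> N) \<and>
     (\<forall>x. F x = (\<Sum>a\<in>A. q a * (\<Prod>i\<in>J. x i ^ a i)))" using F unfolding polyfun_def by (elim exE)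
  then have A: "finite A" "\<And>a. a \<in> A \<Longrightarrow> (\<forall>i. i \<notin> J \<longrightarrow> a i = 0) \<and> (\<Sum>i\<in>J. a i) \<le> N"
    and Fx: "\<And>x. F x = (\<Sum>a\<in>A. q a * (\<Prod>i\<in>J. x i ^ a i))" by auto
  have Qe: "Q = (\<Sum>a\<in>A. smult (q a) (\<Prod>j\<in>J. lamp p T (z j) ^ a j))"
    by (rule poly_eqI_infinite[OF infinite_alg_closed]) (simp add: Q Fx poly_sum poly_prod)
  define h where "h = (\<lambda>(a :: 'i \<Rightarrow> nat) j. red (a j))"
  \<comment> \<open>Different exponent vectors may coincide after reduction; their coefficients are
    added.\<close>
  define q' where "q' = (\<lambda>b. \<Sum>a\<in>{a\<in>A. h a = b}. q a)"
  have regroup: "(\<Sum>a\<in>A. q a * G (h a)) = (\<Sum>b\<in>h ` A. q' b * G b)" for G :: "('i \<Rightarrow> nat) \<Rightarrow> 'q mod_ring alg_closure"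
  proof -
    have "(\<Sum>a\<in>A. q a * G (h a)) = (\<Sum>b\<in>h ` A. \<Sum>a\<in>{a\<in>A. h a = b}. q a * G (h a))"
      using A(1) by (rule sum.image_gen)
    also have "\<dots> = (\<Sum>b\<in>h ` A. q' b * G b)"
      unfolding q'_def sum_distrib_right by (intro sum.cong) auto
    finally show ?thesis .
  qed
  have xred: "to_ac x ^ a = to_ac x ^ red a" for x :: "'q mod_ring" and a
  proof (induction a rule: less_induct)
    case (less a)
    show ?case
    proof (cases "a < p")
      case False
      have "to_ac x ^ a = to_ac x ^ (a - p) * to_ac x ^ p" using False by (simp flip: power_add)
      also have "to_ac x ^ p = to_ac x" using to_ac_power_card[of x 1] by (simp add: pc)
      finally have "to_ac x ^ a = to_ac x ^ (a - p + 1)" by simp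
      also have "\<dots> = to_ac x ^ red (a - p + 1)" by (rule less) (use False p2 in auto)
      finally show ?thesis using red_step False by simp
    qed (simp add: red_small)
  qed
  have q'0: "q' b = 0" if "b \<in> h ` A" for b
  proof (rule mpoly_zero[OF J, of "h ` A" "range to_ac" q' b])
    have card: "card (range (to_ac :: 'q mod_ring \<Rightarrow> _)) = p" using inj_to_ac by (subst card_image) (simp_all add: pc)
    show "finite (h ` A)" using A(1) by simp
    show "b i = 0" if "b \<in> h ` A" "i \<notin> J" for b i using that A(2) by (auto simp: h_def red_def)
    show "b i < card (range (to_ac :: 'q mod_ring \<Rightarrow> _))" if "b \<in> h ` A" "i \<in> J" for b i
      using that red_less unfolding card by (auto simp: h_def)
    show "(\<Sum>b\<in>h ` A. q' b * (\<Prod>i\<in>J. x i ^ b i)) = 0" if x: "\<And>i. i \<in> J \<Longrightarrow> x i \<in> range to_ac" for x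
    proof -
      define x' where "x' = (\<lambda>i. of_ac (x i))"
      have x': "x i = to_ac (x' i)" if "i \<in> J" for i using to_ac_of_ac[OF x[OF that]] by (simp add: x'_def)
      have "(\<Sum>b\<in>h ` A. q' b * (\<Prod>i\<in>J. x i ^ b i)) = (\<Sum>a\<in>A. q a * (\<Prod>i\<in>J. x i ^ h a i))"
        by (rule regroup[symmetric])
      also have "\<dots> = (\<Sum>a\<in>A. q a * (\<Prod>i\<in>J. to_ac (x' i) ^ a i))"
        by (intro sum.cong arg_cong2[of _ _ _ _ "(*)"] prod.cong refl) (simp only: h_def x' xred[symmetric])
      also have "\<dots> = 0" using zero[of x'] Fx by simp
      finally show ?thesis .
    qed
  qed fact
  have "coeff Q E = (\<Sum>a\<in>A. q a * coeff (\<Prod>j\<in>J. lamp p T (z j) ^ a j) E)"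
    by (simp add: Qe coeff_sum)
  also have "\<dots> = (\<Sum>a\<in>A. q a * coeff (\<Prod>j\<in>J. lamp p T (z j) ^ h a j) E)"
  proof (intro sum.cong refl)
    fix a assume "a \<in> A"
    then have "0 + (\<Sum>j\<in>J. a j) \<le> k" using A(2) N by fastforce
    from coeff_red_prod[OF J dsupp_one[of p 0] this, of z]
    show "q a * coeff (\<Prod>j\<in>J. lamp p T (z j) ^ a j) E = q a * coeff (\<Prod>j\<in>J. lamp p T (z j) ^ h a j) E"
      by (simp add: h_def)
  qed
  also have "\<dots> = (\<Sum>b\<in>h ` A. q' b * coeff (\<Prod>j\<in>J. lamp p T (z j) ^ b j) E)" by (rule regroup)
  also have "\<dots> = 0" using q'0 by simp
  finally show ?thesis .
qed

subsection \<open>The top coefficient of the determinant of traces\<close>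

lemma coeff_mult_top:
  fixes A B :: "'r::comm_ring_1 poly"
  assumes "degree A \<le> a" "degree B \<le> b"
  shows "coeff (A * B) (a + b) = coeff A a * coeff B b"
proof -
  have "coeff (A * B) (a + b) = (\<Sum>i\<le>a + b. coeff A i * coeff B (a + b - i))" by (rule coeff_mult)
  also have "\<dots> = (\<Sum>i\<in>{a}. coeff A i * coeff B (a + b - i))"
  proof (rule sum.mono_neutral_right)
    show "\<forall>i\<in>{..a + b} - {a}. coeff A i * coeff B (a + b - i) = 0"
    proof
      fix i assume i: "i \<in> {..a + b} - {a}"
      show "coeff A i * coeff B (a + b - i) = 0"
      proof (cases "i > a")
        case True
        then have "coeff A i = 0" using assms(1) by (intro coeff_eq_0) simp
        then show ?thesis by simp
      next
        case False
        then have "coeff B (a + b - i) = 0" using assms(2) i by (intro coeff_eq_0) auto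
        then show ?thesis by simp
      qed
    qed
  qed auto
  finally show ?thesis by simp
qed

lemma coeff_power_top:
  fixes A :: "'r::comm_ring_1 poly"
  assumes "degree A \<le> d"
  shows "degree (A ^ m) \<le> m * d \<and> coeff (A ^ m) (m * d) = coeff A d ^ m"
proof (induction m)
  case (Suc m)
  have "degree (A * A ^ m) \<le> d + m * d" using degree_mult_le[of A "A ^ m"] assms Suc by linarith
  then show ?case using coeff_mult_top[OF assms, of "A ^ m" "m * d"] Suc by simp
qed simp

text \<open>Each index of M below k contributes less than p^k; equally many indices of the top block
  are missing from M, each worth at least p^k.\<close>

lemma sum_powers_top:
  assumes p: "(p::nat) \<ge> 2" and M: "M \<subseteq> {..<k + n}" "card M = n"
  shows "(\<Sum>m\<in>M. p ^ m) \<le> (\<Sum>m\<in>{k..<k+n}. p ^ m) \<and> ((\<Sum>m\<in>M. p ^ m) = (\<Sum>m\<in>{k..<k+n}. p ^ m) \<longrightarrow> M = {k..<k+n})"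
proof -
  let ?U = "{k..<k+n}"
  have fM: "finite M" using M(1) finite_subset by blast
  have c: "card (M - ?U) = card (?U - M)"
  proof -
    have "card M = card (M \<inter> ?U) + card (M - ?U)" using fM by (metis card_Int_Diff)
    moreover have "card ?U = card (?U \<inter> M) + card (?U - M)" by (rule card_Int_Diff) simp
    ultimately show ?thesis using M(2) by (simp add: Int_commute)
  qed
  have sM: "(\<Sum>m\<in>M. p ^ m) = (\<Sum>m\<in>M \<inter> ?U. p ^ m) + (\<Sum>m\<in>M - ?U. p ^ m)" using fM by (rule sum.Int_Diff)
  have sU: "(\<Sum>m\<in>?U. p ^ m) = (\<Sum>m\<in>M \<inter> ?U. p ^ m) + (\<Sum>m\<in>?U - M. p ^ m)"
    using sum.Int_Diff[of ?U "\<lambda>m. p ^ m" M] by (simp add: Int_commute)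
  show ?thesis
  proof (cases "M - ?U = {}")
    case True
    then have "M \<subseteq> ?U" by blast
    then have "M = ?U" using M(2) by (intro card_subset_eq) auto
    then show ?thesis by simp
  next
    case False
    have "(\<Sum>m\<in>M - ?U. p ^ m) < (\<Sum>m\<in>M - ?U. p ^ k)"
    proof (rule sum_strict_mono)
      show "p ^ m < p ^ k" if "m \<in> M - ?U" for m
        using that M(1) p by (intro power_strict_increasing) auto
    qed (use fM False in auto)
    also have "\<dots> = (\<Sum>m\<in>?U - M. p ^ k)" using c by simp
    also have "\<dots> \<le> (\<Sum>m\<in>?U - M. p ^ m)" using p by (intro sum_mono power_increasing) auto
    finally show ?thesis using sM sU by linarith
  qed
qed

lemma det_dmat: "det (dmat n z) = (\<Sum>\<sigma> | \<sigma> permutes {0..<n}. signof \<sigma> * (\<Prod>i\<in>{0..<n}. z i (\<sigma> i)))"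
  by (subst det_def'[OF dmat_carrier]) (auto simp: dmat_def intro!: sum.cong prod.cong dest: permutes_in_image)

lemma prod_monom: "(\<Prod>i\<in>I. Polynomial.monom (c i) (e i)) = Polynomial.monom (\<Prod>i\<in>I. c i :: 'r::comm_ring_1) (\<Sum>i\<in>I. e i)"
  by (induction I rule: infinite_finite_induct) (auto simp: mult_monom monom_0 one_pCons)

lemma smult_signof_monom: "signof \<sigma> * Polynomial.monom c e = Polynomial.monom (signof \<sigma> * (c :: 'r::comm_ring_1)) e"
  by (simp add: sign_def minus_monom)

text \<open>The choice function \<mu> records which summand of the trace is taken in each
  row.\<close>

lemma det_lamp:
  fixes b y :: "nat \<Rightarrow> 'r::comm_ring_1"
  shows "det (dmat n (\<lambda>i j. lamp p T (b i * y j))) =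
    (\<Sum>\<mu>\<in>PiE {0..<n} (\<lambda>_. {..<T}). Polynomial.monom ((\<Prod>i\<in>{0..<n}. b i ^ (p ^ \<mu> i)) * det (dmat n (\<lambda>i j. y j ^ (p ^ \<mu> i)))) (\<Sum>i\<in>{0..<n}. p ^ \<mu> i))"
proof -
  let ?P = "PiE {0..<n} (\<lambda>_. {..<T})"
  have "det (dmat n (\<lambda>i j. lamp p T (b i * y j))) =
    (\<Sum>\<sigma> | \<sigma> permutes {0..<n}. signof \<sigma> * (\<Sum>\<mu>\<in>?P. \<Prod>i\<in>{0..<n}. Polynomial.monom ((b i * y (\<sigma> i)) ^ (p ^ \<mu> i)) (p ^ \<mu> i)))"
    unfolding det_dmat lamp_def by (simp only: prod_sum_PiE[OF finite_atLeastLessThan finite_lessThan])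
  also have "\<dots> = (\<Sum>\<sigma> | \<sigma> permutes {0..<n}. \<Sum>\<mu>\<in>?P. Polynomial.monom (signof \<sigma> * (\<Prod>i\<in>{0..<n}. (b i * y (\<sigma> i)) ^ (p ^ \<mu> i))) (\<Sum>i\<in>{0..<n}. p ^ \<mu> i))"
    unfolding prod_monom sum_distrib_left smult_signof_monom ..
  also have "\<dots> = (\<Sum>\<mu>\<in>?P. \<Sum>\<sigma> | \<sigma> permutes {0..<n}. Polynomial.monom (signof \<sigma> * (\<Prod>i\<in>{0..<n}. (b i * y (\<sigma> i)) ^ (p ^ \<mu> i))) (\<Sum>i\<in>{0..<n}. p ^ \<mu> i))"
    by (rule sum.swap)
  also have "\<dots> = (\<Sum>\<mu>\<in>?P. Polynomial.monom ((\<Prod>i\<in>{0..<n}. b i ^ (p ^ \<mu> i)) * det (dmat n (\<lambda>i j. y j ^ (p ^ \<mu> i)))) (\<Sum>i\<in>{0..<n}. p ^ \<mu> i))"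
  proof (intro sum.cong refl)
    fix \<mu>
    have "(\<Prod>i\<in>{0..<n}. b i ^ (p ^ \<mu> i)) * det (dmat n (\<lambda>i j. y j ^ (p ^ \<mu> i))) =
      (\<Sum>\<sigma> | \<sigma> permutes {0..<n}. signof \<sigma> * (\<Prod>i\<in>{0..<n}. (b i * y (\<sigma> i)) ^ (p ^ \<mu> i)))"
      unfolding det_dmat sum_distrib_left by (intro sum.cong refl) (simp add: power_mult_distrib prod.distrib mult_ac)
    then show "(\<Sum>\<sigma> | \<sigma> permutes {0..<n}. Polynomial.monom (signof \<sigma> * (\<Prod>i\<in>{0..<n}. (b i * y (\<sigma> i)) ^ (p ^ \<mu> i))) (\<Sum>i\<in>{0..<n}. p ^ \<mu> i)) =
      Polynomial.monom ((\<Prod>i\<in>{0..<n}. b i ^ (p ^ \<mu> i)) * det (dmat n (\<lambda>i j. y j ^ (p ^ \<mu> i)))) (\<Sum>i\<in>{0..<n}. p ^ \<mu> i)"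
      by (simp add: monom_sum)
  qed
  finally show ?thesis .
qed

lemma det_dmat_identical:
  assumes "i < n" "j < n" "i \<noteq> j" "z i = z j"
  shows "det (dmat n z) = (0 :: 'r::comm_ring_1)"
  by (rule det_identical_rows[OF dmat_carrier assms(3,1,2)]) (use assms in \<open>auto simp: dmat_def row_def\<close>)

lemma det_dmat_permute:
  assumes "\<pi> permutes {0..<n}"
  shows "det (dmat n (\<lambda>i j. z (\<pi> i) j)) = signof \<pi> * (det (dmat n z) :: 'r::comm_ring_1)"
proof -
  have "dmat n (\<lambda>i j. z (\<pi> i) j) = mat n n (\<lambda>(i, j). dmat n z $$ (\<pi> i, j))"
    by (rule eq_matI) (use assms in \<open>auto simp: dmat_def dest: permutes_in_image\<close>)
  then show ?thesis using det_permute_rows[OF dmat_carrier[of n z] assms] by simp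
qed

text \<open>Equal Frobenius exponents give equal rows, so only injective \<mu> survive. Among these
  the sum of p^(\<mu> i) is largest exactly when \<mu> enumerates the top block, and the signed sum
  over such enumerations is a determinant in b times one in y.\<close>

lemma det_lamp_top:
  fixes b y :: "nat \<Rightarrow> 'r::comm_ring_1" and n k p :: nat
  assumes p: "p \<ge> 2"
  defines "q \<equiv> det (dmat n (\<lambda>i j. lamp p (k + n) (b i * y j)))"
  shows "degree q \<le> (\<Sum>m\<in>{k..<k+n}. p ^ m) \<and>
    coeff q (\<Sum>m\<in>{k..<k+n}. p ^ m) = det (dmat n (\<lambda>i l. b i ^ (p ^ (k + l)))) * det (dmat n (\<lambda>l j. y j ^ (p ^ (k + l))))"
proof -
  let ?P = "PiE {0..<n} (\<lambda>_. {..<k + n})" and ?e = "\<Sum>m\<in>{k..<k+n}. p ^ m"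
  define B where "B = (\<lambda>\<mu>. (\<Prod>i\<in>{0..<n}. b i ^ (p ^ \<mu> i)) * det (dmat n (\<lambda>i j. y j ^ (p ^ \<mu> i))))"
  define s where "s = (\<lambda>\<mu> :: nat \<Rightarrow> nat. \<Sum>i\<in>{0..<n}. p ^ \<mu> i)"
  have q: "q = (\<Sum>\<mu>\<in>?P. Polynomial.monom (B \<mu>) (s \<mu>))" unfolding q_def B_def s_def by (rule det_lamp)
  have inj: "inj_on \<mu> {0..<n}" if "B \<mu> \<noteq> 0" for \<mu>
  proof (rule ccontr)
    assume "\<not> inj_on \<mu> {0..<n}"
    then obtain i j where "i < n" "j < n" "i \<noteq> j" "\<mu> i = \<mu> j" by (auto simp: inj_on_def)
    then have "det (dmat n (\<lambda>i j. y j ^ (p ^ \<mu> i))) = 0" by (intro det_dmat_identical[of i n j]) auto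
    with that show False by (simp add: B_def)
  qed
  have img: "s \<mu> \<le> ?e \<and> (s \<mu> = ?e \<longrightarrow> \<mu> ` {0..<n} = {k..<k+n})" if "\<mu> \<in> ?P" "B \<mu> \<noteq> 0" for \<mu>
  proof -
    have "s \<mu> = (\<Sum>m\<in>\<mu> ` {0..<n}. p ^ m)" unfolding s_def using inj[OF that(2)] by (simp add: sum.reindex)
    moreover have "\<mu> ` {0..<n} \<subseteq> {..<k+n}" using that(1) by (auto simp: PiE_iff)
    moreover have "card (\<mu> ` {0..<n}) = n" using inj[OF that(2)] by (simp add: card_image)
    ultimately show ?thesis using sum_powers_top[OF p, of "\<mu> ` {0..<n}" k n] by simp
  qed
  have "degree q \<le> ?e"
    unfolding q
  proof (rule degree_sum_le)
    show "finite ?P" by (intro finite_PiE) auto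
    fix \<mu> assume \<mu>: "\<mu> \<in> ?P"
    show "degree (Polynomial.monom (B \<mu>) (s \<mu>)) \<le> ?e"
    proof (cases "B \<mu> = 0")
      case False
      then have "s \<mu> \<le> ?e" using img[OF \<mu>] by blast
      then show ?thesis using degree_monom_le[of "B \<mu>" "s \<mu>"] by linarith
    qed simp
  qed
  moreover have "coeff q ?e = det (dmat n (\<lambda>i l. b i ^ (p ^ (k + l)))) * det (dmat n (\<lambda>l j. y j ^ (p ^ (k + l))))"
  proof -
    \<comment> \<open>Enumerations of the top block {k..<k+n} correspond to permutations of the
      rows.\<close>
    define h where "h = (\<lambda>\<pi>. restrict (\<lambda>i. k + \<pi> i) {0..<n})"
    let ?S = "{\<pi>. \<pi> permutes {0..<n}}"
    have injh: "inj_on h ?S"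
    proof (rule inj_onI)
      fix \<pi> \<pi>' assume a: "\<pi> \<in> ?S" "\<pi>' \<in> ?S" "h \<pi> = h \<pi>'"
      show "\<pi> = \<pi>'"
      proof
        fix i
        show "\<pi> i = \<pi>' i"
        proof (cases "i < n")
          case True
          then show ?thesis using fun_cong[OF a(3), of i] by (simp add: h_def)
        next
          case False
          then show ?thesis using a(1,2) by (auto simp: permutes_def)
        qed
      qed
    qed
    have fP: "finite ?P" by (intro finite_PiE) auto
    have hP: "h ` ?S \<subseteq> ?P"
    proof (rule image_subsetI)
      fix \<pi> assume "\<pi> \<in> ?S"
      then have "\<pi> permutes {0..<n}" by simp
      then have "\<pi> i < n" if "i < n" for i using permutes_in_image[of \<pi> "{0..<n}" i] that by simp
      then show "h \<pi> \<in> ?P" by (simp add: h_def PiE_iff)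
    qed
    have "coeff q ?e = (\<Sum>\<mu>\<in>?P. if s \<mu> = ?e then B \<mu> else 0)" by (simp add: q coeff_sum)
    also have "\<dots> = (\<Sum>\<mu>\<in>h ` ?S. B \<mu>)"
    proof (rule sum.mono_neutral_cong_right[OF fP hP])
      show "\<forall>\<mu>\<in>?P - h ` ?S. (if s \<mu> = ?e then B \<mu> else 0) = 0"
      proof
        fix \<mu> assume \<mu>: "\<mu> \<in> ?P - h ` ?S"
        show "(if s \<mu> = ?e then B \<mu> else 0) = 0"
        proof (rule ccontr)
          assume "(if s \<mu> = ?e then B \<mu> else 0) \<noteq> 0"
          then have s: "s \<mu> = ?e" "B \<mu> \<noteq> 0" by (auto split: if_splits)
          then have im: "\<mu> ` {0..<n} = {k..<k+n}" using img \<mu> by blast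
          define \<pi> where "\<pi> = (\<lambda>i. if i < n then \<mu> i - k else i)"
          have ge: "\<mu> i \<ge> k \<and> \<mu> i < k + n" if "i < n" for i using im that by (metis atLeastLessThan_iff imageI zero_le)
          have "inj_on \<pi> {0..<n}"
          proof (rule inj_onI)
            fix i j assume ij: "i \<in> {0..<n}" "j \<in> {0..<n}" and eq: "\<pi> i = \<pi> j"
            then have "\<mu> i - k = \<mu> j - k" by (simp add: \<pi>_def)
            moreover have "k \<le> \<mu> i" "k \<le> \<mu> j" using ge ij by auto
            ultimately have "\<mu> i = \<mu> j" by linarith
            then show "i = j" using inj[OF s(2)] ij by (simp add: inj_on_def)
          qed
          moreover have "\<pi> ` {0..<n} \<subseteq> {0..<n}" using ge by (force simp: \<pi>_def)
          ultimately have "bij_betw \<pi> {0..<n} {0..<n}" by (simp add: bij_betw_def endo_inj_surj)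
          then have "\<pi> permutes {0..<n}" by (rule bij_imp_permutes) (simp add: \<pi>_def)
          moreover have "h \<pi> = \<mu>"
          proof
            fix i
            show "h \<pi> i = \<mu> i"
              using \<mu> ge[of i] by (cases "i < n") (auto simp: h_def \<pi>_def PiE_iff extensional_def)
          qed
          ultimately show False using \<mu> by blast
        qed
      qed
      show "(if s \<mu> = ?e then B \<mu> else 0) = B \<mu>" if "\<mu> \<in> h ` ?S" for \<mu>
      proof -
        from that obtain \<pi> where \<pi>: "\<pi> permutes {0..<n}" "\<mu> = h \<pi>" by blast
        have "s \<mu> = (\<Sum>i\<in>{0..<n}. p ^ (k + \<pi> i))" unfolding s_def \<pi>(2) h_def by (intro sum.cong) auto
        also have "\<dots> = (\<Sum>i\<in>{0..<n}. p ^ (k + i))" using sum.permute[OF \<pi>(1), of "\<lambda>i. p ^ (k + i)"] by (simp add: o_def)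
        also have "\<dots> = ?e" using sum.shift_bounds_nat_ivl[of "\<lambda>m. p ^ m" 0 k n] by (simp add: add.commute)
        finally show ?thesis by simp
      qed
    qed
    also have "\<dots> = (\<Sum>\<pi>\<in>?S. B (h \<pi>))" by (simp add: sum.reindex[OF injh])
    \<comment> \<open>Restoring the order of the rows in the y-determinant costs the sign of \<pi>,
      which is what turns the products of the b into a determinant.\<close>
    also have "\<dots> = (\<Sum>\<pi>\<in>?S. (signof \<pi> * (\<Prod>i\<in>{0..<n}. b i ^ (p ^ (k + \<pi> i)))) * det (dmat n (\<lambda>l j. y j ^ (p ^ (k + l)))))"
    proof (intro sum.cong refl)
      fix \<pi> assume "\<pi> \<in> ?S"
      then have \<pi>: "\<pi> permutes {0..<n}" by simp
      have "dmat n (\<lambda>i j. y j ^ (p ^ h \<pi> i)) = dmat n (\<lambda>i j. y j ^ (p ^ (k + \<pi> i)))"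
        by (intro dmat_cong) (simp add: h_def)
      moreover have "det (dmat n (\<lambda>i j. y j ^ (p ^ (k + \<pi> i)))) = signof \<pi> * det (dmat n (\<lambda>l j. y j ^ (p ^ (k + l))))"
        by (rule det_dmat_permute[OF \<pi>, of "\<lambda>l j. y j ^ (p ^ (k + l))"])
      moreover have "(\<Prod>i\<in>{0..<n}. b i ^ (p ^ h \<pi> i)) = (\<Prod>i\<in>{0..<n}. b i ^ (p ^ (k + \<pi> i)))"
        by (intro prod.cong) (auto simp: h_def)
      ultimately show "B (h \<pi>) = (signof \<pi> * (\<Prod>i\<in>{0..<n}. b i ^ (p ^ (k + \<pi> i)))) * det (dmat n (\<lambda>l j. y j ^ (p ^ (k + l))))"
        by (simp add: B_def mult_ac)
    qed
    also have "\<dots> = det (dmat n (\<lambda>i l. b i ^ (p ^ (k + l)))) * det (dmat n (\<lambda>l j. y j ^ (p ^ (k + l))))"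
      unfolding det_dmat[of n "\<lambda>i l. b i ^ (p ^ (k + l))"] sum_distrib_right ..
    finally show ?thesis .
  qed
  ultimately show ?thesis by blast
qed

section \<open>Iterated contractions and determinants\<close>

fun cont :: "nat \<Rightarrow> (nat \<Rightarrow> 'r::comm_ring_1) list \<Rightarrow> (nat set \<Rightarrow> 'r) \<Rightarrow> nat set \<Rightarrow> 'r" where
  "cont n [] \<omega> = \<omega>"
| "cont n (v # vs) \<omega> = cont n vs (iota n v \<omega>)"

lemma cont_append: "cont n (us @ vs) \<omega> = cont n vs (cont n us \<omega>)"
  by (induction us arbitrary: \<omega>) auto

lemma cont_scale: "cont n vs (\<lambda>S. c * \<omega> S) T = c * cont n vs \<omega> T"
proof (induction vs arbitrary: \<omega> T)
  case (Cons v vs)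
  have "iota n v (\<lambda>S. c * \<omega> S) = (\<lambda>T. c * iota n v \<omega> T)" by (rule ext) (rule iota_scale)
  then show ?case using Cons by simp
qed simp

lemma cont_zero: "cont n vs (\<lambda>S. 0) T = 0"
  using cont_scale[of n vs 0 "\<lambda>_. 0" T] by simp

lemma cont_swap: "cont n (as @ [x, y] @ bs) \<omega> T = - cont n (as @ [y, x] @ bs) \<omega> T"
proof -
  define \<omega>' where "\<omega>' = cont n as \<omega>"
  have e: "iota n y (iota n x \<omega>') = (\<lambda>S. (-1) * iota n x (iota n y \<omega>') S)" by (rule ext) (simp add: iota_anticomm[of n y x])
  have "cont n (as @ [x, y] @ bs) \<omega> T = cont n bs (\<lambda>S. (-1) * iota n x (iota n y \<omega>') S) T"
    unfolding cont_append cont.simps \<omega>'_def[symmetric] e ..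
  also have "\<dots> = (-1) * cont n bs (iota n x (iota n y \<omega>')) T" by (rule cont_scale)
  also have "cont n bs (iota n x (iota n y \<omega>')) T = cont n (as @ [y, x] @ bs) \<omega> T"
    unfolding cont_append cont.simps \<omega>'_def ..
  finally show ?thesis by simp
qed

lemma cont_move: "cont n (as @ [x] @ ys @ bs) \<omega> T = (-1) ^ length ys * cont n (as @ ys @ [x] @ bs) \<omega> T"
proof (induction ys arbitrary: as)
  case (Cons y ys)
  have "cont n (as @ [x] @ (y # ys) @ bs) \<omega> T = cont n (as @ [x, y] @ (ys @ bs)) \<omega> T" by simp
  also have "\<dots> = - cont n ((as @ [y]) @ [x] @ ys @ bs) \<omega> T" by (subst cont_swap) simp
  also have "\<dots> = - ((-1) ^ length ys * cont n ((as @ [y]) @ ys @ [x] @ bs) \<omega> T)" by (subst Cons.IH) simp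
  finally show ?case by simp
qed simp

lemma cont_repeat: "cont n (as @ [x] @ ys @ [x] @ bs) \<omega> T = 0"
proof -
  define \<omega>' where "\<omega>' = cont n (as @ ys) \<omega>"
  have "iota n x (iota n x \<omega>') = (\<lambda>_. 0)" by (rule ext) (rule iota_self)
  then have "cont n (as @ ys @ [x] @ [x] @ bs) \<omega> T = 0"
    unfolding append_assoc[symmetric] cont_append \<omega>'_def[symmetric, unfolded cont_append] by (simp add: cont_append cont_zero)
  then show ?thesis using cont_move[of n as x ys "[x] @ bs" \<omega> T] by simp
qed

lemma cont_exchange: "cont n (as @ [x] @ ys @ [y] @ bs) \<omega> T = - cont n (as @ [y] @ ys @ [x] @ bs) \<omega> T"
proof -
  have "cont n (as @ [x] @ ys @ [y] @ bs) \<omega> T = (-1) ^ length ys * cont n ((as @ ys) @ [x, y] @ bs) \<omega> T"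
    using cont_move[of n as x ys "[y] @ bs" \<omega> T] by simp
  also have "\<dots> = - ((-1) ^ length ys * cont n ((as @ ys) @ [y, x] @ bs) \<omega> T)" by (subst cont_swap) simp
  also have "(-1) ^ length ys * cont n ((as @ ys) @ [y, x] @ bs) \<omega> T = cont n (as @ [y] @ ys @ [x] @ bs) \<omega> T"
    using cont_move[of n as y ys "[x] @ bs" \<omega> T] by simp
  finally show ?thesis .
qed

definition unitv :: "nat \<Rightarrow> nat \<Rightarrow> 'r::comm_ring_1" where
  "unitv j = (\<lambda>i. if i = j then 1 else 0)"

lemma iota_unitv: "j < n \<Longrightarrow> iota n (unitv j) \<omega> T = (if j \<in> T then 0 else sg T j * \<omega> (insert j T))"
proof -
  assume j: "j < n"
  have "iota n (unitv j) \<omega> T = (\<Sum>i<n. if i = j then (if j \<in> T then 0 else sg T j * \<omega> (insert j T)) else 0)"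
    unfolding iota_def unitv_def by (intro sum.cong) auto
  then show ?thesis using j by simp
qed

lemma iota_expand: "iota n v \<omega> T = (\<Sum>j<n. v j * iota n (unitv j) \<omega> T)"
proof -
  have "iota n (\<lambda>i. \<Sum>j<n. v j * unitv j i) \<omega> T = (\<Sum>j<n. v j * iota n (unitv j) \<omega> T)"
    unfolding iota_vsum iota_vscale ..
  moreover have "iota n v \<omega> T = iota n (\<lambda>i. \<Sum>j<n. v j * unitv j i) \<omega> T"
  proof (rule iota_cong)
    fix i assume "i < n"
    have "(\<Sum>j<n. v j * unitv j i) = (\<Sum>j<n. if j = i then v j else 0)"
      by (intro sum.cong) (auto simp: unitv_def)
    then show "v i = (\<Sum>j<n. v j * unitv j i)" using \<open>i < n\<close> by simp
  qed
  ultimately show ?thesis by simp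
qed

lemma cont_expand:
  "cont n (map v [0..<m]) \<omega> T = (\<Sum>f\<in>PiE {0..<m} (\<lambda>_. {..<n}). (\<Prod>a\<in>{0..<m}. v a (f a)) * cont n (map (\<lambda>a. unitv (f a)) [0..<m]) \<omega> T)"
proof (induction m arbitrary: T)
  case (Suc m)
  let ?P = "\<lambda>m. PiE {0..<m} (\<lambda>_. {..<n})"
  let ?C = "\<lambda>f m. cont n (map (\<lambda>a. unitv (f a)) [0..<m]) \<omega>"
  have IH: "cont n (map v [0..<m]) \<omega> = (\<lambda>T. \<Sum>f\<in>?P m. (\<Prod>a\<in>{0..<m}. v a (f a)) * ?C f m T)"
    by (rule ext) (rule Suc.IH)
  have "cont n (map v [0..<Suc m]) \<omega> T = iota n (v m) (cont n (map v [0..<m]) \<omega>) T"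
    by (simp add: cont_append)
  also have "\<dots> = (\<Sum>j<n. \<Sum>f\<in>?P m. v m j * ((\<Prod>a\<in>{0..<m}. v a (f a)) * iota n (unitv j) (?C f m) T))"
    unfolding IH iota_sum iota_scale iota_expand[of n "v m"] sum_distrib_left
    by (subst sum.swap, intro sum.cong refl, rule mult.left_commute)
  also have "\<dots> = (\<Sum>(j, f)\<in>{..<n} \<times> ?P m. v m j * ((\<Prod>a\<in>{0..<m}. v a (f a)) * iota n (unitv j) (?C f m) T))"
    by (rule sum.cartesian_product)
  also have "\<dots> = (\<Sum>f\<in>?P (Suc m). (\<Prod>a\<in>{0..<Suc m}. v a (f a)) * ?C f (Suc m) T)"
  proof -
    have inj: "inj_on (\<lambda>(j, f). f(m := j)) ({..<n} \<times> ?P m)"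
      using inj_combinator[of m "{0..<m}" "\<lambda>_. {..<n}"] by simp
    have im: "?P (Suc m) = (\<lambda>(j, f). f(m := j)) ` ({..<n} \<times> ?P m)"
      using PiE_insert_eq[of m "{0..<m}" "\<lambda>_. {..<n}"] by (simp add: atLeast0_lessThan_Suc)
    show ?thesis unfolding im
    proof (subst sum.reindex[OF inj], intro sum.cong refl)
      fix z assume "z \<in> {..<n} \<times> ?P m"
      obtain j f where z: "z = (j, f)" by (cases z)
      have 1: "(\<Prod>a\<in>{0..<Suc m}. v a ((f(m := j)) a)) = (\<Prod>a\<in>{0..<m}. v a (f a)) * v m j"
      proof -
        have "(\<Prod>a\<in>{0..<m}. v a ((f(m := j)) a)) = (\<Prod>a\<in>{0..<m}. v a (f a))" by (intro prod.cong) auto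
        then show ?thesis by simp
      qed
      have meq: "map (\<lambda>a. unitv ((f(m := j)) a)) [0..<m] = map (\<lambda>a. unitv (f a)) [0..<m]" by simp
      have "?C (f(m := j)) (Suc m) T = iota n (unitv ((f(m := j)) m)) (?C (f(m := j)) m) T"
        by (simp add: cont_append del: fun_upd_apply)
      then have 2: "?C (f(m := j)) (Suc m) T = iota n (unitv j) (?C f m) T"
        unfolding meq fun_upd_same .
      show "(case z of (j, f) \<Rightarrow> v m j * ((\<Prod>a\<in>{0..<m}. v a (f a)) * iota n (unitv j) (?C f m) T)) =
        ((\<lambda>f. (\<Prod>a\<in>{0..<Suc m}. v a (f a)) * ?C f (Suc m) T) \<circ> (\<lambda>(j, f). f(m := j))) z"
        unfolding z o_def prod.case 1 2 by (simp add: mult_ac)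
    qed
  qed
  finally show ?case .
qed simp

text \<open>A sign depending on n only, left uncomputed: it is cancelled by means of its square
  being 1.\<close>

definition kap :: "nat \<Rightarrow> 'r::comm_ring_1" where
  "kap n = cont n (map unitv [0..<n]) (delta {..<n}) {}"

text \<open>Contracting the top form with the first m unit vectors leaves, up to sign, the form on
  the remaining indices.\<close>

lemma kap_unit: "kap n * kap n = (1 :: 'r::comm_ring_1)"
proof -
  have "\<exists>s :: 'r. s * s = 1 \<and> (\<forall>T. T \<subseteq> {..<n} \<longrightarrow> cont n (map unitv [0..<m]) (delta {..<n}) T = (if T = {m..<n} then s else 0))" if "m \<le> n" for m
    using that
  proof (induction m)
    case 0
    have "{..<n} = {0..<n}" by auto
    then show ?case by (intro exI[of _ 1]) (auto simp: delta_def)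
  next
    case (Suc m)
    then obtain s :: 'r where s: "s * s = 1" "\<And>T. T \<subseteq> {..<n} \<Longrightarrow> cont n (map unitv [0..<m]) (delta {..<n}) T = (if T = {m..<n} then s else 0)"
      by auto
    have mn: "m < n" using Suc.prems by simp
    have "cont n (map unitv [0..<Suc m]) (delta {..<n}) T = (if T = {Suc m..<n} then sg {Suc m..<n} m * s else 0)" if T: "T \<subseteq> {..<n}" for T
    proof -
      have "insert m T \<subseteq> {..<n}" using T mn by auto
      moreover have "(m \<notin> T \<and> insert m T = {m..<n}) \<longleftrightarrow> T = {Suc m..<n}"
      proof -
        have e: "{m..<n} = insert m {Suc m..<n}" using mn by auto
        show ?thesis unfolding e using insert_ident[of m T "{Suc m..<n}"] by auto
      qed
      ultimately show ?thesis using mn by (auto simp: cont_append iota_unitv s(2))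
    qed
    moreover have "sg {Suc m..<n} m * s * (sg {Suc m..<n} m * s) = 1" using s(1) by (simp add: mult_ac)
    ultimately show ?case by (intro exI[of _ "sg {Suc m..<n} m * s"]) auto
  qed
  from this[of n] obtain s :: 'r where "s * s = 1" "\<And>T. T \<subseteq> {..<n} \<Longrightarrow> cont n (map unitv [0..<n]) (delta {..<n}) T = (if T = {n..<n} then s else 0)" by auto
  then show ?thesis by (simp add: kap_def)
qed

text \<open>Permutations are built from transpositions, and exchanging two vectors of the list
  reverses the sign.\<close>

lemma cont_units_permute:
  assumes "\<sigma> permutes {0..<n}"
  shows "cont n (map (\<lambda>a. unitv (\<sigma> a)) [0..<n]) \<omega> T = signof \<sigma> * cont n (map unitv [0..<n]) \<omega> T"
proof (rule permutes_rev_induct[OF _ assms])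
  show "finite {0..<n}" by simp
  show "cont n (map (\<lambda>a. unitv (id a)) [0..<n]) \<omega> T = signof id * cont n (map unitv [0..<n]) \<omega> T" by simp
  fix a b \<tau> assume ab: "a \<in> {0..<n}" "b \<in> {0..<n}" "a \<noteq> b" and IH: "cont n (map (\<lambda>a. unitv (\<tau> a)) [0..<n]) \<omega> T = signof \<tau> * cont n (map unitv [0..<n]) \<omega> T"
    and \<tau>: "\<tau> permutes {0..<n}"
  have ex: "cont n (map (\<lambda>i. h ((\<tau> \<circ> Transposition.transpose a b) i)) [0..<n]) \<omega> T = - cont n (map (\<lambda>i. h (\<tau> i)) [0..<n]) \<omega> T"
    if "a < b" "b < n" for a b and h :: "nat \<Rightarrow> nat \<Rightarrow> 'a"
  proof -
    have "[0..<n] = [0..<a] @ [a..<n]" using upt_add_eq_append[of 0 a "n - a"] that by simp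
    also have "[a..<n] = a # [Suc a..<n]" using that by (intro upt_conv_Cons) simp
    also have "[Suc a..<n] = [Suc a..<b] @ [b..<n]" using upt_add_eq_append[of "Suc a" b "n - b"] that by simp
    also have "[b..<n] = b # [Suc b..<n]" using that by (intro upt_conv_Cons) simp
    finally have l: "[0..<n] = [0..<a] @ [a] @ [Suc a..<b] @ [b] @ [Suc b..<n]" by simp
    let ?F = "\<lambda>i. h ((\<tau> \<circ> Transposition.transpose a b) i)" and ?G = "\<lambda>i. h (\<tau> i)"
    have m: "map ?F xs = map ?G xs" if "a \<notin> set xs" "b \<notin> set xs" for xs
      using that by (intro map_cong) (auto simp: Transposition.transpose_def)
    have m1: "map ?F [0..<a] = map ?G [0..<a]" by (rule m) (use that in auto)
    have m2: "map ?F [Suc a..<b] = map ?G [Suc a..<b]" by (rule m) auto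
    have m3: "map ?F [Suc b..<n] = map ?G [Suc b..<n]" by (rule m) (use that in auto)
    have Fab: "?F a = ?G b" "?F b = ?G a" by simp_all
    have "map ?F [0..<n] = map ?G [0..<a] @ [?G b] @ map ?G [Suc a..<b] @ [?G a] @ map ?G [Suc b..<n]"
      unfolding l map_append m1 m2 m3 list.map Fab ..
    moreover have "map ?G [0..<n] = map ?G [0..<a] @ [?G a] @ map ?G [Suc a..<b] @ [?G b] @ map ?G [Suc b..<n]"
      unfolding l map_append list.map ..
    ultimately show ?thesis by (simp only: cont_exchange[of n _ "?G b" _ "?G a"])
  qed
  have s: "signof (\<tau> \<circ> Transposition.transpose a b) = - (signof \<tau> :: 'a)"
    using ab \<tau> by (subst sign_compose) (auto simp: permutation_swap_id sign_swap_id intro: permutes_imp_permutation[of "{0..<n}"])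
  have "cont n (map (\<lambda>i. unitv ((\<tau> \<circ> Transposition.transpose a b) i)) [0..<n]) \<omega> T = - cont n (map (\<lambda>i. unitv (\<tau> i)) [0..<n]) \<omega> T"
  proof (cases "a < b")
    case True
    then show ?thesis using ab by (intro ex) auto
  next
    case False
    then have "b < a" using ab by simp
    then show ?thesis using ab ex[of b a unitv] by (simp add: transpose_commute)
  qed
  then show "cont n (map (\<lambda>i. unitv ((\<tau> \<circ> Transposition.transpose a b) i)) [0..<n]) \<omega> T = signof (\<tau> \<circ> Transposition.transpose a b) * cont n (map unitv [0..<n]) \<omega> T"
    unfolding s IH by simp
qed

lemma cont_cong:
  assumes "\<And>S. S \<subseteq> {..<n} \<Longrightarrow> card S = card T + length vs \<Longrightarrow> \<omega> S = \<omega>' S" "T \<subseteq> {..<n}"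
  shows "cont n vs \<omega> T = cont n vs \<omega>' T"
  using assms
proof (induction vs arbitrary: \<omega> \<omega>' T)
  case (Cons v vs)
  show ?case unfolding cont.simps
  proof (rule Cons.IH[OF _ Cons.prems(2)])
    fix S assume S: "S \<subseteq> {..<n}" "card S = card T + length vs"
    have fS: "finite S" using S(1) finite_subset by blast
    show "iota n v \<omega> S = iota n v \<omega>' S"
      unfolding iota_def
    proof (intro sum.cong refl)
      fix j assume j: "j \<in> {..<n}"
      have "\<omega> (insert j S) = \<omega>' (insert j S)" if "j \<notin> S"
        by (rule Cons.prems(1)) (use S j that fS in auto)
      then show "(if j \<in> S then 0 else sg S j * v j * \<omega> (insert j S)) = (if j \<in> S then 0 else sg S j * v j * \<omega>' (insert j S))" by simp
    qed
  qed
qed simp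

text \<open>n contractions see only the top coefficient, and the result is multilinear and
  alternating in the vectors. Hence it is a multiple of the determinant, normalised by the value
  \<open>kap n\<close> at the unit vectors.\<close>

lemma cont_full:
  "cont n (map v [0..<n]) \<omega> {} = kap n * det (dmat n v) * \<omega> {..<n}"
proof -
  have "cont n (map v [0..<n]) \<omega> {} = cont n (map v [0..<n]) (\<lambda>S. \<omega> {..<n} * delta {..<n} S) {}"
  proof (rule cont_cong)
    fix S assume S: "S \<subseteq> {..<n}" "card S = card {} + length (map v [0..<n])"
    then have "S = {..<n}" by (intro card_subset_eq) auto
    then show "\<omega> S = \<omega> {..<n} * delta {..<n} S" by (simp add: delta_def)
  qed simp
  also have "\<dots> = \<omega> {..<n} * cont n (map v [0..<n]) (delta {..<n}) {}" by (rule cont_scale)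
  also have "cont n (map v [0..<n]) (delta {..<n}) {} = (\<Sum>f\<in>PiE {0..<n} (\<lambda>_. {..<n}). (\<Prod>a\<in>{0..<n}. v a (f a)) * cont n (map (\<lambda>a. unitv (f a)) [0..<n]) (delta {..<n}) {})"
    by (rule cont_expand)
  also have "\<dots> = (\<Sum>f\<in>(\<lambda>\<sigma>. restrict \<sigma> {0..<n}) ` {\<sigma>. \<sigma> permutes {0..<n}}. (\<Prod>a\<in>{0..<n}. v a (f a)) * cont n (map (\<lambda>a. unitv (f a)) [0..<n]) (delta {..<n}) {})"
  proof (rule sum.mono_neutral_right)
    show "finite (PiE {0..<n} (\<lambda>_. {..<n}))" by (intro finite_PiE) auto
    show "(\<lambda>\<sigma>. restrict \<sigma> {0..<n}) ` {\<sigma>. \<sigma> permutes {0..<n}} \<subseteq> PiE {0..<n} (\<lambda>_. {..<n})"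
    proof (rule image_subsetI)
      fix \<sigma> assume "\<sigma> \<in> {\<sigma>. \<sigma> permutes {0..<n}}"
      then have "\<sigma> i < n" if "i < n" for i using permutes_in_image[of \<sigma> "{0..<n}" i] that by simp
      then show "restrict \<sigma> {0..<n} \<in> PiE {0..<n} (\<lambda>_. {..<n})" by (simp add: PiE_iff)
    qed
    show "\<forall>f\<in>PiE {0..<n} (\<lambda>_. {..<n}) - (\<lambda>\<sigma>. restrict \<sigma> {0..<n}) ` {\<sigma>. \<sigma> permutes {0..<n}}.
      (\<Prod>a\<in>{0..<n}. v a (f a)) * cont n (map (\<lambda>a. unitv (f a)) [0..<n]) (delta {..<n}) {} = 0"
    proof
      fix f assume f: "f \<in> PiE {0..<n} (\<lambda>_. {..<n}) - (\<lambda>\<sigma>. restrict \<sigma> {0..<n}) ` {\<sigma>. \<sigma> permutes {0..<n}}"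
      have "\<not> inj_on f {0..<n}"
      proof
        assume inj: "inj_on f {0..<n}"
        define \<sigma> where "\<sigma> = (\<lambda>i. if i < n then f i else i)"
        have "inj_on \<sigma> {0..<n}" using inj by (simp add: inj_on_def \<sigma>_def)
        moreover have "\<sigma> ` {0..<n} \<subseteq> {0..<n}" using f by (auto simp: \<sigma>_def PiE_iff)
        ultimately have "bij_betw \<sigma> {0..<n} {0..<n}" by (simp add: bij_betw_def endo_inj_surj)
        then have "\<sigma> permutes {0..<n}" by (rule bij_imp_permutes) (simp add: \<sigma>_def)
        moreover have "restrict \<sigma> {0..<n} = f"
        proof
          fix i show "restrict \<sigma> {0..<n} i = f i"
            using f by (cases "i < n") (auto simp: \<sigma>_def PiE_iff extensional_def)
        qed
        ultimately show False using f by blast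
      qed
      then have "\<not> distinct (map f [0..<n])" by (simp add: distinct_map)
      \<comment> \<open>A choice that is not injective contracts twice with the same unit
        vector.\<close>
      then obtain as x ys bs where l: "map f [0..<n] = as @ [x] @ ys @ [x] @ bs" using not_distinct_decomp by blast
      have "(map (\<lambda>a. unitv (f a)) [0..<n] :: (nat \<Rightarrow> 'a) list) = map unitv (map f [0..<n])" by simp
      also have "\<dots> = map unitv as @ [unitv x] @ map unitv ys @ [unitv x] @ map unitv bs" unfolding l by simp
      finally have "cont n (map (\<lambda>a. unitv (f a)) [0..<n]) (delta {..<n}) {} = (0 :: 'a)"
        by (simp only: cont_repeat)
      then show "(\<Prod>a\<in>{0..<n}. v a (f a)) * cont n (map (\<lambda>a. unitv (f a)) [0..<n]) (delta {..<n}) {} = 0" by simp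
    qed
  qed
  also have "\<dots> = (\<Sum>\<sigma> | \<sigma> permutes {0..<n}. (\<Prod>a\<in>{0..<n}. v a (\<sigma> a)) * (signof \<sigma> * kap n))"
  proof -
    have inj: "inj_on (\<lambda>\<sigma>. restrict \<sigma> {0..<n}) {\<sigma>. \<sigma> permutes {0..<n}}"
    proof (rule inj_onI)
      fix \<pi> \<pi>' assume a: "\<pi> \<in> {\<sigma>. \<sigma> permutes {0..<n}}" "\<pi>' \<in> {\<sigma>. \<sigma> permutes {0..<n}}" "restrict \<pi> {0..<n} = restrict \<pi>' {0..<n}"
      show "\<pi> = \<pi>'"
      proof
        fix i
        show "\<pi> i = \<pi>' i"
        proof (cases "i < n")
          case True
          then show ?thesis using fun_cong[OF a(3), of i] by simp
        next
          case False
          then show ?thesis using a(1,2) by (auto simp: permutes_def)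
        qed
      qed
    qed
    show ?thesis
    proof (subst sum.reindex[OF inj], intro sum.cong refl)
      fix \<sigma> assume "\<sigma> \<in> {\<sigma>. \<sigma> permutes {0..<n}}"
      then have \<sigma>: "\<sigma> permutes {0..<n}" by simp
      have m: "map (\<lambda>a. unitv (restrict \<sigma> {0..<n} a)) [0..<n] = map (\<lambda>a. unitv (\<sigma> a)) [0..<n]" by simp
      have pr: "(\<Prod>a\<in>{0..<n}. v a (restrict \<sigma> {0..<n} a)) = (\<Prod>a\<in>{0..<n}. v a (\<sigma> a))" by (intro prod.cong) auto
      show "((\<lambda>f. (\<Prod>a\<in>{0..<n}. v a (f a)) * cont n (map (\<lambda>a. unitv (f a)) [0..<n]) (delta {..<n}) {}) \<circ> (\<lambda>\<sigma>. restrict \<sigma> {0..<n})) \<sigma> =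
        (\<Prod>a\<in>{0..<n}. v a (\<sigma> a)) * (signof \<sigma> * kap n)"
        unfolding o_def m pr cont_units_permute[OF \<sigma>] kap_def ..
    qed
  qed
  also have "\<dots> = kap n * det (dmat n v)"
    unfolding det_dmat sum_distrib_left by (intro sum.cong refl) (simp add: mult_ac)
  finally show ?thesis by (simp add: mult_ac)
qed

lemma cont_Lam: "cont n vs (Lam n A \<omega>) T = Lam n A (cont n (map (tr n A) vs) \<omega>) T"
proof (induction vs arbitrary: \<omega>)
  case (Cons v vs)
  have "iota n v (Lam n A \<omega>) = Lam n A (iota n (tr n A v) \<omega>)" by (rule ext) (rule iota_Lam)
  then show ?case using Cons by simp
qed simp

lemma det_unitv: "det (dmat n unitv) = (1 :: 'r::comm_ring_1)"
proof -
  have "dmat n unitv = (1\<^sub>m n :: 'r mat)" unfolding dmat_one[symmetric] by (intro dmat_cong) (simp add: unitv_def)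
  then show ?thesis by simp
qed

text \<open>The image of the top form is measured by complete contraction with the unit vectors.
  Naturality replaces these by the rows of A, so \<open>cont_full\<close> supplies the determinant
  without an expansion of \<open>lam\<close>.\<close>

lemma Lam_full:
  fixes A :: "nat \<Rightarrow> nat \<Rightarrow> 'r::comm_ring_1"
  shows "Lam n A (delta {..<n}) S = det (dmat n A) * delta {..<n} S"
proof -
  have L: "Lam n A (delta {..<n}) S = lam n A {..<n} S"
  proof -
    have "Lam n A (delta {..<n}) S = (\<Sum>S'\<in>Pow {..<n}. if S' = {..<n} then lam n A S' S else 0)"
      unfolding Lam_def by (intro sum.cong) (auto simp: delta_def)
    also have "\<dots> = lam n A {..<n} S" by (subst sum.delta) auto
    finally show ?thesis .
  qed
  show ?thesis
  proof (cases "S = {..<n}")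
    case False
    have "lam n A {..<n} S = 0"
    proof (rule ccontr)
      assume "lam n A {..<n} S \<noteq> 0"
      then have "S \<subseteq> {..<n} \<and> card S = card {..<n}" by (intro lam_supp[of "{..<n}" n A]) auto
      then have "S = {..<n}" by (intro card_subset_eq) auto
      with False show False by simp
    qed
    with False L show ?thesis by (auto simp: delta_def)
  next
    case True
    have "kap n * Lam n A (delta {..<n}) {..<n} = cont n (map unitv [0..<n]) (Lam n A (delta {..<n})) {}"
      using cont_full[of n unitv "Lam n A (delta {..<n})"] by (simp add: det_unitv)
    also have "\<dots> = cont n (map (tr n A) (map unitv [0..<n])) (delta {..<n}) {}"
      unfolding cont_Lam Lam_empty ..
    also have "map (tr n A) (map unitv [0..<n]) = map (\<lambda>a. tr n A (unitv a)) [0..<n]" by simp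
    also have "cont n (map (\<lambda>a. tr n A (unitv a)) [0..<n]) (delta {..<n}) {} = kap n * det (dmat n (\<lambda>a. tr n A (unitv a)))"
      by (subst cont_full) (simp add: delta_def)
    also have "dmat n (\<lambda>a. tr n A (unitv a)) = dmat n A"
    proof (rule dmat_cong)
      fix a i assume a: "a < n"
      have "(\<Sum>j<n. A j i * unitv a j) = (\<Sum>j<n. if j = a then A j i else 0)"
        by (intro sum.cong) (auto simp: unitv_def)
      then show "tr n A (unitv a) i = A a i" using a by (simp add: tr_def)
    qed
    finally have "kap n * (kap n * Lam n A (delta {..<n}) {..<n}) = kap n * (kap n * det (dmat n A))" by simp
    then have "Lam n A (delta {..<n}) {..<n} = det (dmat n A)" unfolding mult.assoc[symmetric] kap_unit by simp
    with True show ?thesis by (simp add: delta_def)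
  qed
qed

section \<open>The bottom class\<close>

text \<open>A Moore determinant: the value of L_n at the point y.\<close>

abbreviation Ly :: "nat \<Rightarrow> nat \<Rightarrow> (nat \<Rightarrow> 'r::comm_ring_1) \<Rightarrow> 'r" where
  "Ly n p y \<equiv> det (dmat n (\<lambda>i j. y j ^ (p ^ i)))"

lemma Ln_mono_ok: "mono_ok n ({}, \<lambda>j. if j < n then e j else 0)" by (simp add: mono_ok_def)

lemma Ln_Hp: "(Ln n p :: 'k::comm_ring_1 elt) \<in> Hp n"
proof -
  let ?F = "\<lambda>\<sigma>. single ({}, \<lambda>j. if j < n then p ^ (Hilbert_Choice.inv \<sigma> j) else 0) (of_int (sign \<sigma>)) :: 'k elt"
  have fin: "finite {\<sigma>. \<sigma> permutes {..<n}}" by (rule finite_permutations) simp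
  have "(Ln n p :: 'k elt) \<in> H n"
    unfolding Ln_def using fin by (intro H_sum1 H_single Ln_mono_ok)
  moreover have "fst m = {}" if "m \<in> supp (Ln n p :: 'k elt)" for m
  proof -
    have "m \<in> (\<Union>\<sigma>\<in>{\<sigma>. \<sigma> permutes {..<n}}. supp (?F \<sigma>))"
      using that unfolding Ln_def by (rule supp_sum1[THEN subsetD])
    then show ?thesis by (auto dest!: supp_single[THEN subsetD])
  qed
  ultimately show ?thesis by (simp add: Hp_def)
qed

lemma ev_Ln: "ev n (Ln n p) y {} = Ly n p y"
proof -
  have fin: "finite {\<sigma>. \<sigma> permutes {..<n}}" by (rule finite_permutations) simp
  have "ev n (Ln n p) y {} = (\<Sum>\<sigma> | \<sigma> permutes {..<n}. ev n (single ({}, \<lambda>j. if j < n then p ^ (Hilbert_Choice.inv \<sigma> j) else 0) (of_int (sign \<sigma>))) y {})"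
    unfolding Ln_def using fin by (intro ev_sum1) auto
  also have "\<dots> = (\<Sum>\<sigma> | \<sigma> permutes {0..<n}. signof \<sigma> * (\<Prod>i\<in>{0..<n}. y (\<sigma> i) ^ (p ^ i)))"
    unfolding atLeast0LessThan
  proof (intro sum.cong refl)
    fix \<sigma> assume "\<sigma> \<in> {\<sigma>. \<sigma> permutes {..<n}}"
    then have \<sigma>: "\<sigma> permutes {..<n}" by simp
    have "(\<Prod>j<n. y j ^ (if j < n then p ^ (Hilbert_Choice.inv \<sigma> j) else 0)) = (\<Prod>j<n. y j ^ (p ^ (Hilbert_Choice.inv \<sigma> j)))"
      by (intro prod.cong) auto
    \<comment> \<open>The exponents in \<open>Ln\<close> involve the inverse permutation;
      substituting \<sigma> i for j restores the Leibniz formula.\<close>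
    also have "\<dots> = (\<Prod>i<n. y (\<sigma> i) ^ (p ^ (Hilbert_Choice.inv \<sigma> (\<sigma> i))))"
      by (subst prod.permute[OF \<sigma>]) (simp add: o_def)
    also have "\<dots> = (\<Prod>i<n. y (\<sigma> i) ^ (p ^ i))" by (simp add: permutes_inverses[OF \<sigma>])
    finally show "ev n (single ({}, \<lambda>j. if j < n then p ^ (Hilbert_Choice.inv \<sigma> j) else 0) (of_int (sign \<sigma>))) y {} = signof \<sigma> * (\<Prod>i<n. y (\<sigma> i) ^ (p ^ i))"
      by (simp add: emb_single evR_single mval_def)
  qed
  finally show ?thesis by (simp add: det_dmat)
qed

lemma ev_topgen: "ev n (topgen n p) y S = delta {..<n} S * Ly n p y ^ (p - 2)"
proof -
  have "ev n (topgen n p) y S = ev n (single ({..<n}, \<lambda>_. 0) 1) y S * ev n (epow (Ln n p) (p - 2)) y {}"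
    unfolding topgen_def by (intro ev_emult_poly H_single Hp_epow Ln_Hp) (simp add: mono_ok_def)
  then show ?thesis by (simp add: ev_epow[OF Ln_Hp] ev_Ln emb_single evR_single mval_def delta_def)
qed

lemma Ly_tr:
  fixes A :: "nat \<Rightarrow> nat \<Rightarrow> 'q::prime_card mod_ring"
  assumes "p = CARD('q)"
  shows "Ly n p (tr n (acm A) y) = Ly n p y * det (dmat n (acm A))"
proof -
  have "dmat n (\<lambda>i j. tr n (acm A) y j ^ (p ^ i)) = dmat n (\<lambda>i j. \<Sum>k<n. y k ^ (p ^ i) * acm A k j)"
    by (intro dmat_cong) (simp only: assms tr_frob, simp only: tr_def mult.commute)
  then show ?thesis using det_dmat_mult[of n "\<lambda>i k. y k ^ (p ^ i)" "acm A"] by simp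
qed

lemma det_acm: "det (dmat n (acm A)) = to_ac (det (dmat n A))"
  unfolding det_dmat to_ac_sum by (intro sum.cong refl) (simp add: to_ac_prod)

lemma to_ac_fermat:
  fixes x :: "'q::prime_card mod_ring"
  assumes "x \<noteq> 0"
  shows "to_ac x ^ (CARD('q) - 1) = 1"
proof -
  have "CARD('q) > 0" by simp
  have "to_ac x ^ CARD('q) = to_ac x" using to_ac_power_card[of x 1] by simp
  then have "to_ac x * to_ac x ^ (CARD('q) - 1) = to_ac x * 1"
    using \<open>CARD('q) > 0\<close> by (metis Suc_diff_1 mult.right_neutral power_Suc)
  then show ?thesis using assms by simp
qed

text \<open>The top form contributes det A and the power of L_n contributes det A to the power p -
  2; the product det A^(p-1) is 1 by Fermat.\<close>

lemma topgen_D: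
  assumes p: "p = CARD('q::prime_card)"
  shows "(topgen n p :: 'q mod_ring elt) \<in> D n"
  unfolding D_iff
proof (intro conjI ballI allI)
  show "(topgen n p :: 'q mod_ring elt) \<in> H n"
    unfolding topgen_def by (intro H_emult H_single Hp_H Hp_epow Ln_Hp) (simp add: mono_ok_def)
  fix A :: "nat \<Rightarrow> nat \<Rightarrow> 'q mod_ring" and y S assume "A \<in> GL n"
  then have d: "det (dmat n A) \<noteq> 0" by (simp add: GL_iff_det)
  let ?d = "det (dmat n (acm A))"
  have e: "ev n (topgen n p :: 'q mod_ring elt) (tr n (acm A) y) = (\<lambda>S. (Ly n p y * ?d) ^ (p - 2) * delta {..<n} S)"
    by (rule ext) (simp add: ev_topgen Ly_tr[OF p] mult.commute)
  have "Lam n (acm A) (ev n (topgen n p) (tr n (acm A) y)) S = (Ly n p y * ?d) ^ (p - 2) * (?d * delta {..<n} S)"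
    unfolding e Lam_scale Lam_full ..
  also have "\<dots> = Ly n p y ^ (p - 2) * (?d ^ Suc (p - 2)) * delta {..<n} S" by (simp add: power_mult_distrib mult_ac)
  also have "Suc (p - 2) = CARD('q) - 1" using prime_ge_2_nat[OF prime_card[where 'a='q]] p by simp
  also have "?d ^ (CARD('q) - 1) = 1" unfolding det_acm using d by (rule to_ac_fermat)
  finally have fin: "Lam n (acm A) (ev n (topgen n p) (tr n (acm A) y)) S = Ly n p y ^ (p - 2) * 1 * delta {..<n} S" .
  show "Lam n (acm A) (ev n (topgen n p) (tr n (acm A) y)) S = ev n (topgen n p) y S"
    unfolding fin by (simp add: ev_topgen mult.commute)
qed

lemma homog_emult:
  fixes f h :: "'k::comm_ring_1 elt"
  assumes "f \<in> H n" "h \<in> H n" "homog n a f" "homog n b h"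
  shows "homog n (a + b) (emult f h)"
  unfolding homog_def
proof
  fix m assume "m \<in> supp (emult f h)"
  then have "m \<in> (\<Union>z\<in>supp f \<times> supp h. supp (mono_mult (fst z) (snd z) :: 'k elt))"
    unfolding emult_alt by (rule supp_sum[THEN subsetD])
  then obtain m1 m2 where m: "m1 \<in> supp f" "m2 \<in> supp h" "m \<in> supp (mono_mult m1 m2 :: 'k elt)" by auto
  have me: "m = (fst m1 \<union> fst m2, \<lambda>i. snd m1 i + snd m2 i)" using subsetD[OF mono_mult_supp m(3)] by simp
  have disj: "fst m1 \<inter> fst m2 = {}" using m(3) by (auto simp: mono_mult_def supp_def ezero_def split: if_splits)
  have "finite (fst m1)" "finite (fst m2)"
    using H_ok[OF assms(1) m(1)] H_ok[OF assms(2) m(2)] by (auto simp: mono_ok_def intro: finite_subset)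
  then have "card (fst m) = card (fst m1) + card (fst m2)" using disj by (simp add: me card_Un_disjoint)
  moreover have "mdeg n m1 = a" "mdeg n m2 = b" using assms m by (auto simp: homog_def)
  ultimately show "mdeg n m = a + b" by (simp add: mdeg_def me sum.distrib)
qed

lemma homog_single: "mdeg n m = d \<Longrightarrow> homog n d (single m c)"
  by (auto simp: homog_def dest!: supp_single[THEN subsetD])

lemma homog_epow: "f \<in> Hp n \<Longrightarrow> homog n d f \<Longrightarrow> homog n (k * d) (epow f k)"
proof (induction k)
  case 0
  then show ?case by (auto simp: epow_def eone_def mdeg_def intro!: homog_single)
next
  case (Suc k)
  then show ?case by (simp add: epow_Suc homog_emult Hp_H Hp_epow)
qed

lemma homog_Ln: "homog n (2 * (\<Sum>i<n. p ^ i)) (Ln n p :: 'k::comm_ring_1 elt)"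
  unfolding homog_def
proof
  fix m assume "m \<in> supp (Ln n p :: 'k elt)"
  then have "m \<in> (\<Union>\<sigma>\<in>{\<sigma>. \<sigma> permutes {..<n}}. supp (single ({}, \<lambda>j. if j < n then p ^ (Hilbert_Choice.inv \<sigma> j) else 0) (of_int (sign \<sigma>)) :: 'k elt))"
    unfolding Ln_def by (rule supp_sum1[THEN subsetD])
  then obtain \<sigma> where \<sigma>: "\<sigma> permutes {..<n}" and m: "m = ({}, \<lambda>j. if j < n then p ^ (Hilbert_Choice.inv \<sigma> j) else 0)"
    by (auto dest!: supp_single[THEN subsetD])
  have "(\<Sum>j<n. if j < n then p ^ (Hilbert_Choice.inv \<sigma> j) else 0) = (\<Sum>j<n. p ^ (Hilbert_Choice.inv \<sigma> j))"
    by (intro sum.cong) auto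
  also have "\<dots> = (\<Sum>j<n. p ^ j)" using sum.permute[OF permutes_inv[OF \<sigma>], of "\<lambda>j. p ^ j"] by (simp add: o_def)
  finally show "mdeg n m = 2 * (\<Sum>i<n. p ^ i)" by (simp add: mdeg_def m)
qed

lemma homog_topgen: "homog n (n + (p - 2) * (2 * (\<Sum>i<n. p ^ i))) (topgen n p :: 'k::comm_ring_1 elt)"
  unfolding topgen_def
  by (intro homog_emult homog_epow homog_single homog_Ln H_single Hp_H Hp_epow Ln_Hp) (simp_all add: mdeg_def mono_ok_def)

text \<open>The numbers p^j are distinct, so the diagonal monomial arises from the identity
  permutation only. It witnesses that L_n is not zero.\<close>

lemma Ln_coeff: "p \<ge> 2 \<Longrightarrow> (Ln n p :: 'k::comm_ring_1 elt) ({}, \<lambda>j. if j < n then p ^ j else 0) = 1"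
proof -
  assume p: "p \<ge> 2"
  let ?S = "{\<sigma>. \<sigma> permutes {..<n}}"
  have fin: "finite ?S" by (rule finite_permutations) simp
  have "(Ln n p :: 'k elt) ({}, \<lambda>j. if j < n then p ^ j else 0) = (\<Sum>\<sigma>\<in>?S. if \<sigma> = id then 1 else 0)"
    unfolding Ln_def
  proof (intro sum.cong refl)
    fix \<sigma> assume "\<sigma> \<in> ?S"
    then have \<sigma>: "\<sigma> permutes {..<n}" by simp
    have "(\<lambda>j. if j < n then p ^ j else 0) = (\<lambda>j. if j < n then p ^ (Hilbert_Choice.inv \<sigma> j) else 0) \<longleftrightarrow> \<sigma> = id"
    proof
      assume e: "(\<lambda>j. if j < n then p ^ j else 0) = (\<lambda>j. if j < n then p ^ (Hilbert_Choice.inv \<sigma> j) else 0)"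
      have "Hilbert_Choice.inv \<sigma> j = j" for j
      proof (cases "j < n")
        case True
        then have "p ^ j = p ^ (Hilbert_Choice.inv \<sigma> j)" using fun_cong[OF e, of j] by simp
        then show ?thesis using p by (simp add: power_inject_exp)
      next
        case False
        then show ?thesis using permutes_inv[OF \<sigma>] by (auto simp: permutes_def)
      qed
      then have "\<sigma> j = j" for j using permutes_inverses(1)[OF \<sigma>, of j] by simp
      then show "\<sigma> = id" by auto
    qed auto
    then show "(single ({}, \<lambda>j. if j < n then p ^ (Hilbert_Choice.inv \<sigma> j) else 0) (of_int (sign \<sigma>)) :: 'k elt) ({}, \<lambda>j. if j < n then p ^ j else 0) = (if \<sigma> = id then 1 else 0)"
      by (simp add: single_def)
  qed
  also have "\<dots> = 1" using fin permutes_id[of "{..<n}"] by simp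
  finally show ?thesis .
qed

lemma Ly_nonzero:
  assumes "p \<ge> 2"
  shows "\<exists>y :: nat \<Rightarrow> 'k::field alg_closure. Ly n p y \<noteq> 0"
proof (rule ccontr)
  assume "\<nexists>y :: nat \<Rightarrow> 'k alg_closure. Ly n p y \<noteq> 0"
  then have 0: "ev n (Ln n p :: 'k elt) y {} = 0" for y by (simp add: ev_Ln)
  have L: "(Ln n p :: 'k elt) \<in> Hp n" by (rule Ln_Hp)
  have z: "ev n (Ln n p :: 'k elt) y S = 0" for y S
  proof (cases "S = {}")
    case False
    then show ?thesis using L by (auto simp: evR_def Hp_def intro!: sum.neutral)
  qed (simp add: 0)
  have LH: "emb (Ln n p :: 'k elt) \<in> H n" using Hp_H[OF L] by simp
  have "emb (Ln n p :: 'k elt) ({}, \<lambda>j. if j < n then p ^ j else 0) = 0"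
    by (rule evR_inj[OF infinite_alg_closed LH z])
  then show False using Ln_coeff[OF assms, of n, where ?'k = 'k] by (simp add: emb_apply)
qed

section \<open>Reaching the top Dickson class\<close>

text \<open>The Milnor primitive Q_i on both halves, the derivation that sends x_j to
  y_j^(p^i).\<close>

definition qop :: "nat \<Rightarrow> nat \<Rightarrow> nat \<Rightarrow> 'k::field gfun \<Rightarrow> 'k gfun" where
  "qop n p i w = (\<lambda>(b, y, S). iota n (\<lambda>j. y j ^ (p ^ i)) (\<lambda>S. w (b, y, S)) S)"

fun qops :: "nat \<Rightarrow> nat \<Rightarrow> nat list \<Rightarrow> 'k::field gfun \<Rightarrow> 'k gfun" where
  "qops n p [] w = w"
| "qops n p (i # is) w = qops n p is (qop n p i w)"

lemma qops_eq: "qops n p is w (b, y, S) = cont n (map (\<lambda>i j. y j ^ (p ^ i)) is) (\<lambda>S. w (b, y, S)) S"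
  by (induction "is" arbitrary: w) (simp_all add: qop_def)

lemma evR_cong: "(\<And>j. j < n \<Longrightarrow> y j = y' j) \<Longrightarrow> evR n F y S = evR n F y' S"
  unfolding evR_def mval_def by (intro sum.cong refl) simp

lemma tpoly_evR:
  assumes h: "\<And>j. tpoly (\<lambda>t (x :: 'x). h t x j)"
  shows "tpoly (\<lambda>t x. evR n F (h t x) S)"
proof -
  have "(\<lambda>t x. evR n F (h t x) S) = (\<lambda>t x. \<Sum>m\<in>supp F. (if fst m = S then F m else 0) * (\<Prod>j<n. h t x j ^ snd m j))"
    unfolding evR_def mval_def by (intro ext sum.cong refl) simp
  then show ?thesis by (simp only:) (intro tpoly_sum tpoly_mult tpoly_const tpoly_prod tpoly_power h)
qed

lemma evR_line: "\<exists>P. \<forall>s. evR n F (\<lambda>j. a j + s * d j) S = poly P s"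
proof -
  have "tpoly (\<lambda>s (x :: unit). evR n F (\<lambda>j. a j + s * d j) S)"
    by (intro tpoly_evR tpoly_add tpoly_mult tpoly_const tpoly_id)
  then show ?thesis unfolding tpoly_def by blast
qed

text \<open>On the line through y0 and y1 both functions become nonzero polynomials in one variable,
  so their product has finitely many roots.\<close>

lemma two_nonzero:
  fixes f h :: "(nat \<Rightarrow> 'r::field) \<Rightarrow> 'r"
  assumes inf: "infinite (UNIV :: 'r set)"
    and f: "\<And>a d. \<exists>P. \<forall>s. f (\<lambda>j. a j + s * d j) = poly P s"
    and h: "\<And>a d. \<exists>P. \<forall>s. h (\<lambda>j. a j + s * d j) = poly P s"
    and nz: "f y0 \<noteq> 0" "h y1 \<noteq> 0"
  shows "\<exists>y. f y \<noteq> 0 \<and> h y \<noteq> 0"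
proof -
  obtain P where P: "\<And>s. f (\<lambda>j. y0 j + s * (y1 j - y0 j)) = poly P s" using f[of y0 "\<lambda>j. y1 j - y0 j"] by blast
  obtain Q where Q: "\<And>s. h (\<lambda>j. y0 j + s * (y1 j - y0 j)) = poly Q s" using h[of y0 "\<lambda>j. y1 j - y0 j"] by blast
  have "P \<noteq> 0" using P[of 0] nz(1) by auto
  moreover have "Q \<noteq> 0" using Q[of 1] nz(2) by auto
  ultimately have "finite {s. poly (P * Q) s = 0}" by (intro poly_roots_finite) simp
  then obtain s where "poly (P * Q) s \<noteq> 0" using inf by (metis (mono_tags, lifting) UNIV_I finite_subset mem_Collect_eq subsetI)
  then have "f (\<lambda>j. y0 j + s * (y1 j - y0 j)) \<noteq> 0 \<and> h (\<lambda>j. y0 j + s * (y1 j - y0 j)) \<noteq> 0" by (simp add: P Q)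
  then show ?thesis by blast
qed

lemma Ly_line: "\<exists>P. \<forall>s. Ly n p (\<lambda>j. a j + s * d j :: 'k::field alg_closure) = poly P s"
  unfolding ev_Ln[symmetric] by (rule evR_line)

lemma polyfun_evR:
  assumes "finite (supp F)" "\<And>j. j < n \<Longrightarrow> polyfun J 1 (l j)"
  shows "polyfun J (\<Sum>m\<in>supp F. \<Sum>j<n. snd m j) (\<lambda>x. evR n F (\<lambda>j. l j x) S)"
proof -
  have "(\<lambda>x. evR n F (\<lambda>j. l j x) S) = (\<lambda>x. \<Sum>m\<in>supp F. (if fst m = S then F m else 0) * (\<Prod>j<n. l j x ^ snd m j))"
    unfolding evR_def mval_def by (intro ext sum.cong refl) simp
  moreover have "polyfun J (\<Sum>m\<in>supp F. \<Sum>j<n. snd m j) (\<lambda>x. \<Prod>j<n. l j x ^ snd m j)" if m: "m \<in> supp F" for m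
  proof (rule polyfun_mono)
    show "polyfun J (\<Sum>j<n. snd m j * 1) (\<lambda>x. \<Prod>j<n. l j x ^ snd m j)"
      using assms(2) by (intro polyfun_prod polyfun_power) auto
    show "(\<Sum>j<n. snd m j * 1) \<le> (\<Sum>m\<in>supp F. \<Sum>j<n. snd m j)"
      using member_le_sum[of m "supp F" "\<lambda>m. \<Sum>j<n. snd m j"] assms(1) m by simp
  qed
  ultimately show ?thesis by (simp only:) (intro polyfun_sum polyfun_cmult)
qed

lemma polyfun_sum_list: "(\<And>s. s \<in> set ss \<Longrightarrow> polyfun J N (F s)) \<Longrightarrow> polyfun J N (\<lambda>x. \<Sum>s\<leftarrow>ss. F s x)"
  by (induction ss) (auto intro: polyfun_const polyfun_add)

lemma tpoly_sum_list: "(\<And>s. s \<in> set ss \<Longrightarrow> tpoly (F s)) \<Longrightarrow> tpoly (\<lambda>t x. \<Sum>s\<leftarrow>ss. F s t x)"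
proof (induction ss)
  case Nil
  show ?case using tpoly_const[of "\<lambda>_. 0"] by simp
next
  case (Cons s ss)
  then show ?case using tpoly_add[of "F s" "\<lambda>t x. \<Sum>s\<leftarrow>ss. F s t x"] by simp
qed

lemma subspc_sum_list: "subspc W \<Longrightarrow> (\<And>s. s \<in> set ss \<Longrightarrow> u s \<in> W) \<Longrightarrow> (\<lambda>x. \<Sum>s\<leftarrow>ss. u s x) \<in> W"
proof (induction ss)
  case Nil
  then show ?case by (simp add: subspc_zero)
next
  case (Cons s ss)
  then show ?case using subspc_add[of W "u s" "\<lambda>x. \<Sum>s\<leftarrow>ss. u s x"] by simp
qed

lemma det_dmat_frob:
  fixes z :: "nat \<Rightarrow> nat \<Rightarrow> 'q::prime_card mod_ring alg_closure"
  shows "det (dmat n (\<lambda>i j. z i j ^ (CARD('q) ^ k))) = det (dmat n z) ^ (CARD('q) ^ k)"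
proof -
  have s: "signof \<sigma> ^ (CARD('q) ^ k) = (signof \<sigma> :: 'q mod_ring alg_closure)" for \<sigma> :: "nat \<Rightarrow> nat"
  proof -
    have "(- 1 :: 'q mod_ring alg_closure) ^ (CARD('q) ^ k) = - 1"
      using ac_diff_power[of 0 "1 :: 'q mod_ring alg_closure" k] by (simp add: zero_power)
    then show ?thesis by (simp add: sign_def)
  qed
  show ?thesis unfolding det_dmat ac_sum_power
    by (intro sum.cong refl) (simp add: power_mult_distrib s prod_power_distrib)
qed

lemma det_dmat_transpose: "det (dmat n (\<lambda>i j. z j i)) = det (dmat n (z :: nat \<Rightarrow> nat \<Rightarrow> 'r::comm_ring_1))"
proof -
  have "dmat n (\<lambda>i j. z j i) = transpose_mat (dmat n z)" by (rule eq_matI) (simp_all add: dmat_def)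
  then show ?thesis by (simp add: det_transpose[of _ n])
qed

lemma poly_det_dmat: "poly (det (dmat n z)) c = det (dmat n (\<lambda>i j. poly (z i j) (c :: 'r::comm_ring_1)))"
  unfolding det_dmat poly_sum by (intro sum.cong refl) (simp add: poly_prod sign_def)

text \<open>Geometric series, written without subtraction. It places the exponent E below p^(k+n),
  where the traces are cut off.\<close>

lemma geometric_top: "(p::nat) > 0 \<Longrightarrow> (p - 1) * (\<Sum>m\<in>{k..<k+n}. p ^ m) + p ^ k = p ^ (k + n)"
proof (induction n)
  case (Suc n)
  have "(p - 1) * (\<Sum>m\<in>{k..<k+Suc n}. p ^ m) + p ^ k = ((p - 1) * (\<Sum>m\<in>{k..<k+n}. p ^ m) + p ^ k) + (p - 1) * p ^ (k + n)"
    by (simp add: algebra_simps)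
  also have "\<dots> = p ^ (k + n) + (p - 1) * p ^ (k + n)" using Suc by simp
  also have "\<dots> = p * p ^ (k + n)" using Suc.prems by (cases p) simp_all
  finally show ?case by simp
qed simp

lemma polyfun_det:
  fixes n :: nat
  shows "polyfun ({..<n} \<times> {..<n}) n (\<lambda>x :: nat \<times> nat \<Rightarrow> 'r::comm_ring_1. det (dmat n (\<lambda>i j. x (i, j))))"
  unfolding det_dmat
proof (intro polyfun_sum polyfun_cmult)
  fix \<sigma> assume "\<sigma> \<in> {\<sigma>. \<sigma> permutes {0..<n}}"
  then have \<sigma>: "\<sigma> permutes {0..<n}" by simp
  have "polyfun ({..<n} \<times> {..<n}) (\<Sum>i\<in>{0..<n}. 1) (\<lambda>x :: nat \<times> nat \<Rightarrow> 'r. \<Prod>i\<in>{0..<n}. x (i, \<sigma> i))"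
  proof (intro polyfun_prod polyfun_var)
    fix i assume "i \<in> {0..<n}"
    then show "(i, \<sigma> i) \<in> {..<n} \<times> {..<n}" using permutes_in_image[OF \<sigma>, of i] by simp
  qed simp_all
  then show "polyfun ({..<n} \<times> {..<n}) n (\<lambda>x :: nat \<times> nat \<Rightarrow> 'r. \<Prod>i\<in>{0..<n}. x (i, \<sigma> i))" by simp
qed

section \<open>Contraction to polynomial functions and the transfer\<close>

context steenrod_endo
begin

lemma p2: "p \<ge> 2" using p_gt1 by simp

lemma GG_qop: "w \<in> GG n g \<Longrightarrow> qop n p i w \<in> GG n g"
  unfolding qop_def by (rule GG_Milnor)

lemma GG_qops: "w \<in> GG n g \<Longrightarrow> qops n p is w \<in> GG n g"
  by (induction "is" arbitrary: w) (auto intro: GG_qop)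

lemma GG_line:
  assumes "w \<in> GG n g"
  shows "\<exists>P. \<forall>s. w (b, \<lambda>j. a j + s * d j, S) = poly P s"
proof -
  have "tpoly (\<lambda>s (x :: unit). w (b, \<lambda>j. a j + s * d j, S))"
    by (rule tpoly_GG[OF assms, where B = "\<lambda>_. b" and T = "\<lambda>_. S"]) (intro tpoly_add tpoly_mult tpoly_const tpoly_id)
  then show ?thesis unfolding tpoly_def by blast
qed

text \<open>The action leaves the coefficient at the empty set unchanged, so this component is an
  invariant function in the plain sense.\<close>

lemma GG_invariant:
  assumes "w \<in> GG n g" "A \<in> GL n"
  shows "w (b, tr n (acm A) y, {}) = w (b, y, {})"
  using assms(1)
proof induction
  case (GG_gen f d)
  have "Lam n (acm A) (ev n (if b then g f else f) (tr n (acm A) y)) {} = ev n (if b then g f else f) y {}"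
    using D_Lam[OF pairf_if[OF GG_gen(1)] assms(2)] by simp
  then show ?case by (simp add: pairf_def Lam_empty)
qed auto

text \<open>Positive degree without exterior generators forces a positive exponent of some y_j. Here
  the restriction of the generators of \<open>GG\<close> to positive degree pays off.\<close>

lemma GG_at_zero:
  assumes "w \<in> GG n g"
  shows "w (b, \<lambda>_. 0, {}) = 0"
  using assms
proof induction
  case (GG_gen f d)
  let ?f = "if b then g f else f"
  have h: "homog n d ?f" using GG_gen g_deg by auto
  have v: "mval n (\<lambda>_. 0) (snd m) = 0" if m: "m \<in> supp ?f" "fst m = {}" for m
  proof -
    have "mdeg n m = d" using h m(1) by (simp add: homog_def)
    then have "2 * (\<Sum>j<n. snd m j) = d" using m(2) by (simp add: mdeg_def)
    then have "(\<Sum>j<n. snd m j) \<noteq> 0" using GG_gen(3) by (intro notI) linarith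
    then obtain j where "j < n" "snd m j \<noteq> 0" by (metis lessThan_iff sum.neutral)
    then show ?thesis unfolding mval_def by (intro prod_zero) (auto simp: zero_power intro!: bexI[of _ j])
  qed
  then have "ev n ?f (\<lambda>_. 0) {} = 0" unfolding evR_def supp_emb
    by (intro sum.neutral ballI) (simp only: v mult_zero_right if_cancel cong: if_cong)
  then show ?case by (simp add: pairf_def)
qed auto

lemma GG_cong:
  assumes "w \<in> GG n g" "\<And>j. j < n \<Longrightarrow> y j = y' j"
  shows "w (b, y, S) = w (b, y', S)"
proof -
  from GG_repr[OF assms(1)] obtain F where F: "\<And>b y S. w (b, y, S) = evR n (F b) y S" by blast
  show ?thesis unfolding F using assms(2) by (rule evR_cong)
qed

text \<open>Where L_n does not vanish, the vectors (y_j^(p^i)) with i < n form a basis. Contraction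
  with the unit vector j0 is then a combination of Milnor primitives, and it recovers the nonzero
  coefficient at S0 up to sign.\<close>

lemma contract_step:
  assumes w: "w \<in> GG n g" and nz: "w (b, y0, S0) \<noteq> 0" and j0: "j0 \<in> S0"
  shows "\<exists>i y. qop n p i w (b, y, S0 - {j0}) \<noteq> 0"
proof (rule ccontr)
  assume "\<nexists>i y. qop n p i w (b, y, S0 - {j0}) \<noteq> 0"
  then have z: "iota n (\<lambda>j. y j ^ (p ^ i)) (\<lambda>S. w (b, y, S)) (S0 - {j0}) = 0" for i y by (simp add: qop_def)
  have "S0 \<subseteq> {..<n}" using GG_support[OF w] nz by blast
  then have j0n: "j0 < n" using j0 by auto
  obtain y1 :: "nat \<Rightarrow> 'q mod_ring alg_closure" where y1: "Ly n p y1 \<noteq> 0" using Ly_nonzero[OF p2] by blast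
  \<comment> \<open>L_n and the coefficient must be nonzero at a common point.\<close>
  obtain y where y: "Ly n p y \<noteq> 0" "w (b, y, S0) \<noteq> 0"
    using two_nonzero[of "\<lambda>y. Ly n p y" "\<lambda>y. w (b, y, S0)", OF infinite_alg_closed Ly_line GG_line[OF w] y1 nz] by blast
  have "det (dmat n (\<lambda>i j. y i ^ (p ^ j))) \<noteq> 0" using y(1) by (simp add: det_dmat_transpose[of n "\<lambda>i j. y j ^ (p ^ i)"])
  from det_inverse[OF this] obtain B where B: "\<And>i j. i < n \<Longrightarrow> j < n \<Longrightarrow> (\<Sum>k<n. y i ^ (p ^ k) * B k j) = (if i = j then 1 else 0)" by blast
  have "iota n (unitv j0) (\<lambda>S. w (b, y, S)) (S0 - {j0}) = iota n (\<lambda>i. \<Sum>k<n. B k j0 * y i ^ (p ^ k)) (\<lambda>S. w (b, y, S)) (S0 - {j0})"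
    by (rule iota_cong) (use B j0n in \<open>simp add: unitv_def mult.commute\<close>)
  also have "\<dots> = (\<Sum>k<n. B k j0 * iota n (\<lambda>i. y i ^ (p ^ k)) (\<lambda>S. w (b, y, S)) (S0 - {j0}))"
    unfolding iota_vsum iota_vscale ..
  also have "\<dots> = 0" using z by simp
  finally have "sg (S0 - {j0}) j0 * w (b, y, S0) = 0" using j0 j0n by (simp add: iota_unitv insert_absorb)
  then have "sg (S0 - {j0}) j0 * (sg (S0 - {j0}) j0 * w (b, y, S0)) = 0" by (simp only: mult_zero_right)
  then show False using y(2) by (simp only: sg_sq_left)
qed

lemma contract_all:
  assumes "w \<in> GG n g" "w (b, y0, S0) \<noteq> 0" "card S0 = m"
  shows "\<exists>is y. length is = m \<and> qops n p is w (b, y, {}) \<noteq> 0"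
  using assms
proof (induction m arbitrary: w y0 S0)
  case 0
  have "finite S0" using GG_support[OF 0(1)] 0(2) finite_subset[of S0 "{..<n}"] by blast
  with 0 have "w (b, y0, {}) \<noteq> 0" by simp
  then show ?case by (intro exI[of _ "[]"] exI[of _ y0]) simp
next
  case (Suc m)
  then obtain j0 where j0: "j0 \<in> S0" by fastforce
  from contract_step[OF Suc.prems(1,2) j0] obtain i y where iy: "qop n p i w (b, y, S0 - {j0}) \<noteq> 0" by blast
  have "card (S0 - {j0}) = m" using Suc.prems(3) j0 by simp
  from Suc.IH[OF GG_qop[OF Suc.prems(1)] iy this] obtain "is" y' where "length is = m" "qops n p is (qop n p i w) (b, y', {}) \<noteq> 0" by blast
  then show ?case by (intro exI[of _ "i # is"] exI[of _ y']) simp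
qed

text \<open>Every contraction lowers the exterior degree by one, so the component at T sees only
  sets of size \<open>card T + length is\<close>.\<close>

lemma qops_vanish:
  assumes w: "w \<in> GG n g" and z: "\<And>y S. S \<subseteq> {..<n} \<Longrightarrow> card S = card T + length is \<Longrightarrow> w (b, y, S) = 0"
  shows "qops n p is w (b, y, T) = 0"
proof (cases "T \<subseteq> {..<n}")
  case True
  have "cont n (map (\<lambda>i j. y j ^ (p ^ i)) is) (\<lambda>S. w (b, y, S)) T = cont n (map (\<lambda>i j. y j ^ (p ^ i)) is) (\<lambda>S. 0) T"
    by (rule cont_cong[OF _ True]) (simp add: z)
  then show ?thesis by (simp add: qops_eq cont_zero)
next
  case False
  then show ?thesis using GG_support[OF GG_qops[OF w]] by blast
qed

text \<open>All operations act on both halves alike, so the image half stays zero, while the source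
  is normalised until only the exponent k depends on w.\<close>

lemma reach_top:
  assumes w: "w \<in> GG n g" and T0: "\<And>y S. w (True, y, S) = 0" and F0: "\<And>y S. S \<noteq> {} \<Longrightarrow> w (False, y, S) = 0"
    and nz: "w (False, y0, {}) \<noteq> 0"
  shows "\<exists>k. (\<lambda>(b, y, S). if b \<or> S \<noteq> {} then 0 else Ly n p y ^ ((p - 1) * p ^ k)) \<in> GG n g"
proof -
  define \<phi> where "\<phi> = (\<lambda>y. w (False, y, {}))"
  from GG_repr[OF w] obtain F where F: "\<And>b. F b \<in> H n" "\<And>b y S. w (b, y, S) = evR n (F b) y S" by blast
  have "\<exists>ss r. r \<noteq> 0 \<and> (\<forall>z :: nat \<Rightarrow> nat \<Rightarrow> 'q mod_ring.
     (\<Sum>s\<leftarrow>ss. \<phi> (\<lambda>j. \<Sum>i<n. s i * to_ac (z i j))) = (if det (dmat n z) \<noteq> 0 then r else 0))"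
  proof (rule orbit_sum)
    show "\<phi> (tr n (acm A) y) = \<phi> y" if "A \<in> GL n" for A y using GG_invariant[OF w that] by (simp add: \<phi>_def)
    show "\<phi> (\<lambda>_. 0) = 0" using GG_at_zero[OF w] by (simp add: \<phi>_def)
    show "\<phi> y = \<phi> y'" if "\<And>j. j < n \<Longrightarrow> y j = y' j" for y y' unfolding \<phi>_def using GG_cong[OF w that] .
    show "\<phi> y0 \<noteq> 0" using nz by (simp add: \<phi>_def)
  qed
  then obtain ss r where r: "r \<noteq> 0" and ss: "\<And>z :: nat \<Rightarrow> nat \<Rightarrow> 'q mod_ring.
     (\<Sum>s\<leftarrow>ss. \<phi> (\<lambda>j. \<Sum>i<n. s i * to_ac (z i j))) = (if det (dmat n z) \<noteq> 0 then r else 0)" by blast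
  have n0: "n \<noteq> 0"
  proof
    assume "n = 0"
    then have "w (False, y0, {}) = w (False, \<lambda>_. 0, {})" by (intro GG_cong[OF w]) simp
    with nz GG_at_zero[OF w] show False by simp
  qed
  let ?J = "{..<n} \<times> {..<n}"
  define Dn where "Dn = (\<lambda>x :: nat \<times> nat \<Rightarrow> 'q mod_ring alg_closure. \<Sum>s\<leftarrow>ss. \<phi> (\<lambda>j. \<Sum>i<n. s i * x (i, j)))"
  \<comment> \<open>On points over the prime field r det^(p-1) is r times the indicator of
    invertibility, by Fermat, so G vanishes there.\<close>
  define G where "G = (\<lambda>x. Dn x + (- r) * det (dmat n (\<lambda>i j. x (i, j))) ^ (p - 1))"
  define N1 where "N1 = (\<Sum>m\<in>supp (F False). \<Sum>j<n. snd m j)"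
  define N where "N = max N1 ((p - 1) * n)"
  have lin: "polyfun ?J 1 (\<lambda>x. \<Sum>i<n. s i * x (i, j))" if "j < n" for s :: "nat \<Rightarrow> 'q mod_ring alg_closure" and j
    using that by (intro polyfun_sum polyfun_cmult polyfun_var) auto
  have "polyfun ?J N1 Dn"
    unfolding Dn_def \<phi>_def F(2) N1_def by (intro polyfun_sum_list polyfun_evR H_finite[OF F(1)] lin)
  then have "polyfun ?J N Dn" by (rule polyfun_mono) (simp add: N_def)
  moreover have "polyfun ?J N (\<lambda>x. (- r) * det (dmat n (\<lambda>i j. x (i, j))) ^ (p - 1))"
    by (intro polyfun_cmult polyfun_mono[OF polyfun_power[OF polyfun_det]]) (simp add: N_def)
  ultimately have pG: "polyfun ?J N G" unfolding G_def by (rule polyfun_add)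
  have Gz: "G (\<lambda>j. to_ac (x j)) = 0" for x :: "nat \<times> nat \<Rightarrow> 'q mod_ring"
  proof -
    have D: "Dn (\<lambda>j. to_ac (x j)) = (if det (dmat n (\<lambda>i j. x (i, j))) \<noteq> 0 then r else 0)"
      unfolding Dn_def by (rule ss)
    show ?thesis
    proof (cases "det (dmat n (\<lambda>i j. x (i, j))) = 0")
      case True
      then show ?thesis using D p_gt1 by (simp add: G_def det_acm zero_power)
    next
      case False
      then show ?thesis using D to_ac_fermat[OF False] by (simp add: G_def det_acm p_def)
    qed
  qed
  \<comment> \<open>The transfer requires the degree of G to be at most k.\<close>
  define k where "k = N"
  \<comment> \<open>The exponent of the top coefficient of the determinant of traces. Starting the
    block at k makes the resulting E divisible by p^k.\<close>
  define E0 where "E0 = (\<Sum>m\<in>{k..<k+n}. p ^ m)"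
  define E where "E = (p - 1) * E0"
  have dvdE: "p ^ k dvd E" unfolding E_def E0_def by (intro dvd_mult dvd_sum le_imp_power_dvd) simp
  have "E + p ^ k = p ^ (k + n)" unfolding E_def E0_def by (rule geometric_top[OF p_pos])
  then have ltE: "E < p ^ (k + n)" using p_pos by (metis less_add_same_cancel1 zero_less_power)
  \<comment> \<open>Auxiliary scalars with L_n nonzero at them, so that their factor in the top
    coefficient can be cancelled.\<close>
  obtain \<beta> :: "nat \<Rightarrow> 'q mod_ring alg_closure" where \<beta>: "Ly n p \<beta> \<noteq> 0" using Ly_nonzero[OF p2] by blast
  \<comment> \<open>\<open>lamp\<close> sums over m < k + n, additive substitutions over m \<le>
    T.\<close>
  obtain T where T: "k + n = Suc T" using n0 by (cases "k + n") auto
  \<comment> \<open>Coefficients of the additive polynomial in y that is the sum over i of s_i times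
    the truncated trace of \<beta>_i y c.\<close>
  define al where "al = (\<lambda>s (c :: 'q mod_ring alg_closure) m. \<Sum>i<n. s i * (c * \<beta> i) ^ (p ^ m))"
  define W where "W = (\<lambda>c (b, y, S). \<Sum>s\<leftarrow>ss. w (b, \<lambda>j. \<Sum>m\<le>T. al s c m * y j ^ (p ^ m), S))"
  have e: "w (b, y, S) = 0" if "S \<noteq> {}" for b y S using T0 F0[OF that] by (cases b) auto
  have WG: "W c \<in> GG n g" for c
  proof -
    have "(\<lambda>x. \<Sum>s\<leftarrow>ss. (case x of (b, y, S) \<Rightarrow> w (b, \<lambda>j. \<Sum>m\<le>T. al s c m * y j ^ (p ^ m), S))) \<in> GG n g"
      by (intro subspc_sum_list[OF subspc_GG] GG_additive_poly[OF w e])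
    then show ?thesis by (simp add: W_def case_prod_unfold)
  qed
  have "tpoly W"
    unfolding W_def case_prod_beta al_def
    by (intro tpoly_sum_list tpoly_GG[OF w] tpoly_sum tpoly_mult tpoly_power tpoly_const tpoly_id)
  then obtain M q where q: "\<And>x. degree (q x) \<le> M" "\<And>c x. W c x = poly (q x) c" unfolding tpoly_def by metis
  have "W c = (\<lambda>x. poly (q x) c)" for c using q(2) by auto
  then have co: "(\<lambda>x. coeff (q x) E) \<in> GG n g"
    using WG q(1) by (intro extract_coeff_poly[OF subspc_GG infinite_alg_closed, where M = M]) auto
  have q0: "q (b, y, S) = 0" if "b \<or> S \<noteq> {}" for b y S
  proof (rule poly_eqI_infinite[OF infinite_alg_closed])
    fix c
    have "W c (b, y, S) = 0" using that T0 F0 by (cases b) (auto simp: W_def intro!: sum_list_0)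
    then show "poly (q (b, y, S)) c = poly 0 c" by (simp add: q(2))
  qed
  define dB where "dB = Ly n p \<beta> ^ (p ^ k)"
  have dB: "dB \<noteq> 0" using \<beta> by (simp add: dB_def)
  have q1: "coeff (q (False, y, {})) E = r * (dB * Ly n p y ^ (p ^ k)) ^ (p - 1)" for y
  proof -
    define q2 where "q2 = det (dmat n (\<lambda>i j. lamp p (k + n) (\<beta> i * y j)))"
    define Q where "Q = q (False, y, {}) + smult (- r) (q2 ^ (p - 1))"
    have "coeff Q E = 0"
    proof (rule transfer_zero[OF p_def _ pG _ dvdE ltE Gz])
      show "finite ?J" by simp
      show "N \<le> k" by (simp add: k_def)
      fix c
      have al: "(\<Sum>m\<le>T. al s c m * y j ^ (p ^ m)) = (\<Sum>i<n. s i * poly (lamp p (k + n) (\<beta> i * y j)) c)" for s j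
      proof -
        have "(\<Sum>m\<le>T. al s c m * y j ^ (p ^ m)) = (\<Sum>m\<le>T. \<Sum>i<n. s i * (c * (\<beta> i * y j)) ^ (p ^ m))"
          unfolding al_def sum_distrib_right by (intro sum.cong refl) (simp add: power_mult_distrib mult.assoc)
        also have "\<dots> = (\<Sum>i<n. \<Sum>m\<le>T. s i * (c * (\<beta> i * y j)) ^ (p ^ m))" by (rule sum.swap)
        also have "\<dots> = (\<Sum>i<n. s i * poly (lamp p (k + n) (\<beta> i * y j)) c)"
          unfolding poly_lamp T lessThan_Suc_atMost sum_distrib_left ..
        finally show ?thesis .
      qed
      have "poly Q c = W c (False, y, {}) + (- r) * poly q2 c ^ (p - 1)" by (simp add: Q_def q(2))
      also have "W c (False, y, {}) = Dn (\<lambda>z. poly (lamp p (k + n) ((\<lambda>(i, j). \<beta> i * y j) z)) c)"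
        by (simp add: W_def Dn_def \<phi>_def al)
      also have "poly q2 c = det (dmat n (\<lambda>i j. poly (lamp p (k + n) ((\<lambda>(i, j). \<beta> i * y j) (i, j))) c))"
        unfolding q2_def poly_det_dmat by simp
      finally show "poly Q c = G (\<lambda>z. poly (lamp p (k + n) ((\<lambda>(i, j). \<beta> i * y j) z)) c)" by (simp only: G_def)
    qed
    then have "coeff (q (False, y, {})) E = r * coeff (q2 ^ (p - 1)) E" by (simp add: Q_def)
    also have "coeff (q2 ^ (p - 1)) E = coeff q2 E0 ^ (p - 1)"
      unfolding E_def using det_lamp_top[OF p2, of n k \<beta> y] coeff_power_top[of q2 E0 "p - 1"] by (simp add: q2_def E0_def)
    also have "coeff q2 E0 = det (dmat n (\<lambda>i l. \<beta> i ^ (p ^ (k + l)))) * det (dmat n (\<lambda>l j. y j ^ (p ^ (k + l))))"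
      using det_lamp_top[OF p2, of n k \<beta> y] by (simp add: q2_def E0_def)
    also have "det (dmat n (\<lambda>i l. \<beta> i ^ (p ^ (k + l)))) = dB"
    proof -
      have "det (dmat n (\<lambda>i l. \<beta> i ^ (p ^ (k + l)))) = det (dmat n (\<lambda>l i. (\<beta> i ^ (p ^ l)) ^ (p ^ k)))"
        by (subst det_dmat_transpose[symmetric]) (simp add: power_add power_mult mult.commute flip: power_mult)
      then show ?thesis unfolding dB_def p_def det_dmat_frob .
    qed
    also have "det (dmat n (\<lambda>l j. y j ^ (p ^ (k + l)))) = Ly n p y ^ (p ^ k)"
    proof -
      have "det (dmat n (\<lambda>l j. y j ^ (p ^ (k + l)))) = det (dmat n (\<lambda>l j. (y j ^ (p ^ l)) ^ (p ^ k)))"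
        by (simp add: power_add mult.commute flip: power_mult)
      then show ?thesis unfolding p_def det_dmat_frob .
    qed
    finally show ?thesis .
  qed
  have "(\<lambda>x. inverse (r * dB ^ (p - 1)) * coeff (q x) E) \<in> GG n g" by (rule GG.GG_scale[OF co])
  moreover have "(\<lambda>x. inverse (r * dB ^ (p - 1)) * coeff (q x) E) = (\<lambda>(b, y, S). if b \<or> S \<noteq> {} then 0 else Ly n p y ^ ((p - 1) * p ^ k))"
  proof
    fix x :: "bool \<times> (nat \<Rightarrow> 'q mod_ring alg_closure) \<times> nat set"
    obtain b y S where x: "x = (b, y, S)" by (cases x)
    show "inverse (r * dB ^ (p - 1)) * coeff (q x) E = (case x of (b, y, S) \<Rightarrow> if b \<or> S \<noteq> {} then 0 else Ly n p y ^ ((p - 1) * p ^ k))"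
    proof (cases "b \<or> S \<noteq> {}")
      case True
      then show ?thesis by (simp add: x q0)
    next
      case False
      have "(Ly n p y ^ (p ^ k)) ^ (p - 1) = Ly n p y ^ ((p - 1) * p ^ k)" by (simp add: mult.commute flip: power_mult)
      moreover have "coeff (q (False, y, {})) E = (r * dB ^ (p - 1)) * (Ly n p y ^ (p ^ k)) ^ (p - 1)"
        unfolding q1 power_mult_distrib by (simp only: mult.assoc)
      moreover have "inverse c * (c * u) = u" if "c \<noteq> 0" for c u :: "'q mod_ring alg_closure"
        using that by (simp add: mult.assoc[symmetric])
      moreover have "r * dB ^ (p - 1) \<noteq> 0" using r dB by simp
      moreover have "b = False" "S = {}" using False by simp_all
      ultimately show ?thesis using False by (simp only: x case_prod_conv if_False)
    qed
  qed
  ultimately show ?thesis by auto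
qed

section \<open>Injectivity in positive degrees\<close>

lemma GG_Frobenius_iter:
  assumes w: "w \<in> GG n g" and e: "\<And>b y S. S \<noteq> {} \<Longrightarrow> w (b, y, S) = 0"
  shows "(\<lambda>(b, y, S). if S = {} then w (b, \<lambda>j. y j ^ (p ^ k), S) else 0) \<in> GG n g"
proof (induction k)
  case 0
  have "(\<lambda>(b, y, S). if S = {} then w (b, \<lambda>j. y j ^ (p ^ 0), S) else 0) = w" using e by auto
  then show ?case using w by simp
next
  case (Suc k)
  have "(\<lambda>(b, y, S). if S = {} then w (b, \<lambda>j. y j ^ (p ^ Suc k), S) else 0) =
    (\<lambda>(b, y, S). if S = {} then (\<lambda>(b, y, S). if S = {} then w (b, \<lambda>j. y j ^ (p ^ k), S) else 0) (b, \<lambda>j. y j ^ p, S) else 0)"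
    by (auto simp: fun_eq_iff power_mult)
  then show ?case using GG_Frobenius[OF Suc] by simp
qed

text \<open>Powers are surjective on points: a function that is nonzero somewhere remains so after
  the substitution of y^m for y.\<close>

lemma roots: "m > 0 \<Longrightarrow> \<exists>y. (\<lambda>j. y j ^ m) = (y0 :: nat \<Rightarrow> 'q mod_ring alg_closure)"
proof -
  assume "m > 0"
  then have "\<forall>j. \<exists>z. z ^ m = y0 j" using nth_root_exists by blast
  then obtain y where "\<forall>j. y j ^ m = y0 j" by metis
  then show ?thesis by (intro exI[of _ y]) auto
qed

lemma ev_ezero: "ev n (ezero :: 'q mod_ring elt) y S = 0"
  by (simp add: evR_def supp_def ezero_def emb_def)

text \<open>Maximality of card S ensures that card S contractions leave a function without exterior
  part.\<close>

lemma max_exterior_degree: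
  fixes f :: "'q mod_ring elt"
  assumes "f \<in> D n" "f \<noteq> ezero"
  obtains y S where "ev n f y S \<noteq> 0" "S \<subseteq> {..<n}" "\<And>y' S'. ev n f y' S' \<noteq> 0 \<Longrightarrow> card S' \<le> card S"
proof -
  have f: "f \<in> H n" using assms(1) by (rule D_H)
  have sub: "S \<subseteq> {..<n}" if "ev n f y S \<noteq> 0" for y S
  proof (rule ccontr)
    assume "\<not> S \<subseteq> {..<n}"
    then have "fst m \<noteq> S" if "m \<in> supp f" for m using H_ok[OF f that] by (auto simp: mono_ok_def)
    then have "ev n f y S = 0" by (auto simp: evR_def intro!: sum.neutral)
    with that show False by simp
  qed
  have "\<exists>y S. ev n f y S \<noteq> 0"
  proof (rule ccontr)
    assume "\<nexists>y S. ev n f y S \<noteq> 0"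
    then have "f = ezero"
      by (intro ev_inj[OF f D_H[OF D_ezero]]) (simp add: ev_ezero)
    with assms(2) show False by simp
  qed
  then obtain y0 S0 where "ev n f y0 S0 \<noteq> 0" by blast
  moreover have "card (snd z) < Suc n" if "ev n f (fst z) (snd z) \<noteq> 0" for z :: "(nat \<Rightarrow> 'q mod_ring alg_closure) \<times> nat set"
    using card_mono[OF _ sub[OF that]] by simp
  ultimately obtain z :: "(nat \<Rightarrow> 'q mod_ring alg_closure) \<times> nat set" where z: "ev n f (fst z) (snd z) \<noteq> 0"
     "\<And>z'. ev n f (fst z') (snd z') \<noteq> 0 \<Longrightarrow> card (snd z') \<le> card (snd z)"
    using ex_has_greatest_nat[of "\<lambda>z. ev n f (fst z) (snd z) \<noteq> 0" "(y0, S0)" "\<lambda>z. card (snd z)" "Suc n"] by auto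
  show thesis
    by (rule that[OF z(1) sub[OF z(1)]]) (use z(2)[of "(y', S')" for y' S'] in simp)
qed

lemma kernel_trivial:
  assumes top: "g (topgen n p) \<noteq> ezero" and f: "f \<in> D n" "homog n d f" "d > 0" and gf: "g f = ezero"
  shows "f = ezero"
proof (rule ccontr)
  assume "f \<noteq> ezero"
  obtain y0 S0 where S0: "ev n f y0 S0 \<noteq> 0" "S0 \<subseteq> {..<n}" "\<And>y' S'. ev n f y' S' \<noteq> 0 \<Longrightarrow> card S' \<le> card S0"
    using max_exterior_degree[OF f(1) \<open>f \<noteq> ezero\<close>] by blast
  \<comment> \<open>For n = 0 the element \<open>topgen\<close> has degree 0 and would not generate
    a member of the span.\<close>
  have n0: "n > 0"
  proof (rule ccontr)
    assume "\<not> n > 0"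
    then have "mdeg n m = 0" if "m \<in> supp f" for m using H_ok[OF D_H[OF f(1)] that] by (simp add: mono_ok_def mdeg_def)
    then have "supp f = {}" using f(2,3) by (auto simp: homog_def)
    then have "f = ezero" by (auto simp: supp_def ezero_def)
    with \<open>f \<noteq> ezero\<close> show False by simp
  qed
  define w0 where "w0 = pairf n g f"
  have w0: "w0 \<in> GG n g" unfolding w0_def by (rule GG.GG_gen[OF f])
  have w0T: "w0 (True, y, S) = 0" for y S by (simp add: w0_def pairf_def gf ev_ezero)
  have w0F: "w0 (False, y, S) = ev n f y S" for y S by (simp add: w0_def pairf_def)
  obtain "is" y where "is": "length is = card S0" "qops n p is w0 (False, y, {}) \<noteq> 0"
    using contract_all[OF w0, of False y0 S0] S0(1) by (auto simp: w0F)
  have "\<exists>k. (\<lambda>(b, y, S). if b \<or> S \<noteq> {} then 0 else Ly n p y ^ ((p - 1) * p ^ k)) \<in> GG n g"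
  proof (rule reach_top[OF GG_qops[OF w0] _ _ "is"(2)])
    show "qops n p is w0 (True, y, S) = 0" for y S by (rule qops_vanish[OF w0]) (rule w0T)
    show "qops n p is w0 (False, y, S) = 0" if "S \<noteq> {}" for y S
    proof (cases "S \<subseteq> {..<n}")
      case True
      then have "card S > 0" using that finite_subset by (auto simp: card_gt_0_iff)
      show ?thesis
      proof (rule qops_vanish[OF w0])
        fix y' and S' :: "nat set" assume "card S' = card S + length is"
        then have "\<not> card S' \<le> card S0" using \<open>card S > 0\<close> "is"(1) by simp
        then show "w0 (False, y', S') = 0" using S0(3) unfolding w0F by blast
      qed
    next
      case False
      then show ?thesis by (rule GG_support[OF GG_qops[OF w0]])
    qed
  qed
  then obtain k where k: "(\<lambda>(b, y, S). if b \<or> S \<noteq> {} then 0 else Ly n p y ^ ((p - 1) * p ^ k)) \<in> GG n g" by blast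

  define \<tau> where "\<tau> = g (topgen n p)"
  have \<tau>: "\<tau> \<in> D n" "\<tau> \<noteq> ezero" using top g_maps[OF topgen_D[OF p_def]] by (simp_all add: \<tau>_def)
  define w2 where "w2 = pairf n g (topgen n p)"
  have w2: "w2 \<in> GG n g" unfolding w2_def using n0 by (intro GG.GG_gen[OF topgen_D[OF p_def] homog_topgen]) simp
  have w2F: "w2 (False, y, S) = delta {..<n} S * Ly n p y ^ (p - 2)" for y S by (simp add: w2_def pairf_def ev_topgen)
  have w2T: "w2 (True, y, S) = ev n \<tau> y S" for y S by (simp add: w2_def pairf_def \<tau>_def)
  obtain y1 S1 where S1: "ev n \<tau> y1 S1 \<noteq> 0" "S1 \<subseteq> {..<n}" "\<And>y' S'. ev n \<tau> y' S' \<noteq> 0 \<Longrightarrow> card S' \<le> card S1"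
    using max_exterior_degree[OF \<tau>] by blast
  have "card S1 \<le> n" using card_mono[OF _ S1(2)] by simp
  \<comment> \<open>Otherwise fewer than n contractions bring the image to exterior degree 0, where
    the source then has no component.\<close>
  have "S1 = {..<n}"
  proof (rule ccontr)
    assume "S1 \<noteq> {..<n}"
    then have lt: "card S1 < n" using S1(2) \<open>card S1 \<le> n\<close> card_subset_eq[OF _ S1(2)] by fastforce
    obtain js y2 where js: "length js = card S1" "qops n p js w2 (True, y2, {}) \<noteq> 0"
      using contract_all[OF w2, of True y1 S1] S1(1) by (auto simp: w2T)
    obtain y3 where y3: "(\<lambda>j. y3 j ^ p) = y2" using roots[OF p_pos] by blast
    \<comment> \<open>The source may still be nonzero at nonempty S. Frobenius discards these
      components, after which the whole source is 0.\<close>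
    define w4 where "w4 = (\<lambda>(b, y, S). if S = {} then qops n p js w2 (b, \<lambda>j. y j ^ p, S) else 0)"
    have w4: "w4 \<in> GG n g" unfolding w4_def by (rule GG_Frobenius[OF GG_qops[OF w2]])
    have "w4 (False, y, S) = 0" for y S
    proof -
      have "qops n p js w2 (False, y', {}) = 0" for y'
      proof (rule qops_vanish[OF w2])
        fix y S assume "S \<subseteq> {..<n}" "card S = card {} + length js"
        then have "S \<noteq> {..<n}" using js(1) lt by auto
        then show "w2 (False, y, S) = 0" by (simp add: w2F delta_def)
      qed
      then show ?thesis by (simp add: w4_def)
    qed
    then have "w4 (True, y3, {}) = 0" by (rule GG_graph[OF w4])
    then show False using js(2) y3 by (simp add: w4_def)
  qed
  define w3 where "w3 = qops n p [0..<n] w2"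
  have w3: "w3 \<in> GG n g" unfolding w3_def by (rule GG_qops[OF w2])
  \<comment> \<open>The n contractions contribute one more factor L_n, so the source becomes
    \<open>kap n\<close> times L_n^(p-1).\<close>
  have w3e: "w3 (b, y, {}) = kap n * Ly n p y * w2 (b, y, {..<n})" for b y
    unfolding w3_def qops_eq by (rule cont_full)
  have w3z: "w3 (b, y, S) = 0" if "S \<noteq> {}" for b y S
  proof (cases "S \<subseteq> {..<n}")
    case True
    then have "card S > 0" using that finite_subset by (auto simp: card_gt_0_iff)
    show ?thesis unfolding w3_def
    proof (rule qops_vanish[OF w2])
      fix y' S' assume "S' \<subseteq> {..<n}" "card S' = card S + length [0..<n]"
      then have False using card_mono[of "{..<n}" S'] \<open>card S > 0\<close> by simp
      then show "w2 (b, y', S') = 0" ..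
    qed
  next
    case False
    then show ?thesis by (rule GG_support[OF w3])
  qed
  have LyF: "Ly n p (\<lambda>j. y j ^ (p ^ k)) = Ly n p y ^ (p ^ k)" for y :: "nat \<Rightarrow> 'q mod_ring alg_closure"
  proof -
    have "Ly n p (\<lambda>j. y j ^ (p ^ k)) = det (dmat n (\<lambda>i j. (y j ^ (p ^ i)) ^ (p ^ k)))"
      by (simp add: mult.commute flip: power_mult)
    then show ?thesis unfolding p_def det_dmat_frob .
  qed
  \<comment> \<open>After k Frobenius steps the source of \<open>w3\<close> is \<open>kap n\<close>
    times L_n^((p-1) p^k). The pair with image 0 cancels exactly this and leaves the image
    untouched.\<close>
  define w5 where "w5 = (\<lambda>x. (case x of (b, y, S) \<Rightarrow> if S = {} then w3 (b, \<lambda>j. y j ^ (p ^ k), S) else 0) -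
     kap n * (case x of (b, y, S) \<Rightarrow> if b \<or> S \<noteq> {} then 0 else Ly n p y ^ ((p - 1) * p ^ k)))"
  have w5: "w5 \<in> GG n g"
    unfolding w5_def by (intro subspc_diff[OF subspc_GG] GG.GG_scale k GG_Frobenius_iter[OF w3 w3z])
  have "w5 (False, y, S) = 0" for y S
  proof (cases "S = {}")
    case True
    have "Suc (p - 2) = p - 1" using p2 by simp
    then have "Ly n p y ^ (p ^ k) * (Ly n p y ^ (p ^ k)) ^ (p - 2) = (Ly n p y ^ (p ^ k)) ^ (p - 1)"
      by (metis power_Suc)
    also have "\<dots> = Ly n p y ^ ((p - 1) * p ^ k)" by (simp add: mult.commute flip: power_mult)
    finally show ?thesis using True by (simp add: w5_def w3e w2F LyF delta_def mult.assoc)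
  qed (simp add: w5_def)
  then have z: "w5 (True, y, {}) = 0" for y by (rule GG_graph[OF w5])
  obtain y4 :: "nat \<Rightarrow> 'q mod_ring alg_closure" where y4: "Ly n p y4 \<noteq> 0" using Ly_nonzero[OF p2] by blast
  obtain y5 where y5: "Ly n p y5 \<noteq> 0" "ev n \<tau> y5 {..<n} \<noteq> 0"
    using two_nonzero[of "\<lambda>y. Ly n p y" "\<lambda>y. ev n \<tau> y {..<n}", OF infinite_alg_closed Ly_line evR_line y4] S1(1) \<open>S1 = {..<n}\<close> by blast
  obtain y6 where y6: "(\<lambda>j. y6 j ^ (p ^ k)) = y5" using roots[of "p ^ k" y5] p_pos by auto
  have "kap n * Ly n p y5 * ev n \<tau> y5 {..<n} = 0"
    using z[of y6] by (simp add: w5_def w3e w2T y6)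
  moreover have "kap n \<noteq> (0 :: 'q mod_ring alg_closure)" using kap_unit[of n, where ?'r = "'q mod_ring alg_closure"] by auto
  ultimately show False using y5 by simp
qed

end

text \<open>A degree has finitely many monomials and the coefficients are finite in number; with
  this, injectivity in a degree gives bijectivity.\<close>

lemma finite_homog:
  "finite {f :: 'k::{finite, zero} elt. f \<in> H n \<and> homog n d f}"
proof -
  define M where "M = {m. mono_ok n m \<and> mdeg n m = d}"
  have "M \<subseteq> Pow {..<n} \<times> {e. \<forall>i. (i \<in> {..<n} \<longrightarrow> e i \<in> {..d}) \<and> (i \<notin> {..<n} \<longrightarrow> e i = 0)}"
  proof
    fix m assume m: "m \<in> M"
    have "snd m i \<le> d" if "i < n" for i
    proof -
      have "snd m i \<le> (\<Sum>i<n. snd m i)" using that by (intro member_le_sum) auto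
      then show ?thesis using m by (simp add: M_def mdeg_def)
    qed
    then show "m \<in> Pow {..<n} \<times> {e. \<forall>i. (i \<in> {..<n} \<longrightarrow> e i \<in> {..d}) \<and> (i \<notin> {..<n} \<longrightarrow> e i = 0)}"
      using m by (cases m) (auto simp: M_def mono_ok_def)
  qed
  moreover have "finite (Pow {..<n} \<times> {e. \<forall>i. (i \<in> {..<n} \<longrightarrow> e i \<in> {..d}) \<and> (i \<notin> {..<n} \<longrightarrow> e i = (0::nat))})"
    by (intro finite_cartesian_product finite_set_of_finite_funs) auto
  ultimately have "finite M" by (rule finite_subset)
  then have "finite {f :: 'k elt. \<forall>m. (m \<in> M \<longrightarrow> f m \<in> UNIV) \<and> (m \<notin> M \<longrightarrow> f m = 0)}"
    by (intro finite_set_of_finite_funs) auto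
  moreover have "{f :: 'k elt. f \<in> H n \<and> homog n d f} \<subseteq> {f. \<forall>m. (m \<in> M \<longrightarrow> f m \<in> UNIV) \<and> (m \<notin> M \<longrightarrow> f m = 0)}"
    by (auto simp: H_def homog_def M_def supp_def)
  ultimately show ?thesis by (rule finite_subset[rotated])
qed

theorem theorem4:
  fixes n p :: nat and g :: "'q::prime_card mod_ring elt \<Rightarrow> 'q mod_ring elt"
  assumes p_def: "p = CARD('q)"
    and p_odd: "odd p"
    and g_maps: "\<forall>f\<in>D n. g f \<in> D n"
    and g_add: "\<forall>a\<in>D n. \<forall>b\<in>D n. g (eadd a b) = eadd (g a) (g b)"
    and g_scale: "\<forall>c. \<forall>a\<in>D n. g (escale c a) = escale c (g a)"
    and g_deg: "\<forall>d. \<forall>f\<in>D n. homog n d f \<longrightarrow> homog n d (g f)"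
    and g_P: "\<forall>r. \<forall>f\<in>D n. g (Pst n p r f) = Pst n p r (g f)"
    and g_beta: "\<forall>f\<in>D n. g (Bock f) = Bock (g f)"
    and g_top: "g (topgen n p) \<noteq> ezero"
  shows "\<forall>d>0. bij_betw g {f \<in> D n. homog n d f} {f \<in> D n. homog n d f}"
proof (intro allI impI)
  fix d :: nat assume d: "d > 0"
  interpret steenrod_endo n p g
    by unfold_locales (use assms in blast)+
  let ?V = "{f \<in> D n. homog n d f} :: 'q mod_ring elt set"
  have "?V \<subseteq> {f. f \<in> H n \<and> homog n d f}" using D_H by blast
  then have fin: "finite ?V" using finite_homog by (rule finite_subset)
  have "inj_on g ?V"
  proof (rule inj_onI)
    fix a b assume a: "a \<in> ?V" and b: "b \<in> ?V" and eq: "g a = g b"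
    define h where "h = eadd a (escale (-1) b)"
    have hD: "h \<in> D n" using a b by (auto simp: h_def intro: D_eadd D_escale)
    have hh: "homog n d h" using a b
      unfolding h_def homog_def supp_def eadd_def escale_def
      by (smt (verit) add.right_neutral mem_Collect_eq mult_zero_right)
    have aD: "a \<in> D n" and bD: "b \<in> D n" using a b by auto
    have "g h = eadd (g a) (escale (-1) (g b))"
      unfolding h_def g_add[OF aD D_escale[OF bD]] g_scale[OF bD] ..
    then have "g h = ezero" by (simp add: eq eadd_def escale_def ezero_def)
    from kernel_trivial[OF g_top hD hh d this] have "a m + (-1) * b m = 0" for m
      by (metis (no_types) eadd_def escale_def ezero_def h_def)
    then show "a = b" by (simp add: fun_eq_iff)
  qed
  moreover have "g ` ?V \<subseteq> ?V" using g_maps g_deg by auto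
  ultimately show "bij_betw g ?V ?V" using fin by (simp add: bij_betw_def endo_inj_surj)
qed

end
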